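(* Let $k\ge2$ be an integer, $n=2k$, and let $u\in C^2(\mathbb{R}^n)$ satisfy $$-D^2u\in\Gamma_k,\qquad \sigma_k(-D^2u)=e^u\quad\text{in }\mathbb{R}^n.\tag{E}$$ Suppose that, for some $C>0$ and some sequence $R_j\to\infty$, $$\int_{B_{R_j}}e^{-\frac{u}{k+1}}\,dx\le CR_j^{n+2}.$$ Then $$u(x)=\log\!\left(2^k(k+1)^k\binom{2k}{k}\lambda^k\right)-(k+1)\log\bigl(1+\lambda|x-x_0|^2\bigr)\tag{B}$$ for some $x_0\in\mathbb{R}^n$ and $\lambda>0$. Conversely, every function of the form (B) is an admissible solution of (E). Moreover, $$\int_{\mathbb{R}^n}e^u\,dx=\frac{2^k(k+1)^k\binom{2k}{k}\pi^k}{k!}.$$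
   Context: For a real symmetric $n\times n$ matrix $A$, $\sigma_j(A)$ is the $j$-th elementary symmetric function of its eigenvalues, and $\Gamma_k=\{A:\sigma_j(A)>0,\ 1\le j\le k\}$. "Admissible solution of (E)" means that both conditions in (E) hold. $B_R$ is the open Euclidean ball of radius $R$ centered at the origin. *)

theory Defs
  imports "HOL-Analysis.Analysis" "HOL-Computational_Algebra.Polynomial"
begin

definition charpoly :: "real ^ 'n ^ 'n \<Rightarrow> real poly" where
  "charpoly A = det (mat [:0, 1:] - map_matrix (\<lambda>c. [:c:]) A)"

text \<open>Real eigenvalues, repeated according to algebraic multiplicity. For a symmetric matrix
  these are all the eigenvalues, so the list has length \<open>CARD('n)\<close>.\<close>

definition eigenvalues :: "real ^ 'n ^ 'n \<Rightarrow> real list" where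
  "eigenvalues A = sorted_list_of_multiset (proots (charpoly A))"

definition elem_sym :: "nat \<Rightarrow> real list \<Rightarrow> real" where
  "elem_sym j xs = (\<Sum>S | S \<subseteq> {..<length xs} \<and> card S = j. \<Prod>i\<in>S. xs ! i)"

definition sigma :: "nat \<Rightarrow> real ^ 'n ^ 'n \<Rightarrow> real" where
  "sigma j A = elem_sym j (eigenvalues A)"

definition Gamma_cone :: "nat \<Rightarrow> (real ^ 'n ^ 'n) set" where
  "Gamma_cone k = {A. transpose A = A \<and> (\<forall>j\<in>{1..k}. sigma j A > 0)}"

definition grad :: "(real ^ 'n \<Rightarrow> real) \<Rightarrow> real ^ 'n \<Rightarrow> real ^ 'n" where
  "grad u x = (\<chi> i. frechet_derivative u (at x) (axis i 1))"

definition hessian :: "(real ^ 'n \<Rightarrow> real) \<Rightarrow> real ^ 'n \<Rightarrow> real ^ 'n ^ 'n" where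
  "hessian u x = matrix (frechet_derivative (grad u) (at x))"

definition C2 :: "(real ^ 'n \<Rightarrow> real) \<Rightarrow> bool" where
  "C2 u \<longleftrightarrow> u differentiable_on UNIV \<and> grad u differentiable_on UNIV
     \<and> continuous_on UNIV (hessian u)"

definition admissible_solution :: "nat \<Rightarrow> (real ^ 'n \<Rightarrow> real) \<Rightarrow> bool" where
  "admissible_solution k u \<longleftrightarrow> C2 u
     \<and> (\<forall>x. - hessian u x \<in> Gamma_cone k)
     \<and> (\<forall>x. sigma k (- hessian u x) = exp (u x))"

definition bubble :: "nat \<Rightarrow> real ^ 'n \<Rightarrow> real \<Rightarrow> real ^ 'n \<Rightarrow> real" where
  "bubble k x0 l x =
     ln (2 ^ k * (real k + 1) ^ k * real ((2 * k) choose k) * l ^ k)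
     - (real k + 1) * ln (1 + l * (norm (x - x0))\<^sup>2)"

end

theory Submission
  imports Defs
begin

text \<open>
  Put \<open>w = exp (- u / (k + 1))\<close>, \<open>p = \<nabla>w\<close>, \<open>H = D\<^sup>2w\<close>. The equation becomes
  \<open>w \<sigma>\<^sub>k(H) - T\<^sub>k\<^sub>-\<^sub>1(H)[p,p] = c\<close> with a constant \<open>c > 0\<close>, where \<open>T\<^sub>j\<close> denotes the Newton tensors, and
  the solutions sought are those with \<open>H\<close> a constant multiple of the identity. Since \<open>n = 2k\<close>, the field
  \<open>V = w\<^sup>-\<^sup>k\<^sup>-\<^sup>1 (2 w T\<^sub>k p - |p|\<^sup>2 T\<^sub>k\<^sub>-\<^sub>1 p - c p)\<close> vanishes on them, and substituting the equation into its
  divergence gives \<open>- w\<^sup>k div V = \<sigma>\<^sub>1 \<sigma>\<^sub>k - 2 (k + 1) \<sigma>\<^sub>k\<^sub>+\<^sub>1 + w\<^sup>-\<^sup>1 (|p|\<^sup>2 \<sigma>\<^sub>k - \<sigma>\<^sub>1 T\<^sub>k\<^sub>-\<^sub>1[p,p] + 2 (k - 1) T\<^sub>k[p,p])\<close>.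
  Newton's inequalities make this defect nonnegative, and it vanishes only if \<open>H\<close> is a multiple of the
  identity. They also bound \<open>V\<close> by the square root of the defect times a density whose integral over the
  ball of radius \<open>R\<close> is \<open>O(R\<^sup>2)\<close>; that bound is obtained from \<open>\<integral> w = O(R\<^sup>n\<^sup>+\<^sup>2)\<close> by iterated Caccioppoli
  estimates. Hence the integral of \<open>w\<^sup>-\<^sup>k\<close> times the defect is finite, and then zero.

  No third derivatives are needed: the Newton tensors of a \<open>C\<^sup>1\<close> gradient field are divergence free in
  the weak sense because \<open>x + t q(x)\<close> preserves a ball for small \<open>t\<close> when \<open>q\<close> is compactly supported, so
  that all the coefficients of \<open>\<integral> det (1 + t Dq)\<close> except the constant one vanish.
\<close>

section \<open>Real-rooted polynomials and Newton's inequalities\<close>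

text \<open>The power \<open>-1/(k+1)\<close> in \<open>w\<close> is the one for which all powers of
  \<open>w\<close> cancel from the equation and leave a constant. Since \<open>n = 2k\<close>, the
  Newton-Maclaurin inequality reads
  \<open>2 (k + 1) \<sigma>_(k+1) \<le> \<sigma>_1 \<sigma>_k\<close>, exactly the part of the
  defect without \<open>p\<close>; the part with \<open>p\<close> is handled by replacing
  \<open>w \<sigma>_k\<close> by \<open>c + T_(k-1)[p,p]\<close>, which leaves one Newton inequality
  for each removed eigenvalue. The growth hypothesis is critical: the squared cutoff gradient is
  \<open>O(R^-2)\<close> and the density integrates to \<open>O(R^2)\<close>, so absorption yields
  only a bounded integral. Vanishing comes from a second pass, in which the gradient is small on a
  fixed ball and the defect has little mass outside it. The estimates hold at every single radius at
  which the growth bound holds, with constants independent of it, so a sequence of radii suffices.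
  Symmetric functions of matrices are taken as coefficients of \<open>det (1 + tM)\<close> because
  the Jacobians of the test fields \<open>\<Psi> p\<close> are not symmetric; they are matched with
  the eigenvalue definition for symmetric matrices.\<close>

definition splits :: "real poly \<Rightarrow> bool" where
  "splits p \<longleftrightarrow> p \<noteq> 0 \<and> size (proots p) = degree p"

lemma splits_obtain_root:
  assumes "splits p" "degree p = Suc n"
  obtains a q where "p = [:-a, 1:] * q" "splits q" "degree q = n"
proof -
  from assms have "proots p \<noteq> {#}" by (auto simp: splits_def)
  then obtain a where "a \<in># proots p" by blast
  with assms have "poly p a = 0" by (auto simp: splits_def)
  then obtain q where q: "p = [:-a, 1:] * q" by (auto simp: poly_eq_0_iff_dvd)
  with assms have "q \<noteq> 0" by (auto simp: splits_def)
  have d: "degree p = Suc (degree q)"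
    unfolding q using \<open>q \<noteq> 0\<close> by (subst degree_mult_eq) auto
  have "proots p = {#a#} + proots q"
    unfolding q using \<open>q \<noteq> 0\<close> by (subst proots_mult) auto
  with assms d \<open>q \<noteq> 0\<close> have "splits q" by (simp add: splits_def)
  with q d assms show ?thesis by (intro that[of a q]) auto
qed

lemma pderiv_linear_factor_mult:
  "pderiv ([:-a, 1:] * q) = q + [:-a, 1:] * pderiv q" for q :: "real poly"
  unfolding pderiv_mult by (simp add: pderiv_pCons)

text \<open>Laguerre's inequality, by splitting off a root: \<open>n\<close> times the deficit in
  degree \<open>n + 1\<close> is a square plus a nonnegative multiple of the deficit in degree
  \<open>n\<close>. At \<open>x = 0\<close> it is Newton's inequality for the three lowest
  coefficients.\<close>

lemma splits_laguerre:
  "splits p \<Longrightarrow> degree p = n \<Longrightarrow> n \<ge> 1 \<Longrightarrow>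
     real n * (poly p x * poly (pderiv (pderiv p)) x) \<le> (real n - 1) * (poly (pderiv p) x)\<^sup>2"
proof (induction n arbitrary: p)
  case 0
  then show ?case by simp
next
  case (Suc n)
  obtain a q where q: "p = [:-a, 1:] * q" "splits q" "degree q = n"
    using splits_obtain_root[OF Suc.prems(1,2)] .
  show ?case
  proof (cases "n = 0")
    case True
    have "pderiv (pderiv p) = 0"
      using Suc.prems True by (simp add: pderiv_eq_0_iff degree_pderiv)
    then show ?thesis by (simp add: True)
  next
    case False
    define l where "l = x - a"
    define y0 y1 y2 where "y0 = poly q x" "y1 = poly (pderiv q) x" "y2 = poly (pderiv (pderiv q)) x"
    have IH: "real n * (y0 * y2) \<le> (real n - 1) * y1\<^sup>2"
      using Suc.IH[OF q(2,3)] False by (simp add: y0_y1_y2_def)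
    have e0: "poly p x = l * y0" by (simp add: q(1) l_def y0_y1_y2_def algebra_simps)
    have p1: "pderiv p = q + [:-a, 1:] * pderiv q"
      unfolding q(1) by (rule pderiv_linear_factor_mult)
    have e1: "poly (pderiv p) x = y0 + l * y1"
      by (simp add: p1 l_def y0_y1_y2_def algebra_simps)
    have p2: "pderiv (pderiv p) = 2 * pderiv q + [:-a, 1:] * pderiv (pderiv q)"
      unfolding p1 by (simp only: pderiv_add pderiv_linear_factor_mult)
    have e2: "poly (pderiv (pderiv p)) x = 2 * y1 + l * y2"
      unfolding p2 by (simp add: l_def y0_y1_y2_def algebra_simps)
    have n: "real n > 0" using False by simp
    have "real n * (n * (y0 + l * y1)\<^sup>2 - (n + 1) * (l * y0) * (2 * y1 + l * y2))
        = (n * y0 - l * y1)\<^sup>2 + (n + 1) * l\<^sup>2 * ((real n - 1) * y1\<^sup>2 - n * (y0 * y2))"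
      by (simp add: power2_eq_square algebra_simps)
    also have "\<dots> \<ge> 0"
      using IH by (intro add_nonneg_nonneg mult_nonneg_nonneg) auto
    finally have "n * (y0 + l * y1)\<^sup>2 - (n + 1) * (l * y0) * (2 * y1 + l * y2) \<ge> 0"
      using n by (simp add: zero_le_mult_iff)
    then show ?thesis by (simp add: e0 e1 e2 algebra_simps)
  qed
qed

text \<open>Rolle's theorem between consecutive roots. Disjointness from \<open>Z\<close> makes the
  count in \<open>splits_pderiv\<close> work: these zeros of the derivative come in addition to
  those at multiple roots of \<open>p\<close>.\<close>

lemma rolle_between_roots:
  fixes p :: "real poly"
  assumes "p \<noteq> 0"
  defines "Z \<equiv> {x. poly p x = 0}"
  obtains Y where "finite Y" "card Y \<ge> card Z - 1" "Y \<inter> Z = {}" "\<And>y. y \<in> Y \<Longrightarrow> poly (pderiv p) y = 0"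
proof (cases "Z = {}")
  case True
  then show ?thesis by (intro that[of "{}"]) auto
next
  case False
  have fin: "finite Z" using assms poly_roots_finite by blast
  define nxt where "nxt z = Min {z' \<in> Z. z < z'}" for z
  let ?Z = "Z - {Max Z}"
  have nxt: "nxt z \<in> Z \<and> z < nxt z \<and> (\<forall>z'\<in>Z. z < z' \<longrightarrow> nxt z \<le> z')" if "z \<in> ?Z" for z
  proof -
    have "Max Z \<in> {z' \<in> Z. z < z'}"
      using that fin False by (simp add: order_le_neq_trans)
    then have "{z' \<in> Z. z < z'} \<noteq> {}" by blast
    then have "nxt z \<in> {z' \<in> Z. z < z'}"
      unfolding nxt_def using fin by (intro Min_in) auto
    then show ?thesis using fin by (auto simp: nxt_def)
  qed
  have "\<exists>y. z < y \<and> y < nxt z \<and> poly (pderiv p) y = 0" if "z \<in> ?Z" for z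
  proof -
    have "poly p z = poly p (nxt z)"
      using nxt[OF that] that by (auto simp: Z_def)
    have "\<exists>y. z < y \<and> y < nxt z \<and> (*) (poly (pderiv p) y) = (\<lambda>v. 0)"
    proof (rule Rolle_deriv[where f' = "\<lambda>x. (*) (poly (pderiv p) x)"])
      show "(poly p has_derivative (*) (poly (pderiv p) x)) (at x)" for x
        using poly_DERIV[of p x] by (simp add: has_field_derivative_def)
    qed (use nxt[OF that] \<open>poly p z = _\<close> in \<open>auto intro!: continuous_intros\<close>)
    then show ?thesis by (metis mult.right_neutral)
  qed
  then obtain y where y: "\<And>z. z \<in> ?Z \<Longrightarrow> z < y z \<and> y z < nxt z \<and> poly (pderiv p) (y z) = 0"
    by metis
  have lt: "y z < y z'" if "z \<in> ?Z" "z' \<in> ?Z" "z < z'" for z z'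
  proof -
    have "y z < nxt z" "nxt z \<le> z'" "z' < y z'"
      using y[OF that(1)] y[OF that(2)] nxt[OF that(1)] that by auto
    then show ?thesis by linarith
  qed
  have "inj_on y ?Z"
    by (rule inj_onI) (metis lt less_irrefl linorder_neqE)
  then have "card (y ` ?Z) = card ?Z" by (rule card_image)
  also have "\<dots> = card Z - 1" using fin False by simp
  finally have c: "card (y ` ?Z) = card Z - 1" .
  have "y z \<notin> Z" if "z \<in> ?Z" for z
    using y[OF that] nxt[OF that] by fastforce
  with y c fin show ?thesis by (intro that[of "y ` ?Z"]) auto
qed

text \<open>A root of order \<open>m\<close> is a root of order \<open>m - 1\<close> of the
  derivative; these orders add up to \<open>degree p - card Z\<close>, and Rolle's theorem supplies
  \<open>card Z - 1\<close> further roots, which exhausts the degree.\<close>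

lemma splits_pderiv:
  assumes "splits p" "degree p \<ge> 1"
  shows "splits (pderiv p)"
proof -
  have p0: "p \<noteq> 0" using assms by (simp add: splits_def)
  have dp: "pderiv p \<noteq> 0" using assms by (simp add: pderiv_eq_0_iff)
  define Z where "Z = {x. poly p x = 0}"
  have fin: "finite Z" using p0 poly_roots_finite unfolding Z_def by blast
  have pos: "order z p \<ge> 1" if "z \<in> Z" for z
    using that p0 order_root[of p z] by (auto simp: Z_def)
  have size: "size (proots q) = (\<Sum>z\<in>{x. poly q x = 0}. order z q)" if "q \<noteq> 0" for q :: "real poly"
    using that by (simp add: size_multiset_overloaded_eq)
  have Zne: "Z \<noteq> {}"
  proof
    assume "Z = {}"
    then show False using size[OF p0] assms by (simp add: splits_def Z_def)
  qed
  obtain Y where Y: "finite Y" "card Y \<ge> card Z - 1" "Y \<inter> Z = {}"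
      "\<And>y. y \<in> Y \<Longrightarrow> poly (pderiv p) y = 0"
    using rolle_between_roots[OF p0] unfolding Z_def by metis
  have cardZ: "card Z \<ge> 1" using fin Zne by (simp add: Suc_le_eq card_gt_0_iff)
  have "(\<Sum>z\<in>Z. order z p) = (\<Sum>z\<in>Z. order z (pderiv p) + 1)"
  proof (intro sum.cong refl)
    fix z assume "z \<in> Z"
    then show "order z p = order z (pderiv p) + 1"
      using order_pderiv[OF p0, of z] by (simp add: Z_def)
  qed
  then have 1: "degree p = (\<Sum>z\<in>Z. order z (pderiv p)) + card Z"
    using assms size[OF p0] by (simp only: splits_def Z_def sum.distrib card_eq_sum)
  have "card Y \<le> (\<Sum>z\<in>Y. order z (pderiv p))"
  proof -
    have "(\<Sum>z\<in>Y. 1) \<le> (\<Sum>z\<in>Y. order z (pderiv p))"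
      using Y(4) dp by (intro sum_mono) (auto simp: order_root Suc_le_eq)
    then show ?thesis by simp
  qed
  moreover have "(\<Sum>z\<in>Z. order z (pderiv p)) + (\<Sum>z\<in>Y. order z (pderiv p))
      = (\<Sum>z\<in>Z \<union> Y. order z (pderiv p))"
    using Y fin by (subst sum.union_disjoint) auto
  moreover have "\<dots> = (\<Sum>z\<in>(Z \<union> Y) \<inter> {x. poly (pderiv p) x = 0}. order z (pderiv p))"
    using Y fin by (intro sum.mono_neutral_right) (auto simp: order_0I)
  moreover have "\<dots> \<le> (\<Sum>z\<in>{x. poly (pderiv p) x = 0}. order z (pderiv p))"
    using dp poly_roots_finite by (intro sum_mono2) auto
  ultimately have "degree p - 1 \<le> size (proots (pderiv p))"
    using 1 Y(2) cardZ size[OF dp] by linarith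
  moreover have "size (proots (pderiv p)) \<le> degree (pderiv p)" by (rule size_proots_le)
  ultimately show ?thesis using dp by (simp add: splits_def degree_pderiv)
qed

text \<open>Differentiation keeps the roots real, drops the lowest coefficient and multiplies the
  others by known factors. Repeating it turns the three coefficients into the lowest ones (the case
  \<open>j = n\<close>), where \<open>splits_laguerre\<close> at 0 applies.\<close>

lemma splits_newton:
  "splits p \<Longrightarrow> degree p = n \<Longrightarrow> 1 \<le> j \<Longrightarrow> j < n \<Longrightarrow>
     (real j + 1) * (real n - real j + 1) * (coeff p (n - (j - 1)) * coeff p (n - (j + 1)))
       \<le> real j * (real n - real j) * (coeff p (n - j))\<^sup>2"
proof (induction n arbitrary: p)
  case 0
  then show ?case by simp
next
  case (Suc n)
  show ?case
  proof (cases "j = n")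
    case True
    have "real (Suc n) * (poly p 0 * poly (pderiv (pderiv p)) 0) \<le> (real (Suc n) - 1) * (poly (pderiv p) 0)\<^sup>2"
      using splits_laguerre[OF Suc.prems(1,2), of 0] by simp
    moreover have "poly (pderiv (pderiv p)) 0 = 2 * coeff p 2" "poly (pderiv p) 0 = coeff p 1" "poly p 0 = coeff p 0"
      by (simp_all add: poly_0_coeff_0 coeff_pderiv numeral_2_eq_2)
    moreover have "Suc n - (j - 1) = 2" using True Suc.prems by simp
    ultimately show ?thesis using True by (simp add: algebra_simps)
  next
    case False
    with Suc.prems have j: "j < n" by simp
    have "splits (pderiv p)" "degree (pderiv p) = n"
      using splits_pderiv[OF Suc.prems(1)] Suc.prems by (auto simp: degree_pderiv)
    from Suc.IH[OF this Suc.prems(3) j]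
    have IH: "(real j + 1) * (real n - real j + 1) *
        (coeff (pderiv p) (n - (j - 1)) * coeff (pderiv p) (n - (j + 1)))
      \<le> real j * (real n - real j) * (coeff (pderiv p) (n - j))\<^sup>2" .
    define m where "m = n - j"
    have m: "m > 0" "n = m + j" using j by (auto simp: m_def)
    obtain i where i: "j = Suc i" using Suc.prems by (cases j) auto
    obtain m' where m': "m = Suc m'" using m by (cases m) auto
    have c: "coeff (pderiv p) (n - (j - 1)) = (real m + 2) * coeff p (Suc n - (j - 1))"
       "coeff (pderiv p) (n - (j + 1)) = real m * coeff p (Suc n - (j + 1))"
       "coeff (pderiv p) (n - j) = (real m + 1) * coeff p (Suc n - j)"
      using m(2) i m' by (simp_all add: coeff_pderiv algebra_simps eval_nat_numeral)
    define A B where "A = coeff p (Suc n - (j - 1)) * coeff p (Suc n - (j + 1))"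
      and "B = (coeff p (Suc n - j))\<^sup>2"
    have nm: "real n - real j = m" using m(2) by simp
    \<comment> \<open>The induction hypothesis for \<open>pderiv p\<close> is the wanted inequality
      for \<open>p\<close> times the positive factor \<open>m (m + 1)\<close>.\<close>
    have "(real m * (real m + 1)) * ((real j + 1) * (real m + 2) * A)
       \<le> (real m * (real m + 1)) * (real j * (real m + 1) * B)"
      using IH unfolding c nm A_def B_def
      by (simp only: power_mult_distrib power2_eq_square mult_ac)
    then have "(real j + 1) * (real m + 2) * A \<le> real j * (real m + 1) * B"
      using m(1) by (subst (asm) mult_le_cancel_left_pos) auto
    then show ?thesis unfolding A_def B_def using m(2) by (simp add: algebra_simps)
  qed
qed

section \<open>Elementary symmetric functions\<close>

text \<open>Encoded as a coefficient of the generating product, so that removing an index and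
  Euler-type sums become product and derivative rules for polynomials.\<close>

definition esym :: "'a set \<Rightarrow> ('a \<Rightarrow> real) \<Rightarrow> nat \<Rightarrow> real" where
  "esym S l j = coeff (\<Prod>i\<in>S. [:1, l i:]) j"

lemma esym_0 [simp]: "esym S l 0 = 1"
  unfolding esym_def by (induction S rule: infinite_finite_induct) auto

lemma esym_insert:
  assumes "finite S" "a \<notin> S"
  shows "esym (insert a S) l (Suc j) = esym S l (Suc j) + l a * esym S l j"
  using assms by (simp add: esym_def)

lemma esym_remove:
  assumes "finite S" "i \<in> S"
  shows "esym S l (Suc j) = esym (S - {i}) l (Suc j) + l i * esym (S - {i}) l j"
  using esym_insert[of "S - {i}" i l j] assms by (simp add: insert_absorb)

lemma esym_eq_0:
  assumes "finite S" "card S < j"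
  shows "esym S l j = 0"
proof -
  have "degree (\<Prod>i\<in>S. [:1, l i:]) \<le> (\<Sum>i\<in>S. 1)"
    using degree_prod_sum_le[OF assms(1), of "\<lambda>i. [:1, l i:]"]
    by (rule order_trans) (intro sum_mono, simp)
  then show ?thesis unfolding esym_def using assms by (intro coeff_eq_0) auto
qed

text \<open>Both sides are a coefficient of the derivative of the generating product, once by the
  product rule and once coefficientwise.\<close>

lemma sum_mult_esym_remove:
  assumes "finite S"
  shows "(\<Sum>i\<in>S. l i * esym (S - {i}) l j) = (real j + 1) * esym S l (Suc j)"
proof -
  have "(\<Sum>i\<in>S. l i * esym (S - {i}) l j) = coeff (pderiv (\<Prod>i\<in>S. [:1, l i:])) j"
    by (simp add: pderiv_prod coeff_sum esym_def pderiv_pCons)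
  also have "\<dots> = (real j + 1) * esym S l (Suc j)"
    by (simp add: coeff_pderiv esym_def algebra_simps)
  finally show ?thesis .
qed

lemma sum_esym_remove:
  assumes "finite S"
  shows "(\<Sum>i\<in>S. esym (S - {i}) l j) = (real (card S) - real j) * esym S l j"
proof (cases j)
  case (Suc m)
  have "(\<Sum>i\<in>S. esym (S - {i}) l (Suc m)) = (\<Sum>i\<in>S. esym S l (Suc m) - l i * esym (S - {i}) l m)"
    using esym_remove[OF assms] by (intro sum.cong) auto
  also have "\<dots> = real (card S) * esym S l (Suc m) - (real m + 1) * esym S l (Suc m)"
    by (simp add: sum_subtractf sum_mult_esym_remove[OF assms])
  finally show ?thesis using Suc by (simp add: algebra_simps)
qed simp

lemma esym_1: "finite S \<Longrightarrow> esym S l 1 = sum l S"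
  using sum_mult_esym_remove[of S l 0] by simp

text \<open>The reversed generating polynomial has monic factors, so its degree is
  \<open>card S\<close> even when some \<open>l i\<close> vanish; this is the form to which
  \<open>splits_newton\<close> applies.\<close>

lemma coeff_prod_linear_reverse:
  assumes "finite S"
  shows "j \<le> card S \<Longrightarrow> coeff (\<Prod>i\<in>S. [:l i, 1:]) (card S - j) = esym S l j"
  using assms
proof (induction S arbitrary: j rule: finite_induct)
  case empty
  then show ?case by (simp add: esym_def)
next
  case (insert a S)
  have deg: "degree (\<Prod>i\<in>S. [:l i, 1:]) \<le> card S"
    using degree_prod_sum_le[OF insert(1), of "\<lambda>i. [:l i, 1:]"] by simp
  show ?case
  proof (cases j)
    case 0
    have "coeff (\<Prod>i\<in>S. [:l i, 1:]) (Suc (card S)) = 0"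
      using deg by (intro coeff_eq_0) auto
    then show ?thesis using 0 insert.IH[of 0] insert.hyps by simp
  next
    case (Suc m)
    show ?thesis
    proof (cases "m = card S")
      case True
      then show ?thesis
        using insert.IH[of m] insert Suc esym_eq_0[of S "Suc m" l] by (simp add: esym_insert)
    next
      case False
      then obtain r where r: "card S - m = Suc r" "card S - Suc m = r"
        using insert Suc by (metis Suc_diff_Suc card_insert_disjoint Suc_le_mono le_neq_implies_less)
      have "Suc m \<le> card S" using False insert Suc by simp
      then show ?thesis
        using insert.IH[of m] insert.IH[of "Suc m"] insert.hyps Suc r by (simp add: esym_insert)
    qed
  qed
qed

lemma splits_prod_linear:
  assumes "finite S"
  shows "splits (\<Prod>i\<in>S. [:l i, 1:])" "degree (\<Prod>i\<in>S. [:l i, 1:]) = card S"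
proof -
  have ne: "(\<Prod>i\<in>S. [:l i, 1:]) \<noteq> 0" using assms by simp
  show d: "degree (\<Prod>i\<in>S. [:l i, 1:]) = card S"
    using assms by (subst degree_prod_eq_sum_degree) auto
  have "size (proots (\<Prod>i\<in>S. [:l i, 1:])) = card S"
    by (subst proots_prod) (auto simp: size_multiset_sum)
  with ne d show "splits (\<Prod>i\<in>S. [:l i, 1:])" by (simp add: splits_def)
qed

lemma esym_newton:
  assumes "finite S" "Suc j < card S"
  shows "(real j + 2) * (real (card S) - real j) * (esym S l j * esym S l (Suc (Suc j)))
       \<le> (real j + 1) * (real (card S) - real j - 1) * (esym S l (Suc j))\<^sup>2"
  using splits_newton[OF splits_prod_linear[OF assms(1), of l], of "Suc j"] assms
    coeff_prod_linear_reverse[OF assms(1), of _ l]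
  by (simp add: algebra_simps)

text \<open>The constants of \<open>esym_newton\<close> satisfy \<open>b \<le> a\<close>; when the
  left side is not positive, or the last factor vanishes because its order exceeds
  \<open>card S\<close>, nothing is left to prove.\<close>

lemma esym_newton_weak:
  assumes "finite S"
  shows "esym S l j * esym S l (Suc (Suc j)) \<le> (esym S l (Suc j))\<^sup>2"
proof (cases "Suc j < card S \<and> esym S l j * esym S l (Suc (Suc j)) > 0")
  case True
  define x y a b where "x = esym S l j * esym S l (Suc (Suc j))" and "y = (esym S l (Suc j))\<^sup>2"
    and "a = (real j + 2) * (real (card S) - real j)" and "b = (real j + 1) * (real (card S) - real j - 1)"
  have x: "x > 0" and b: "b > 0" and ba: "b \<le> a"
    using True by (auto simp: x_def a_def b_def intro!: mult_mono)
  have "a * x \<le> b * y" using esym_newton[OF assms, of j l] True by (simp add: x_def y_def a_def b_def)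
  moreover have "b * x \<le> a * x" using ba x by simp
  ultimately have "b * x \<le> b * y" by linarith
  then have "x \<le> y" using b by simp
  then show ?thesis by (simp add: x_def y_def)
next
  case False
  then have "esym S l j * esym S l (Suc (Suc j)) \<le> 0"
    using esym_eq_0[OF assms, of "Suc (Suc j)" l] by (auto simp: not_less)
  then show ?thesis using zero_le_power2[of "esym S l (Suc j)"] by linarith
qed

text \<open>The key monotonicity of the cone. If \<open>b \<le> 0\<close>, then
  \<open>b + x a > 0\<close> and \<open>c + x b > 0\<close> give
  \<open>b^2 + a b x \<le> 0 < a c + a b x\<close>, which contradicts Newton's inequality
  \<open>a c \<le> b^2\<close> for the remaining values.\<close>

lemma esym_remove_pos:
  assumes S: "finite S" "i \<in> S" and pos: "\<And>j. j \<le> k \<Longrightarrow> esym S l j > 0"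
  shows "j < k \<Longrightarrow> esym (S - {i}) l j > 0"
proof (induction j)
  case 0
  then show ?case by simp
next
  case (Suc j)
  define a b c x where "a = esym (S - {i}) l j" and "b = esym (S - {i}) l (Suc j)"
    and "c = esym (S - {i}) l (Suc (Suc j))" and "x = l i"
  have a: "a > 0" using Suc by (simp add: a_def)
  have 1: "b + x * a > 0" and 2: "c + x * b > 0"
    using pos[of "Suc j"] pos[of "Suc (Suc j)"] Suc.prems esym_remove[OF S, of l]
    by (simp_all add: a_def b_def c_def x_def)
  have n: "a * c \<le> b\<^sup>2"
    using esym_newton_weak[of "S - {i}" l j] S by (simp add: a_def b_def c_def)
  show ?case
  proof (rule ccontr)
    assume "\<not> ?thesis"
    then have b: "b \<le> 0" by (simp add: b_def)
    have "b * (b + x * a) \<le> 0" using b 1 by (simp add: mult_nonpos_nonneg)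
    moreover have "a * (c + x * b) > 0" using a 2 by simp
    ultimately have "b\<^sup>2 < a * c" by (simp add: power2_eq_square algebra_simps)
    with n show False by simp
  qed
qed

text \<open>Newton's inequality at order \<open>k + 1\<close> chained with the bound at order
  \<open>k\<close>. Every link is an equality if the end result is, so equality descends to order 2,
  where it can be exploited.\<close>

lemma newton_maclaurin:
  assumes S: "finite S" and pos: "\<And>j. j \<le> k \<Longrightarrow> esym S l j > 0" and k: "k < card S"
  shows "(real k + 1) * real (card S) * esym S l (Suc k) \<le> (real (card S) - real k) * (esym S l 1 * esym S l k)"
    and "k \<ge> 1 \<Longrightarrow> (real k + 1) * real (card S) * esym S l (Suc k) = (real (card S) - real k) * (esym S l 1 * esym S l k)
      \<Longrightarrow> 2 * real (card S) * esym S l 2 = (real (card S) - 1) * (esym S l 1)\<^sup>2"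
  using pos k
proof (induction k)
  case 0
  { case 1 then show ?case by simp next case 2 then show ?case by simp }
next
  case (Suc k)
  define n where "n = real (card S)"
  define a b c e where "a = esym S l k" and "b = esym S l (Suc k)" and "c = esym S l (Suc (Suc k))"
    and "e = esym S l 1"
  have step: "(k + 2) * n * c \<le> (n - k - 1) * (e * b) \<and>
      ((k + 2) * n * c = (n - k - 1) * (e * b) \<longrightarrow> (k + 1) * n * b = (n - k) * (e * a))"
    if pos: "\<And>j. j \<le> Suc k \<Longrightarrow> esym S l j > 0" and k: "Suc k < card S"
      and IH: "(k + 1) * n * b \<le> (n - k) * (e * a)"
  proof -
    have p: "a > 0" "b > 0" "n - k > 0" "n - k - 1 > 0" "n > 0"
      using pos[of k] pos[of "Suc k"] k by (simp_all add: a_def b_def n_def)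
    have nw: "(k + 2) * (n - k) * (a * c) \<le> (k + 1) * (n - k - 1) * b\<^sup>2"
      using esym_newton[OF S k, of l] by (simp add: a_def b_def c_def n_def add_ac)
    define m where "m = (n - k) * a"
    have m: "m > 0" using p by (simp add: m_def)
    have 1: "m * ((k + 2) * n * c) \<le> ((n - k - 1) * b) * ((k + 1) * n * b)"
      using mult_left_mono[OF nw, of n] p by (simp add: m_def power2_eq_square mult_ac)
    have 2: "((n - k - 1) * b) * ((k + 1) * n * b) \<le> ((n - k - 1) * b) * ((n - k) * (e * a))"
      using IH p by (intro mult_left_mono) auto
    have 3: "((n - k - 1) * b) * ((n - k) * (e * a)) = m * ((n - k - 1) * (e * b))"
      by (simp add: m_def)
    have "(k + 2) * n * c \<le> (n - k - 1) * (e * b)"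
      using order_trans[OF 1 2[unfolded 3]] m by (simp only: mult_le_cancel_left_pos)
    moreover have "(k + 1) * n * b = (n - k) * (e * a)"
      if eq: "(k + 2) * n * c = (n - k - 1) * (e * b)"
    proof -
      have "((n - k - 1) * b) * ((k + 1) * n * b) = ((n - k - 1) * b) * ((n - k) * (e * a))"
        using 1 2 3 unfolding eq by linarith
      then show ?thesis using p by simp
    qed
    ultimately show ?thesis by blast
  qed
  { case 1
    have IH: "(k + 1) * n * b \<le> (n - k) * (e * a)"
      using Suc.IH(1) 1 by (simp add: n_def a_def b_def e_def add_ac)
    show ?case using step[OF _ _ IH] 1 by (simp add: n_def b_def c_def e_def algebra_simps)
  next
    case 2
    have IH: "(k + 1) * n * b \<le> (n - k) * (e * a)"
      using Suc.IH(1) 2 by (simp add: n_def a_def b_def e_def add_ac)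
    have "(k + 2) * n * c = (n - k - 1) * (e * b)"
      using 2 by (simp add: n_def b_def c_def e_def algebra_simps)
    then have eq: "(k + 1) * n * b = (n - k) * (e * a)"
      using step[OF _ _ IH] 2 by blast
    show ?case
    proof (cases "k = 0")
      case True
      then show ?thesis using 2 by (simp add: numeral_2_eq_2 power2_eq_square)
    next
      case False
      then show ?thesis using Suc.IH(2) eq 2 by (simp add: n_def a_def b_def e_def add_ac)
    qed
  }
qed

text \<open>The hypothesis says that the variance vanishes: the sum of
  \<open>(l i - e / n)^2\<close> is \<open>((n - 1) e^2 - 2 n \<sigma>_2) / n\<close>.\<close>

lemma all_equal_if_newton_eq:
  assumes S: "finite S" "i \<in> S"
    and eq: "2 * real (card S) * esym S l 2 = (real (card S) - 1) * (esym S l 1)\<^sup>2"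
  shows "l i = esym S l 1 / card S"
proof -
  define n e where "n = real (card S)" and "e = esym S l 1"
  have n: "n > 0" using S by (auto simp: n_def card_gt_0_iff)
  have e: "e = sum l S" using esym_1[OF S(1)] by (simp add: e_def)
  have r: "esym (S - {i}) l 1 = e - l i" if "i \<in> S" for i
    using esym_remove[OF S(1) that, of l 0] by (simp add: e_def)
  have "(\<Sum>i\<in>S. l i * (e - l i)) = 2 * esym S l 2"
    using sum_mult_esym_remove[OF S(1), of l 1] r by (simp add: numeral_2_eq_2)
  moreover have "(\<Sum>i\<in>S. l i * (e - l i)) = e * e - (\<Sum>i\<in>S. (l i)\<^sup>2)"
    unfolding e by (simp add: right_diff_distrib sum_subtractf power2_eq_square sum_distrib_right)
  ultimately have q: "(\<Sum>i\<in>S. (l i)\<^sup>2) = e\<^sup>2 - 2 * esym S l 2"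
    by (simp add: power2_eq_square)
  have "(\<Sum>i\<in>S. (l i - e / n)\<^sup>2) = (\<Sum>i\<in>S. (l i)\<^sup>2 - (2 * e / n) * l i + (e / n)\<^sup>2)"
    by (intro sum.cong refl) (simp add: power2_eq_square algebra_simps)
  also have "\<dots> = (\<Sum>i\<in>S. (l i)\<^sup>2) - (2 * e / n) * e + n * (e / n)\<^sup>2"
    by (simp only: sum.distrib sum_subtractf e n_def sum_distrib_left) simp
  also have "\<dots> = ((n - 1) * e\<^sup>2 - 2 * n * esym S l 2) / n"
    using n unfolding q by (simp add: field_simps power2_eq_square)
  also have "\<dots> = 0" using eq by (simp add: n_def e_def)
  finally have "(l i - e / n)\<^sup>2 = 0"
    using S by (subst (asm) sum_nonneg_eq_0_iff) auto
  then show ?thesis by (simp add: n_def e_def)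
qed

section \<open>Spectral theorem and rank-one perturbations\<close>

lemma dot_symmetric_matrix:
  fixes A :: "real^'n^'n"
  assumes "transpose A = A"
  shows "x \<bullet> (A *v y) = (A *v x) \<bullet> y"
  using dot_lmul_matrix[of x A y] assms by (metis vector_transpose_matrix)

text \<open>A maximizer \<open>v\<close> of the Rayleigh quotient on the unit sphere of
  \<open>S\<close> is an eigenvector. The residual \<open>y = A v - m v\<close> is orthogonal to
  \<open>v\<close>, and moving from \<open>v\<close> by \<open>t y\<close> changes the form to first
  order by \<open>2 t |y|^2\<close>, which maximality allows only if \<open>y = 0\<close>.\<close>

lemma quadratic_max_eigenvector:
  fixes A :: "real^'n^'n"
  assumes sym: "transpose A = A" and S: "subspace S" and inv: "\<And>x. x \<in> S \<Longrightarrow> A *v x \<in> S"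
    and ne: "z \<in> S" "z \<noteq> 0"
  obtains v m where "v \<in> S" "norm v = 1" "A *v v = m *\<^sub>R v"
proof -
  note sa = dot_symmetric_matrix[OF sym]
  let ?K = "S \<inter> sphere 0 1"
  have "compact ?K"
    using closed_subspace[OF S] by (simp add: closed_Int_compact)
  moreover have "z /\<^sub>R norm z \<in> ?K" using ne S by (simp add: subspace_scale)
  then have "?K \<noteq> {}" by blast
  moreover have "continuous_on ?K (\<lambda>x. x \<bullet> (A *v x))"
    by (intro continuous_intros matrix_vector_mult_linear_continuous_on)
  ultimately obtain v where v: "v \<in> S" "norm v = 1" and max: "\<And>y. y \<in> ?K \<Longrightarrow> y \<bullet> (A *v y) \<le> v \<bullet> (A *v v)"
    using continuous_attains_sup[of ?K "\<lambda>x. x \<bullet> (A *v x)"] by (metis IntE mem_sphere_0)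
  define m where "m = v \<bullet> (A *v v)"
  have vv: "v \<bullet> v = 1" using v by (simp add: dot_square_norm)
  have le: "y \<bullet> (A *v y) \<le> m * (y \<bullet> y)" if y: "y \<in> S" for y
  proof (cases "y = 0")
    case False
    let ?y = "y /\<^sub>R norm y"
    have "?y \<bullet> (A *v ?y) \<le> m"
      using max[of ?y] y S False by (simp add: m_def subspace_scale)
    then have "(y \<bullet> (A *v y)) / (norm y)\<^sup>2 \<le> m"
      by (simp add: matrix_vector_mult_scaleR power2_eq_square divide_simps)
    then show ?thesis using False by (simp add: divide_simps dot_square_norm split: if_splits)
  qed (simp add: matrix_vector_mult_0_right)
  define y where "y = A *v v - m *\<^sub>R v"
  have yS: "y \<in> S" unfolding y_def using inv v S by (intro subspace_diff subspace_scale) auto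
  have "v \<bullet> y = 0" unfolding y_def m_def inner_diff_right inner_scaleR_right vv by simp
  then have yv: "y \<bullet> v = 0" by (simp only: inner_commute)
  have Ay: "(A *v v) \<bullet> y = y \<bullet> y"
  proof -
    have "A *v v = y + m *\<^sub>R v" by (simp add: y_def)
    then show ?thesis using yv by (simp add: inner_add_left inner_commute[of v y])
  qed
  define b where "b = m * (y \<bullet> y) - y \<bullet> (A *v y)"
  have ineq: "2 * t * (y \<bullet> y) \<le> t\<^sup>2 * b" for t
  proof -
    have le': "(v + t *\<^sub>R y) \<bullet> (A *v (v + t *\<^sub>R y)) \<le> m * ((v + t *\<^sub>R y) \<bullet> (v + t *\<^sub>R y))"
      using le[of "v + t *\<^sub>R y"] v yS S by (simp add: subspace_add subspace_scale)
    have e1: "(v + t *\<^sub>R y) \<bullet> (A *v (v + t *\<^sub>R y)) = m + 2 * t * (y \<bullet> y) + t\<^sup>2 * (y \<bullet> (A *v y))"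
      using Ay sa[of v y]
      by (simp add: matrix_vector_right_distrib matrix_vector_mult_scaleR inner_add_left inner_add_right
          m_def power2_eq_square inner_commute[of y "A *v v"] distrib_left)
    have e2: "(v + t *\<^sub>R y) \<bullet> (v + t *\<^sub>R y) = 1 + t\<^sup>2 * (y \<bullet> y)"
      using yv by (simp add: inner_add_left inner_add_right vv power2_eq_square inner_commute[of v y])
    show ?thesis using le' unfolding e1 e2 b_def by (simp add: algebra_simps)
  qed
  have "y \<bullet> y \<le> 0"
  proof (rule ccontr)
    assume "\<not> ?thesis"
    then have p: "y \<bullet> y > 0" by linarith
    \<comment> \<open>Any \<open>t > 0\<close> with \<open>t b < 2 |y|^2\<close> contradicts
      \<open>ineq\<close>; the added 1 keeps the denominator positive when
      \<open>b = 0\<close>.\<close>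
    define t where "t = (y \<bullet> y) / (\<bar>b\<bar> + 1)"
    have t: "t > 0" using p by (simp add: t_def)
    have "t * (\<bar>b\<bar> + 1) = y \<bullet> y" by (simp add: t_def)
    then have "t * \<bar>b\<bar> = y \<bullet> y - t" by (simp add: algebra_simps)
    then have "t * \<bar>b\<bar> < 2 * (y \<bullet> y)" using p t by linarith
    moreover have "t * b \<le> t * \<bar>b\<bar>" using t by (intro mult_left_mono) auto
    ultimately have "t * b < 2 * (y \<bullet> y)" by linarith
    then have "t * (t * b) < t * (2 * (y \<bullet> y))" using t by (intro mult_strict_left_mono)
    with ineq[of t] show False by (simp add: power2_eq_square algebra_simps)
  qed
  then have "y = 0" by (simp add: inner_gt_zero_iff not_less[symmetric])
  with v show ?thesis by (intro that[of v m]) (auto simp: y_def)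
qed

definition diagm :: "('n \<Rightarrow> real) \<Rightarrow> real^'n^'n" where
  "diagm l = (\<chi> i j. if i = j then l i else 0)"

text \<open>A largest orthonormal set of eigenvectors spans: otherwise its orthogonal complement is
  a nonzero invariant subspace, which contains one more unit eigenvector. Largest sets exist since
  independence bounds the size.\<close>

lemma spectral_theorem:
  fixes A :: "real^'n^'n"
  assumes sym: "transpose A = A"
  obtains Q l where "orthogonal_matrix Q" "A = Q ** diagm l ** transpose Q"
proof -
  define P where "P B \<longleftrightarrow> finite B \<and> pairwise orthogonal B \<and> (\<forall>b\<in>B. norm b = 1 \<and> (\<exists>m. A *v b = m *\<^sub>R b))"
    for B :: "(real^'n) set"
  have ind: "independent B" if "P B" for B
    using that by (intro pairwise_orthogonal_independent) (auto simp: P_def)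
  have bd: "card B \<le> CARD('n)" if "P B" for B
    using independent_bound[OF ind[OF that]] by simp
  have "P {}" by (simp add: P_def)
  then have "\<exists>B. P B \<and> (\<forall>B'. P B' \<longrightarrow> card B' \<le> card B)"
    using ex_has_greatest_nat[of P "{}" card "Suc CARD('n)"] bd by (auto simp: less_Suc_eq_le)
  then obtain B where B: "P B" and mx: "\<And>B'. P B' \<Longrightarrow> card B' \<le> card B" by blast
  have "span B = UNIV"
  proof (rule ccontr)
    assume "span B \<noteq> UNIV"
    then obtain z where z: "z \<noteq> 0" "\<And>x. x \<in> span B \<Longrightarrow> z \<bullet> x = 0"
      using span_not_UNIV_orthogonal by blast
    let ?S = "{x. \<forall>b\<in>B. b \<bullet> x = 0}"
    have "subspace ?S" by (auto simp: subspace_def inner_add_right)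
    moreover have "A *v x \<in> ?S" if "x \<in> ?S" for x
    proof -
      have "b \<bullet> (A *v x) = 0" if "b \<in> B" for b
      proof -
        have "\<exists>m. A *v b = m *\<^sub>R b" using B that by (simp add: P_def)
        then obtain m where "A *v b = m *\<^sub>R b" ..
        then have "b \<bullet> (A *v x) = m * (b \<bullet> x)"
          by (simp add: dot_symmetric_matrix[OF sym])
        then show ?thesis using \<open>x \<in> ?S\<close> that by simp
      qed
      then show ?thesis by blast
    qed
    moreover have "z \<in> ?S" using z span_base by (auto simp: inner_commute)
    ultimately obtain v m where v: "v \<in> ?S" "norm v = 1" "A *v v = m *\<^sub>R v"
      using quadratic_max_eigenvector[OF sym, of ?S z] z(1) by blast
    have "v \<notin> B" using v by (auto simp: dot_square_norm)
    have "P (insert v B)"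
      using B v by (auto simp: P_def pairwise_insert orthogonal_def inner_commute)
    then show False using mx[of "insert v B"] \<open>v \<notin> B\<close> B by (auto simp: P_def)
  qed
  then have "card B = CARD('n)"
    using ind[OF B] by (metis dim_UNIV DIM_cart DIM_real mult.right_neutral dim_eq_card_independent dim_span)
  then obtain h where h: "bij_betw h (UNIV :: 'n set) B"
    using B finite_same_card_bij[of "UNIV :: 'n set" B] by (auto simp: P_def)
  have hB: "h i \<in> B" for i using h by (auto simp: bij_betw_def)
  obtain l where l: "\<And>i. A *v h i = l i *\<^sub>R h i"
  proof -
    have "\<forall>i. \<exists>m. A *v h i = m *\<^sub>R h i" using B hB by (simp add: P_def)
    then show ?thesis using that by metis
  qed
  have orth: "pairwise orthogonal B" and unit: "\<And>b. b \<in> B \<Longrightarrow> norm b = 1"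
    using B by (simp_all add: P_def)
  define Q :: "real^'n^'n" where "Q = (\<chi> i j. h j $ i)"
  have col: "column j Q = h j" for j by (simp add: Q_def column_def vec_eq_iff)
  have Q: "orthogonal_matrix Q"
    unfolding orthogonal_matrix_orthonormal_columns col
  proof (intro conjI allI impI)
    show "norm (h i) = 1" for i using unit[OF hB] .
    fix i j :: 'n assume "i \<noteq> j"
    then have "h i \<noteq> h j" using h by (auto simp: bij_betw_def inj_on_def)
    then show "orthogonal (h i) (h j)" using orth hB by (auto simp: pairwise_def)
  qed
  have "(A ** Q) $ i $ j = (Q ** diagm l) $ i $ j" for i j
  proof -
    have "(A ** Q) $ i $ j = (A *v h j) $ i"
      by (simp add: matrix_matrix_mult_def matrix_vector_mult_def Q_def)
    also have "\<dots> = h j $ i * l j" by (simp add: l)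
    also have "\<dots> = (Q ** diagm l) $ i $ j"
      by (simp add: matrix_matrix_mult_def Q_def diagm_def if_distrib cong: if_cong)
    finally show ?thesis .
  qed
  then have "A ** Q = Q ** diagm l" by (simp add: vec_eq_iff)
  then have "A = Q ** diagm l ** transpose Q"
    using Q by (metis matrix_mul_assoc matrix_mul_rid orthogonal_matrix_def)
  with Q show ?thesis by (rule that)
qed

section \<open>Determinants of rank-one perturbations\<close>

lemma det_unit_rows_replaced:
  fixes b :: "real^'n"
  shows "det ((\<chi> i. if i = k then b else d i *s axis i 1) :: real^'n^'n) = b $ k * prod d (UNIV - {k})"
proof -
  let ?c = "\<lambda>i. if i = k then 1 else d i"
  have "((\<chi> i. if i = k then b else d i *s axis i 1) :: real^'n^'n) =
      (\<chi> i. ?c i *s (if i = k then b else axis i 1))"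
    by (simp add: vec_eq_iff)
  then have "det ((\<chi> i. if i = k then b else d i *s axis i 1) :: real^'n^'n) =
      prod ?c UNIV * det ((\<chi> i. if i = k then b else axis i 1) :: real^'n^'n)"
    by (simp only: det_rows_mul)
  also have "prod ?c UNIV = prod d (UNIV - {k})"
    by (subst prod.remove[of _ k]) (auto intro!: prod.cong)
  also have "((\<chi> i. if i = k then b else axis i 1) :: real^'n^'n) =
     (\<chi> i. if i = k then sum (\<lambda>i. b $ i *s row i (mat 1 :: real^'n^'n)) UNIV else row i (mat 1))"
    by (simp add: vec_eq_iff row_def mat_def axis_def if_distrib cong: if_cong)
  also have "det \<dots> = b $ k"
    by (subst cramer_lemma_transpose) simp
  finally show ?thesis by simp
qed

text \<open>A division-free matrix determinant lemma, valid also where the diagonal matrix is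
  singular. The perturbation is switched on row by row; expanding in row \<open>k\<close> leaves a
  determinant whose row \<open>k\<close> is \<open>b\<close>, and multiples of that row remove the
  earlier perturbations (\<open>clear\<close>).\<close>

lemma det_diagm_rank_one:
  fixes a b :: "real^'n"
  shows "det (diagm d + (\<chi> i j. a $ i * b $ j)) = prod d UNIV + (\<Sum>i\<in>UNIV. a $ i * b $ i * prod d (UNIV - {i}))"
proof -
  define r where "r S i = (if i \<in> S then d i *s axis i 1 + a $ i *s b else d i *s axis i 1)" for S and i :: 'n
  have clear: "det ((\<chi> i. if i = k then b else r T i) :: real^'n^'n) = b $ k * prod d (UNIV - {k})"
    if "finite T" "k \<notin> T" for k T
    using that
  proof (induction T rule: finite_induct)
    case empty
    show ?case using det_unit_rows_replaced[of k b d] by (simp add: r_def cong: if_cong)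
  next
    case (insert x T)
    let ?A = "(\<chi> i. if i = k then b else r T i) :: real^'n^'n"
    have "x \<noteq> k" using insert by auto
    have "(\<chi> i. if i = k then b else r (insert x T) i) =
        (\<chi> i. if i = x then row x ?A + a $ x *s row k ?A else row i ?A)"
      using insert \<open>x \<noteq> k\<close> by (auto simp: vec_eq_iff row_def r_def)
    then have "det (\<chi> i. if i = k then b else r (insert x T) i) = det ?A"
      by (simp only: det_row_operation[OF \<open>x \<noteq> k\<close>])
    then show ?case using insert by simp
  qed
  have main: "det ((\<chi> i. r S i) :: real^'n^'n) = prod d UNIV + (\<Sum>i\<in>S. a $ i * b $ i * prod d (UNIV - {i}))"
    if "finite S" for S
    using that
  proof (induction S rule: finite_induct)
    case empty
    have "(\<chi> i. r {} i) = diagm d"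
      by (auto simp: r_def diagm_def vec_eq_iff axis_def)
    moreover have "det (diagm d) = prod d UNIV"
      by (subst det_diagonal) (auto simp: diagm_def)
    ultimately show ?case by simp
  next
    case (insert k S)
    have 1: "(\<chi> i. r (insert k S) i) = (\<chi> i. if i = k then d i *s axis i 1 + a $ i *s b else r S i)"
      by (auto simp: vec_eq_iff r_def)
    have 2: "(\<chi> i. if i = k then d i *s axis i 1 else r S i) = (\<chi> i. r S i)"
      using insert by (auto simp: vec_eq_iff r_def)
    have 3: "(\<chi> i. if i = k then a $ i *s b else r S i) = (\<chi> i. if i = k then a $ k *s b else r S i)"
      by (auto simp: vec_eq_iff)
    have "det ((\<chi> i. r (insert k S) i) :: real^'n^'n) = det ((\<chi> i. r S i) :: real^'n^'n)
        + a $ k * det ((\<chi> i. if i = k then b else r S i) :: real^'n^'n)"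
      unfolding 1 det_row_add 2 3 det_row_mul ..
    then show ?case using insert clear[of S k] by (simp add: algebra_simps)
  qed
  have eq: "(\<chi> i. r UNIV i) = diagm d + (\<chi> i j. a $ i * b $ j)"
    by (auto simp: r_def diagm_def vec_eq_iff axis_def)
  show ?thesis using main[of UNIV] unfolding eq by simp
qed

section \<open>Symmetric functions of the eigenvalues as polynomials in the matrix entries\<close>

text \<open>This is \<open>det (1 + tM)\<close> as a polynomial in \<open>t\<close>. Its
  coefficients are defined for nonsymmetric matrices too and are polynomials in the entries, hence
  continuous, which is not visible from a sorted list of eigenvalues.\<close>

definition detpoly :: "real^'n^'n \<Rightarrow> real poly" where
  "detpoly M = det (\<chi> i j. [:mat 1 $ i $ j, M $ i $ j:])"

definition csig :: "nat \<Rightarrow> real^'n^'n \<Rightarrow> real" where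
  "csig j M = coeff (detpoly M) j"

definition outer :: "real^'n \<Rightarrow> real^'n \<Rightarrow> real^'n^'n" where
  "outer a b = (\<chi> i j. a $ i * b $ j)"

lemma poly_det: "poly (det M) x = det (\<chi> i j. poly (M $ i $ j) x)" for M :: "real poly^'n^'n"
  by (simp add: det_def poly_sum poly_prod)

lemma poly_detpoly: "poly (detpoly M) t = det (mat 1 + t *\<^sub>R M)"
  unfolding detpoly_def poly_det by (rule arg_cong[of _ _ det]) (simp add: vec_eq_iff)

lemma detpoly_unique: "(\<And>t. poly P t = det (mat 1 + t *\<^sub>R M)) \<Longrightarrow> detpoly M = P"
  by (subst poly_eq_poly_eq_iff[symmetric]) (auto simp: poly_detpoly)

lemma degree_detpoly_le: "degree (detpoly (M :: real^'n^'n)) \<le> CARD('n)"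
proof -
  have "degree (of_int (sign p) * (\<Prod>i\<in>UNIV. [:mat 1 $ i $ p i, M $ i $ p i:])) \<le> CARD('n)" for p
  proof -
    have "degree (\<Prod>i\<in>UNIV. [:mat 1 $ i $ p i, M $ i $ p i:]) \<le> (\<Sum>i\<in>(UNIV::'n set). 1)"
      using degree_prod_sum_le[OF finite, of "\<lambda>i. [:mat 1 $ i $ p i, M $ i $ p i:]" "UNIV :: 'n set"]
      by (rule order_trans) (intro sum_mono, simp)
    then show ?thesis by (simp add: of_int_poly)
  qed
  then show ?thesis unfolding detpoly_def det_def by (intro degree_sum_le) auto
qed

lemma csig_0 [simp]: "csig 0 M = 1"
  using poly_detpoly[of M 0] by (simp add: csig_def poly_0_coeff_0)

lemma det_eq_sum_csig: "det (mat 1 + t *\<^sub>R M) = (\<Sum>j\<le>CARD('n). csig j M * t ^ j)" for M :: "real^'n^'n"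
proof -
  have "poly (detpoly M) t = (\<Sum>j\<le>degree (detpoly M). csig j M * t ^ j)"
    by (simp add: poly_altdef csig_def)
  also have "\<dots> = (\<Sum>j\<le>CARD('n). csig j M * t ^ j)"
    using degree_detpoly_le[of M] by (intro sum.mono_neutral_left) (auto simp: csig_def coeff_eq_0)
  finally show ?thesis by (simp add: poly_detpoly)
qed

lemma continuous_on_coeff_prod_linear:
  assumes "finite I" "\<And>i. i \<in> I \<Longrightarrow> continuous_on X (a i)" "\<And>i. i \<in> I \<Longrightarrow> continuous_on X (b i)"
  shows "continuous_on X (\<lambda>x. coeff (\<Prod>i\<in>I. [:a i x, b i x :: real:]) j)"
  using assms
proof (induction I arbitrary: j rule: finite_induct)
  case (insert i I)
  have "continuous_on X (\<lambda>x. a i x * coeff (\<Prod>i\<in>I. [:a i x, b i x:]) j +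
      (case j of 0 \<Rightarrow> 0 | Suc m \<Rightarrow> b i x * coeff (\<Prod>i\<in>I. [:a i x, b i x:]) m))"
    using insert by (cases j) (auto intro!: continuous_intros)
  then show ?case using insert by (cases j) auto
qed auto

lemma continuous_on_csig [continuous_intros]:
  fixes M :: "'a :: topological_space \<Rightarrow> real^'n^'n"
  assumes "continuous_on X M"
  shows "continuous_on X (\<lambda>x. csig j (M x))"
proof -
  have "csig j (M x) = (\<Sum>p | p permutes UNIV. of_int (sign p) *
      coeff (\<Prod>i\<in>UNIV. [:mat 1 $ i $ p i, M x $ i $ p i:]) j)" for x
    unfolding csig_def detpoly_def det_def by (simp add: coeff_sum of_int_poly)
  moreover have "continuous_on X (\<lambda>x. \<Sum>p | p permutes UNIV. of_int (sign p) *
      coeff (\<Prod>i\<in>UNIV. [:mat 1 $ i $ p i, M x $ i $ p i:]) j)"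
    using assms by (intro continuous_intros continuous_on_coeff_prod_linear) auto
  ultimately show ?thesis by simp
qed

lemma matrix_mult_add_rdistrib: "(B + C) ** A = B ** A + C ** A" for A B C :: "real^'n^'n"
  by (vector matrix_matrix_mult_def sum.distrib[symmetric] distrib_right)

lemma det_similar:
  fixes Q M :: "real^'n^'n"
  assumes "orthogonal_matrix Q"
  shows "det (x *\<^sub>R mat 1 + t *\<^sub>R (Q ** M ** transpose Q)) = det (x *\<^sub>R mat 1 + t *\<^sub>R M)"
proof -
  have Q: "Q ** transpose Q = mat 1" using assms by (simp add: orthogonal_matrix_def)
  have "Q ** (x *\<^sub>R mat 1 + t *\<^sub>R M) ** transpose Q = x *\<^sub>R (Q ** transpose Q) + t *\<^sub>R (Q ** M ** transpose Q)"
    by (simp add: matrix_add_ldistrib matrix_mult_add_rdistrib matrix_scalar_ac flip: scalar_matrix_assoc)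
  then have "det (x *\<^sub>R mat 1 + t *\<^sub>R (Q ** M ** transpose Q)) =
      det (x *\<^sub>R mat 1 + t *\<^sub>R M) * det (Q ** transpose Q)"
    unfolding Q by (metis det_mul mult.commute mult.left_commute Q)
  then show ?thesis by (simp add: Q)
qed

text \<open>In the eigenbasis, where \<open>a v* Q\<close> holds the coordinates of
  \<open>a\<close>, this is \<open>det_diagm_rank_one\<close> with diagonal entries
  \<open>1 + t l i\<close>. So \<open>csig\<close> is affine along rank-one matrices, and the slope
  is the Newton tensor, diagonal in the same basis.\<close>

lemma csig_rank_one:
  fixes Q :: "real^'n^'n" and l :: "'n \<Rightarrow> real"
  assumes Q: "orthogonal_matrix Q"
  defines "A \<equiv> Q ** diagm l ** transpose Q"
  shows "csig (Suc m) (A + outer a b) = esym UNIV l (Suc m) +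
     (\<Sum>i\<in>UNIV. (a v* Q) $ i * (b v* Q) $ i * esym (UNIV - {i}) l m)"
proof -
  define a' b' where "a' = a v* Q" and "b' = b v* Q"
  have "Q *v a' = a" "Q *v b' = b"
    unfolding a'_def b'_def transpose_matrix_vector[symmetric] matrix_vector_mul_assoc using Q by (simp_all add: orthogonal_matrix_def)
  then have ab: "(\<Sum>m\<in>UNIV. Q $ i $ m * a' $ m) = a $ i" "(\<Sum>m\<in>UNIV. Q $ i $ m * b' $ m) = b $ i" for i
    by (simp_all add: vec_eq_iff matrix_vector_mult_def)
  have "Q ** outer a' b' ** transpose Q = outer a b"
  proof -
    have "(Q ** outer a' b' ** transpose Q) $ i $ j = outer a b $ i $ j" for i j
    proof -
      have "(Q ** outer a' b' ** transpose Q) $ i $ j =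
          (\<Sum>k\<in>UNIV. (\<Sum>m\<in>UNIV. Q $ i $ m * a' $ m) * (Q $ j $ k * b' $ k))"
        by (simp add: matrix_matrix_mult_def transpose_def outer_def sum_distrib_right sum_distrib_left mult_ac)
      also have "\<dots> = outer a b $ i $ j"
        by (simp only: ab flip: sum_distrib_left) (simp add: outer_def)
      finally show ?thesis .
    qed
    then show ?thesis by (simp add: vec_eq_iff)
  qed
  then have A: "A + outer a b = Q ** (diagm l + outer a' b') ** transpose Q"
    by (simp add: A_def matrix_add_ldistrib matrix_mult_add_rdistrib)
  \<comment> \<open>The shift by \<open>pCons 0\<close> is the factor \<open>t\<close> carried by
    the rank-one part; it lowers the order of \<open>esym\<close> in the sum by one.\<close>
  define P where "P = (\<Prod>i\<in>UNIV. [:1, l i:]) +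
      pCons 0 (\<Sum>i\<in>UNIV. smult (a' $ i * b' $ i) (\<Prod>i\<in>UNIV - {i}. [:1, l i:]))"
  have "detpoly (A + outer a b) = P"
  proof (rule detpoly_unique)
    fix t
    have "det (mat 1 + t *\<^sub>R (A + outer a b)) = det (mat 1 + t *\<^sub>R (diagm l + outer a' b'))"
      unfolding A using det_similar[OF Q, of 1] by simp
    also have "mat 1 + t *\<^sub>R (diagm l + outer a' b') =
        diagm (\<lambda>i. 1 + t * l i) + (\<chi> i j. (t *\<^sub>R a') $ i * b' $ j)"
      by (auto simp: vec_eq_iff mat_def diagm_def outer_def algebra_simps)
    also have "det \<dots> = poly P t"
      unfolding det_diagm_rank_one
      by (simp add: P_def poly_prod poly_sum sum_distrib_left mult_ac)
    finally show "poly P t = det (mat 1 + t *\<^sub>R (A + outer a b))" by simp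
  qed
  then show ?thesis
    by (simp add: csig_def P_def coeff_sum esym_def flip: a'_def b'_def)
qed

lemma csig_diagonalized:
  fixes Q :: "real^'n^'n"
  assumes "orthogonal_matrix Q"
  shows "csig m (Q ** diagm l ** transpose Q) = esym UNIV l m"
proof (cases m)
  case (Suc j)
  have "outer 0 (0 :: real^'n) = 0" by (simp add: outer_def vec_eq_iff)
  then show ?thesis using csig_rank_one[OF assms, of j l 0 0] Suc by simp
qed simp

section \<open>Agreement with the definition by eigenvalues\<close>

lemma elem_sym_eq_coeff: "elem_sym j xs = coeff (\<Prod>x\<leftarrow>xs. [:1, x:]) j"
proof -
  have "(\<Prod>x\<leftarrow>xs. [:1, x:]) = (\<Prod>i\<in>{..<length xs}. monom (xs ! i) 1 + 1)"
    by (simp add: prod.list_conv_set_nth monom_altdef one_pCons atLeast0LessThan)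
  also have "\<dots> = (\<Sum>S\<in>Pow {..<length xs}. monom (\<Prod>i\<in>S. xs ! i) (card S))"
  proof -
    have "(\<Prod>i\<in>S. monom (xs ! i) 1) = monom (\<Prod>i\<in>S. xs ! i) (card S)" for S
      by (induction S rule: infinite_finite_induct) (auto simp: mult_monom)
    then show ?thesis by (subst prod_add) auto
  qed
  finally have "coeff (\<Prod>x\<leftarrow>xs. [:1, x:]) j = (\<Sum>S\<in>Pow {..<length xs}. if card S = j then \<Prod>i\<in>S. xs ! i else 0)"
    by (simp add: coeff_sum)
  also have "\<dots> = (\<Sum>S | S \<subseteq> {..<length xs} \<and> card S = j. \<Prod>i\<in>S. xs ! i)"
    by (subst sum.inter_filter[symmetric]) (auto simp: Pow_def)
  finally show ?thesis by (simp add: elem_sym_def)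
qed

lemma sigma_diagonalized:
  fixes Q :: "real^'n^'n"
  assumes Q: "orthogonal_matrix Q"
  shows "sigma j (Q ** diagm l ** transpose Q) = esym UNIV l j"
proof -
  let ?A = "Q ** diagm l ** transpose Q"
  have "poly (charpoly ?A) x = poly (\<Prod>i\<in>UNIV. [:- l i, 1:]) x" for x
  proof -
    have "poly (charpoly ?A) x = det (mat x - ?A)"
      unfolding charpoly_def poly_det
      by (rule arg_cong[of _ _ det]) (auto simp: vec_eq_iff mat_def map_matrix_def)
    also have "mat x - ?A = x *\<^sub>R mat 1 + (-1) *\<^sub>R ?A" by (simp add: vec_eq_iff mat_def)
    also have "det \<dots> = det (x *\<^sub>R mat 1 + (-1) *\<^sub>R diagm l)" by (rule det_similar[OF Q])
    also have "x *\<^sub>R mat 1 + (-1) *\<^sub>R diagm l = mat x - diagm l" by (simp add: vec_eq_iff mat_def)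
    also have "det (mat x - diagm l) = (\<Prod>i\<in>UNIV. x - l i)"
      by (subst det_diagonal) (auto simp: diagm_def mat_def)
    finally show ?thesis by (simp add: poly_prod)
  qed
  then have "charpoly ?A = (\<Prod>i\<in>UNIV. [:- l i, 1:])"
    by (metis poly_eq_poly_eq_iff ext)
  then have "proots (charpoly ?A) = image_mset l (mset_set UNIV)"
  proof -
    have "(\<Sum>i\<in>S. {#l i#}) = image_mset l (mset_set S)" for S :: "'n set"
      by (induction S rule: infinite_finite_induct) auto
    moreover have "proots (\<Prod>i\<in>UNIV. [:- l i, 1:]) = (\<Sum>i\<in>UNIV. {#l i#})"
      by (subst proots_prod) auto
    ultimately show ?thesis using \<open>charpoly ?A = _\<close> by simp
  qed
  then have "mset (eigenvalues ?A) = image_mset l (mset_set UNIV)"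
    by (simp add: eigenvalues_def)
  then have "(\<Prod>x\<leftarrow>eigenvalues ?A. [:1, x:]) = (\<Prod>i\<in>UNIV. [:1, l i:])"
  proof -
    assume m: "mset (eigenvalues ?A) = image_mset l (mset_set UNIV)"
    have "(\<Prod>x\<leftarrow>eigenvalues ?A. [:1, x:]) = prod_mset (image_mset (\<lambda>x. [:1, x:]) (mset (eigenvalues ?A)))"
      by (simp only: prod_mset_prod_list[symmetric] mset_map)
    also have "\<dots> = (\<Prod>i\<in>UNIV. [:1, l i:])"
      by (simp add: m prod_unfold_prod_mset multiset.map_comp comp_def)
    finally show ?thesis .
  qed
  then show ?thesis by (simp add: sigma_def elem_sym_eq_coeff esym_def)
qed

section \<open>Change of variables without an order on the index type\<close>

text \<open>The change of variables theorems of the library require a well-order on the index type;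
  \<open>'a wocopy\<close> is a copy of \<open>'a\<close> that carries an arbitrary one.\<close>

typedef 'a wocopy = "UNIV :: 'a set" by blast

definition wocode :: "'a::finite wocopy \<Rightarrow> nat" where
  "wocode = (SOME f. inj f)"

instance wocopy :: (finite) finite
proof
  have "(UNIV :: 'a wocopy set) = range Abs_wocopy"
    using type_definition.Abs_image[OF type_definition_wocopy] by (rule sym)
  then show "finite (UNIV :: 'a wocopy set)" by (metis finite_imageI finite)
qed

lemma inj_wocode: "inj (wocode :: 'a::finite wocopy \<Rightarrow> nat)"
proof -
  have "\<exists>f :: 'a wocopy \<Rightarrow> nat. inj f"
    using finite_imp_inj_to_nat_seg[of "UNIV :: 'a wocopy set"] by auto
  then show ?thesis unfolding wocode_def by (rule someI_ex)
qed

instantiation wocopy :: (finite) wellorder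
begin

definition "x \<le> y \<longleftrightarrow> wocode x \<le> wocode (y :: 'a wocopy)"
definition "x < y \<longleftrightarrow> wocode x < wocode (y :: 'a wocopy)"

instance
proof
  fix x y z :: "'a wocopy" and P :: "'a wocopy \<Rightarrow> bool"
  show "x < y \<longleftrightarrow> x \<le> y \<and> \<not> y \<le> x" by (auto simp: less_eq_wocopy_def less_wocopy_def)
  show "x \<le> x" by (simp add: less_eq_wocopy_def)
  show "x \<le> y \<Longrightarrow> y \<le> z \<Longrightarrow> x \<le> z" by (simp add: less_eq_wocopy_def)
  show "x \<le> y \<Longrightarrow> y \<le> x \<Longrightarrow> x = y"
    using inj_wocode by (auto simp: less_eq_wocopy_def inj_def)
  show "x \<le> y \<or> y \<le> x" by (auto simp: less_eq_wocopy_def)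
  assume step: "\<And>x. (\<And>y. y < x \<Longrightarrow> P y) \<Longrightarrow> P x"
  show "P x"
  proof (induction x rule: measure_induct_rule[of wocode])
    case (less x)
    show ?case by (rule step, rule less) (simp add: less_wocopy_def)
  qed
qed

end

definition reindex :: "('m::finite \<Rightarrow> 'n::finite) \<Rightarrow> real^'n \<Rightarrow> real^'m" where
  "reindex b x = (\<chi> i. x $ b i)"

lemma bounded_linear_reindex: "bounded_linear (reindex (b :: 'm::finite \<Rightarrow> 'n::finite))"
  unfolding linear_conv_bounded_linear[symmetric] by (auto simp: reindex_def linear_iff vec_eq_iff)

lemma continuous_on_reindex: "continuous_on S (reindex b)"
  by (rule bounded_linear.continuous_on[OF bounded_linear_reindex continuous_on_id])

lemma lborel_distr_reindex:
  fixes b :: "'m::finite \<Rightarrow> 'n::finite"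
  assumes b: "bij b"
  shows "lborel = distr lborel borel (reindex b :: real^'n \<Rightarrow> real^'m)"
proof (rule lborel_eqI)
  fix l u :: "real^'m"
  assume le: "\<And>e. e \<in> Basis \<Longrightarrow> l \<bullet> e \<le> u \<bullet> e"
  have lu: "l $ i \<le> u $ i" for i using le[of "axis i 1"] by (simp add: inner_axis)
  have P: "(\<Prod>e\<in>Basis. x \<bullet> e) = (\<Prod>i\<in>UNIV. x $ i)" for x :: "real^'k"
    by (simp add: Basis_vec_def UNION_singleton_eq_range prod.reindex axis_eq_axis inj_on_def inner_axis)
  have bi: "bij (inv b)" using b by (rule bij_imp_bij_inv)
  have "emeasure (distr lborel borel (reindex b)) (box l u) = emeasure lborel (reindex b -` box l u)"
    by (subst emeasure_distr) (auto intro!: borel_measurable_continuous_onI continuous_on_reindex)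
  also have "reindex b -` box l u = box (reindex (inv b) l) (reindex (inv b) u)"
  proof -
    have all: "(\<forall>i. P (b i) i) \<longleftrightarrow> (\<forall>j. P j (inv b j))" for P :: "'n \<Rightarrow> 'm \<Rightarrow> bool"
      using b by (metis bij_inv_eq_iff)
    show ?thesis
      using all[of "\<lambda>j i. l $ i < x $ j \<and> x $ j < u $ i" for x]
      by (intro set_eqI) (simp add: mem_box_cart reindex_def)
  qed
  also have "emeasure lborel \<dots> = ennreal (\<Prod>j\<in>UNIV. (u - l) $ inv b j)"
  proof -
    have "reindex (inv b) l \<bullet> e \<le> reindex (inv b) u \<bullet> e" if "e \<in> Basis" for e :: "real^'n"
      using lu that by (auto simp: reindex_def inner_axis Basis_vec_def)
    then show ?thesis by (simp add: emeasure_lborel_box P) (simp add: reindex_def)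
  qed
  also have "(\<Prod>j\<in>UNIV. (u - l) $ inv b j) = (\<Prod>i\<in>UNIV. (u - l) $ i)"
    by (rule prod.reindex_bij_betw[OF bi])
  finally show "emeasure (distr lborel borel (reindex b)) (box l u) = ennreal (\<Prod>e\<in>Basis. (u - l) \<bullet> e)"
    by (simp only: P)
qed simp

text \<open>Conjugation by \<open>b\<close> is a sign-preserving bijection between the permutations
  of the two index types.\<close>

lemma det_reindex:
  fixes A :: "'a::comm_ring_1^'n^'n" and b :: "'m::finite \<Rightarrow> 'n::finite"
  assumes b: "bij b"
  shows "det ((\<chi> i j. A $ b i $ b j) :: 'a^'m^'m) = det A"
proof -
  let ?h = "\<lambda>p x. if x \<in> UNIV then b (p (inv_into UNIV b x)) else x"
  have bb: "bij_betw b UNIV UNIV" using b by simp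
  have h: "bij_betw ?h {p. p permutes UNIV} {p. p permutes UNIV}"
    by (rule bij_betw_permutations[OF bb])
  have mp: "?h p = map_permutation UNIV b p" for p
    using b by (auto simp: map_permutation_def restrict_id_def bij_def fun_eq_iff)
  have "det A = (\<Sum>p | p permutes UNIV. of_int (sign (?h p)) * (\<Prod>i\<in>UNIV. A $ i $ ?h p i))"
    unfolding det_def by (rule sum.reindex_bij_betw[OF h, symmetric])
  also have "\<dots> = (\<Sum>p | p permutes UNIV. of_int (sign p) * (\<Prod>i\<in>UNIV. A $ b i $ b (p i)))"
  proof (intro sum.cong refl, goal_cases)
    case (1 p)
    have "sign (?h p) = sign p"
      unfolding mp using 1 b by (intro sign_map_permutation) (auto simp: bij_def)
    moreover have "(\<Prod>i\<in>UNIV. A $ i $ ?h p i) = (\<Prod>i\<in>UNIV. A $ b i $ ?h p (b i))"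
      by (rule prod.reindex_bij_betw[OF bb, symmetric])
    moreover have "?h p (b i) = b (p i)" for i using b by (simp add: bij_def)
    ultimately show ?case by simp
  qed
  finally show ?thesis by (simp add: det_def)
qed

lemma measure_differentiable_image_wellorder:
  fixes g :: "real^'n::{finite,wellorder} \<Rightarrow> real^'n::_"
  assumes S: "S \<in> sets borel"
    and der: "\<And>x. x \<in> S \<Longrightarrow> (g has_derivative g' x) (at x within S)"
    and inj: "inj_on g S"
    and meas: "(\<lambda>x. det (matrix (g' x))) \<in> borel_measurable borel"
    and img: "g ` S \<in> sets borel" "bounded (g ` S)"
  shows "has_bochner_integral lborel (\<lambda>x. indicator S x * \<bar>det (matrix (g' x))\<bar>) (measure lborel (g ` S))"
proof -
  have S': "S \<in> sets lebesgue" using S by auto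
  have "g ` S \<in> lmeasurable" using img by (intro bounded_set_imp_lmeasurable) auto
  then have io: "(\<lambda>x. \<bar>det (matrix (g' x))\<bar>) integrable_on S"
    using measurable_differentiable_image_eq[OF S' der inj] by blast
  then have si: "set_integrable lebesgue S (\<lambda>x. \<bar>det (matrix (g' x))\<bar>)"
    by (subst (asm) absolutely_integrable_on_iff_nonneg[symmetric]) auto
  have m: "(\<lambda>x. indicator S x *\<^sub>R \<bar>det (matrix (g' x))\<bar>) \<in> borel_measurable lborel"
    using S meas by measurable
  have i: "set_integrable lborel S (\<lambda>x. \<bar>det (matrix (g' x))\<bar>)"
    using si integrable_completion[OF m] by (simp add: set_integrable_def)
  have "(LINT x:S|lborel. \<bar>det (matrix (g' x))\<bar>) = measure lebesgue (g ` S)"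
    using set_borel_integral_eq_integral(2)[OF i] measure_differentiable_image_eq[OF S' der inj io] by simp
  then show ?thesis
    using i img by (simp add: has_bochner_integral_iff set_integrable_def set_lebesgue_integral_def)
qed

text \<open>Conjugating \<open>g\<close> with the relabelling \<open>r\<close> of coordinates
  changes neither Lebesgue measure nor determinants. The result serves twice: for the null
  Lagrangians and for the total mass of the bubble.\<close>

lemma measure_differentiable_image:
  fixes g :: "real^'n \<Rightarrow> real^'n"
  assumes S: "S \<in> sets borel"
    and der: "\<And>x. x \<in> S \<Longrightarrow> (g has_derivative g' x) (at x within S)"
    and inj: "inj_on g S"
    and meas: "(\<lambda>x. det (matrix (g' x))) \<in> borel_measurable borel"
    and img: "g ` S \<in> sets borel" "bounded (g ` S)"
  shows "has_bochner_integral lborel (\<lambda>x. indicator S x * \<bar>det (matrix (g' x))\<bar>) (measure lborel (g ` S))"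
proof -
  define b :: "'n wocopy \<Rightarrow> 'n" where "b = Rep_wocopy"
  have b: "bij b"
    unfolding b_def using type_definition.Rep_range[OF type_definition_wocopy]
    by (simp add: bij_def inj_def Rep_wocopy_inject)
  define r where "r = (reindex b :: real^'n \<Rightarrow> real^('n wocopy))"
  define r' where "r' = (reindex (inv b) :: real^('n wocopy) \<Rightarrow> real^'n)"
  have rr: "r (r' y) = y" "r' (r x) = x" for x y
    using b by (simp_all add: r_def r'_def reindex_def vec_eq_iff bij_is_inj bij_is_surj surj_f_inv_f)
  have bl: "bounded_linear r" "bounded_linear r'"
    by (simp_all add: r_def r'_def bounded_linear_reindex)
  have c: "continuous_on X r" "continuous_on Y r'" for X Y
    by (simp_all add: r_def r'_def continuous_on_reindex)
  have mr: "r \<in> borel \<rightarrow>\<^sub>M borel" "r' \<in> borel \<rightarrow>\<^sub>M borel"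
    using c by (auto intro!: borel_measurable_continuous_onI)
  have img_r: "r ` X = r' -` X" for X
  proof (intro set_eqI iffI)
    fix y assume "y \<in> r' -` X"
    then show "y \<in> r ` X" using rr(1)[of y] by (intro image_eqI[of y r "r' y"]) auto
  qed (auto simp: rr)
  have img_b: "r ` X \<in> sets borel" if "X \<in> sets borel" for X
    unfolding img_r using measurable_sets[OF mr(2) that] by simp
  have distr: "lborel = distr lborel borel r"
    unfolding r_def by (rule lborel_distr_reindex[OF b])
  have matrix_eq: "det (matrix (\<lambda>v. r (f (r' v)))) = det (matrix f)" if "linear f" for f :: "real^'n \<Rightarrow> real^'n"
  proof -
    have ax: "r' (axis j 1) = axis (b j) 1" for j
    proof -
      have "inv b i = j \<longleftrightarrow> i = b j" for i using bij_inv_eq_iff[OF b, of j i] by auto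
      then show ?thesis by (simp add: r'_def reindex_def vec_eq_iff axis_def)
    qed
    have "matrix (\<lambda>v. r (f (r' v))) = (\<chi> i j. matrix f $ b i $ b j)"
      by (simp add: matrix_def ax r_def reindex_def)
    then show ?thesis using det_reindex[OF b, of "matrix f"] by simp
  qed
  define g2 where "g2 y = r (g (r' y))" for y
  define g2' where "g2' y = (if r' y \<in> S then (\<lambda>v. r (g' (r' y) (r' v))) else id)" for y
  have lin: "linear (g' x)" if "x \<in> S" for x
    using der[OF that] by (rule has_derivative_linear)
  have det2: "det (matrix (g2' y)) = (if r' y \<in> S then det (matrix (g' (r' y))) else 1)" for y
    using matrix_eq[OF lin, of "r' y"] by (simp add: g2'_def)
  have "(\<lambda>x. if x \<in> S then det (matrix (g' x)) else 1) \<in> borel_measurable borel"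
    by (rule measurable_If_set) (use S meas in auto)
  then have meas_det: "(\<lambda>y. det (matrix (g2' y))) \<in> borel_measurable borel"
    unfolding det2 by (rule measurable_compose[OF mr(2)])
  have "has_bochner_integral lborel (\<lambda>y. indicator (r ` S) y * \<bar>det (matrix (g2' y))\<bar>) (measure lborel (g2 ` (r ` S)))"
  proof (rule measure_differentiable_image_wellorder)
    show "r ` S \<in> sets borel" by (rule img_b[OF S])
    show "(g2 has_derivative g2' y) (at y within r ` S)" if y: "y \<in> r ` S" for y
    proof -
      have yS: "r' y \<in> S" using y rr by auto
      have "r' ` (r ` S) = S" by (simp add: image_image rr)
      then have "(g has_derivative g' (r' y)) (at (r' y) within r' ` (r ` S))"
        using der[OF yS] by simp
      then have "((\<lambda>y. g (r' y)) has_derivative (\<lambda>v. g' (r' y) (r' v))) (at y within r ` S)"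
        by (rule has_derivative_in_compose[OF bounded_linear_imp_has_derivative[OF bl(2)]])
      then have "((\<lambda>y. r (g (r' y))) has_derivative (\<lambda>v. r (g' (r' y) (r' v)))) (at y within r ` S)"
        by (rule bounded_linear.has_derivative[OF bl(1)])
      then show ?thesis using yS by (simp add: g2'_def g2_def[abs_def])
    qed
    show "inj_on g2 (r ` S)"
    proof (rule inj_onI)
      fix y z assume yz: "y \<in> r ` S" "z \<in> r ` S" and eq: "g2 y = g2 z"
      have "g (r' y) = g (r' z)" using eq rr(2) unfolding g2_def by metis
      moreover have "r' y \<in> S" "r' z \<in> S" using yz by (auto simp: rr)
      ultimately have "r' y = r' z" using inj by (auto dest: inj_onD)
      then show "y = z" using rr(1) by metis
    qed
    show "(\<lambda>y. det (matrix (g2' y))) \<in> borel_measurable borel" by (rule meas_det)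
    have e: "g2 ` (r ` S) = r ` (g ` S)" by (simp add: g2_def image_image rr)
    show "g2 ` (r ` S) \<in> sets borel" unfolding e by (rule img_b[OF img(1)])
    show "bounded (g2 ` (r ` S))" unfolding e by (rule bounded_linear_image[OF img(2) bl(1)])
  qed
  also have "g2 ` (r ` S) = r ` (g ` S)" by (simp add: g2_def image_image rr)
  also have "measure lborel (r ` (g ` S)) = measure (distr lborel borel r) (r ` (g ` S))"
    by (simp only: distr[symmetric])
  also have "\<dots> = measure lborel (g ` S)"
  proof -
    have "r -` (r ` X) = X" for X by (auto simp: img_r rr)
    then show ?thesis using img_b[OF img(1)] mr by (subst measure_distr) auto
  qed
  finally have hb: "has_bochner_integral (distr lborel borel r) (\<lambda>y. indicator (r ` S) y * \<bar>det (matrix (g2' y))\<bar>)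
      (measure lborel (g ` S))"
    by (simp only: distr[symmetric])
  have meas2: "(\<lambda>y. indicator (r ` S) y * \<bar>det (matrix (g2' y))\<bar>) \<in> borel_measurable borel"
    using meas_det img_b[OF S] by (intro borel_measurable_times borel_measurable_indicator borel_measurable_abs) auto
  have "has_bochner_integral lborel (\<lambda>x. indicator (r ` S) (r x) * \<bar>det (matrix (g2' (r x)))\<bar>)
      (measure lborel (g ` S))"
    using hb meas2 mr(1) by (simp add: has_bochner_integral_iff integrable_distr_eq integral_distr)
  moreover have "indicator (r ` S) (r x) * \<bar>det (matrix (g2' (r x)))\<bar> = indicator S x * \<bar>det (matrix (g' x))\<bar>" for x
    unfolding det2 rr img_r by (auto simp: indicator_def rr)
  ultimately show ?thesis by simp
qed

section \<open>Null Lagrangians\<close>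

text \<open>Balls are closed so that every continuous integrand is integrable.\<close>

definition bint :: "real \<Rightarrow> (real^'n \<Rightarrow> real) \<Rightarrow> real" where
  "bint R f = (LINT x:cball 0 R|lborel. f x)"

lemma bint_integrable:
  "continuous_on UNIV f \<Longrightarrow> set_integrable lborel (cball 0 R) f" for f :: "real^'n \<Rightarrow> real"
  unfolding set_integrable_def by (rule borel_integrable_compact) (auto intro: continuous_on_subset)

lemma bint_add:
  assumes "continuous_on UNIV f" "continuous_on UNIV g"
  shows "bint R (\<lambda>x. f x + g x) = bint R f + bint R g"
  unfolding bint_def using assms by (intro set_integral_add bint_integrable)

lemma bint_diff:
  assumes "continuous_on UNIV f" "continuous_on UNIV g"
  shows "bint R (\<lambda>x. f x - g x) = bint R f - bint R g"
  unfolding bint_def using assms by (intro set_integral_diff bint_integrable)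

lemma bint_cmult: "bint R (\<lambda>x. c * f x) = c * bint R f"
  unfolding bint_def by simp

lemma bint_sum:
  assumes "finite I" "\<And>i. i \<in> I \<Longrightarrow> continuous_on UNIV (f i)"
  shows "bint R (\<lambda>x. \<Sum>i\<in>I. f i x) = (\<Sum>i\<in>I. bint R (f i))"
  using assms
proof (induction I rule: finite_induct)
  case (insert i I)
  then show ?case by (simp add: bint_add continuous_on_sum)
qed (simp add: bint_def)

lemma bint_mono:
  assumes "continuous_on UNIV f" "continuous_on UNIV g" "\<And>x. norm x \<le> R \<Longrightarrow> f x \<le> g x"
  shows "bint R f \<le> bint R g"
  unfolding bint_def using assms by (intro set_integral_mono bint_integrable) auto

lemma bint_cong: "(\<And>x. norm x \<le> R \<Longrightarrow> f x = g x) \<Longrightarrow> bint R f = bint R g"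
  unfolding bint_def by (intro set_lebesgue_integral_cong) auto

text \<open>The determinant is 1 at \<open>t = 0\<close>; if it were not positive at
  \<open>t\<close>, it would vanish at some \<open>s \<le> t\<close>, and a kernel vector
  \<open>h = - s M h\<close> would satisfy \<open>|h| \<le> |h| / 2\<close>.\<close>

lemma det_id_add_pos:
  fixes M :: "real^'n^'n"
  assumes K: "\<And>h. norm (M *v h) \<le> K * norm h" and t: "0 \<le> t" "t * K \<le> 1/2"
  shows "det (mat 1 + t *\<^sub>R M) > 0"
proof (rule ccontr)
  assume neg: "\<not> ?thesis"
  have "continuous_on {0..t} (\<lambda>s. det (mat 1 + s *\<^sub>R M))"
    unfolding det_eq_sum_csig by (intro continuous_intros)
  then obtain s where s: "0 \<le> s" "s \<le> t" "det (mat 1 + s *\<^sub>R M) = 0"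
    using IVT2'[of "\<lambda>s. det (mat 1 + s *\<^sub>R M)" t 0 0] neg t by (auto simp: not_less)
  then obtain h where h: "h \<noteq> 0" "(mat 1 + s *\<^sub>R M) *v h = 0"
    using det_nz_iff_inj[of "\<lambda>h. (mat 1 + s *\<^sub>R M) *v h"]
    by (auto simp: linear_injective_0)
  then have "h = - (s *\<^sub>R (M *v h))"
    by (simp add: matrix_vector_mult_add_rdistrib scaleR_matrix_vector_assoc add_eq_0_iff2)
  then have "norm h = s * norm (M *v h)"
    using s by (metis norm_minus_cancel norm_scaleR abs_of_nonneg)
  also have "\<dots> \<le> s * (K * norm h)" using K s by (intro mult_left_mono)
  also have "\<dots> \<le> t * (K * norm h)"
    using K[of h] s by (intro mult_right_mono) (auto intro: order_trans[OF norm_ge_zero])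
  also have "\<dots> \<le> 1/2 * norm h" using mult_right_mono[OF t(2), of "norm h"] by (simp add: mult.assoc)
  finally show False using h by simp
qed

lemma matrix_norm_bound:
  fixes M :: "'a::topological_space \<Rightarrow> real^'n^'n"
  assumes "compact S" "continuous_on S M"
  obtains K where "K \<ge> 0" "\<And>x h. x \<in> S \<Longrightarrow> norm (M x *v h) \<le> K * norm h"
proof -
  have "bounded (M ` S)" using assms by (intro compact_imp_bounded compact_continuous_image)
  then obtain B where B: "B > 0" "\<And>x. x \<in> S \<Longrightarrow> norm (M x) \<le> B" by (auto simp: bounded_pos)
  have "norm (M x *v h) \<le> B * CARD('n) * norm h" if x: "x \<in> S" for x h
  proof -
    have "norm (M x *v h) \<le> (\<Sum>i\<in>UNIV. \<bar>(M x *v h) $ i\<bar>)" by (rule norm_le_l1_cart)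
    also have "\<dots> \<le> (\<Sum>i\<in>(UNIV::'n set). B * norm h)"
    proof (intro sum_mono)
      fix i
      have "\<bar>(M x *v h) $ i\<bar> = \<bar>M x $ i \<bullet> h\<bar>" by (simp add: matrix_vector_mult_def inner_vec_def)
      also have "\<dots> \<le> norm (M x $ i) * norm h" by (rule Cauchy_Schwarz_ineq2)
      also have "\<dots> \<le> B * norm h"
        using B(2)[OF x] Finite_Cartesian_Product.norm_nth_le[of "M x" i] by (intro mult_right_mono) auto
      finally show "\<bar>(M x *v h) $ i\<bar> \<le> B * norm h" .
    qed
    finally show ?thesis by (simp add: mult_ac)
  qed
  then show ?thesis using B by (intro that[of "B * CARD('n)"]) auto
qed

lemma poly_sum_zero_on_interval:
  assumes "e > 0" "\<And>t. 0 < t \<Longrightarrow> t < e \<Longrightarrow> (\<Sum>j\<le>n. c j * t ^ j) = (0::real)" "j \<le> n"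
  shows "c j = 0"
proof -
  define p where "p = (\<Sum>j\<le>n. monom (c j) j)"
  have "poly p t = (\<Sum>j\<le>n. c j * t ^ j)" for t by (simp add: p_def poly_sum poly_monom)
  then have "{0<..<e} \<subseteq> {t. poly p t = 0}" using assms by auto
  moreover have "infinite {0<..<e}" using assms by simp
  ultimately have "p = 0" using poly_roots_finite[of p] finite_subset by blast
  moreover have "coeff p j = c j" using assms by (simp add: p_def coeff_sum)
  ultimately show ?thesis by simp
qed

text \<open>For small \<open>t\<close> the Jacobian determinant of \<open>x + t q(x)\<close> is
  positive, so its integral is the volume of the image, and the image of the ball is the ball
  itself. A polynomial in \<open>t\<close> that is constant on an interval has no higher
  coefficients. Only one derivative of \<open>q\<close> is used.\<close>

lemma bint_csig_eq_0:
  fixes q :: "real^'n \<Rightarrow> real^'n"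
  assumes der: "\<And>x. (q has_derivative (\<lambda>h. M x *v h)) (at x)"
    and cont: "continuous_on UNIV M"
    and supp: "\<And>x. norm x \<ge> R \<Longrightarrow> q x = 0" and R: "R > 0" and j: "j \<ge> 1"
  shows "bint R (\<lambda>x. csig j (M x)) = 0"
proof (cases "j \<le> CARD('n)")
  case False
  then have "csig j M = 0" for M :: "real^'n^'n"
    using degree_detpoly_le[of M] by (simp add: csig_def coeff_eq_0)
  then show ?thesis by (simp add: bint_def)
next
  case j': True
  obtain K where K: "K \<ge> 0" "\<And>x h. x \<in> cball 0 R \<Longrightarrow> norm (M x *v h) \<le> K * norm h"
    using matrix_norm_bound[of "cball 0 R" M] cont by (auto intro: continuous_on_subset)
  \<comment> \<open>Outside the closed ball \<open>q\<close> vanishes near \<open>x\<close>, so its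
    derivative is 0 there and the bound from the compact ball holds globally.\<close>
  have K': "norm (M x *v h) \<le> K * norm h" for x h
  proof (cases "norm x \<le> R")
    case False
    have "(q has_derivative (\<lambda>h. 0)) (at x)"
    proof (rule has_derivative_transform_within_open)
      show "((\<lambda>x. 0) has_derivative (\<lambda>h. 0)) (at x)" by simp
      show "open (- cball 0 R :: (real^'n) set)" by auto
    qed (use False supp in auto)
    then have "(\<lambda>h. M x *v h) = (\<lambda>h. 0)" using der has_derivative_unique by blast
    then have "M x *v h = 0" by (rule fun_cong)
    then show ?thesis using K by simp
  qed (use K in auto)
  have lip: "norm (q x - q y) \<le> K * norm (x - y)" for x y
    by (rule differentiable_bound[of UNIV q "\<lambda>x h. M x *v h"])
       (use der K' in \<open>auto intro!: onorm_bound K(1) matrix_vector_mul_bounded_linear\<close>)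
  define B :: "(real^'n) set" where "B = cball 0 R"
  have det_int: "bint R (\<lambda>x. det (mat 1 + t *\<^sub>R M x)) = measure lborel B"
    if t: "0 < t" "t * K \<le> 1/2" for t
  proof -
    define g where "g x = x + t *\<^sub>R q x" for x
    have tl: "norm (t *\<^sub>R q x - t *\<^sub>R q y) \<le> 1/2 * norm (x - y)" for x y
    proof -
      have "norm (t *\<^sub>R q x - t *\<^sub>R q y) = t * norm (q x - q y)"
        using t by (simp flip: scaleR_diff_right)
      also have "\<dots> \<le> t * (K * norm (x - y))" using lip t by (intro mult_left_mono) auto
      also have "\<dots> \<le> 1/2 * norm (x - y)"
        using mult_right_mono[OF t(2), of "norm (x - y)"] by (simp add: mult.assoc)
      finally show ?thesis .
    qed
    have inj: "x = y" if "g x = g y" for x y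
    proof -
      have "x - y = t *\<^sub>R q y - t *\<^sub>R q x" using that by (simp add: g_def algebra_simps)
      then have "norm (x - y) \<le> 1/2 * norm (x - y)" using tl[of y x] by (simp add: norm_minus_commute)
      then show ?thesis by simp
    qed
    have out: "g x = x" if "norm x > R" for x using supp[of x] that by (simp add: g_def)
    \<comment> \<open>Points outside the ball are fixed, so injectivity keeps the image of the ball
      inside it; surjectivity is a fixed point argument.\<close>
    have img: "g ` B = B"
    proof (intro set_eqI iffI)
      fix y assume "y \<in> g ` B"
      then obtain x where x: "x \<in> B" "y = g x" by auto
      show "y \<in> B"
      proof (rule ccontr)
        assume "y \<notin> B"
        then have "g y = g x" using out[of y] x by (simp add: B_def)
        then show False using inj x \<open>y \<notin> B\<close> by metis
      qed
    next
      fix y assume y: "y \<in> B"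
      \<comment> \<open>Solving \<open>g x = y\<close> means finding a fixed point of
        \<open>x \<mapsto> y - t q(x)\<close>, a contraction with factor 1/2.\<close>
      have "dist (y - t *\<^sub>R q x) (y - t *\<^sub>R q z) \<le> 1/2 * dist x z" for x z
        using tl[of x z] by (simp add: dist_norm norm_minus_commute)
      then have "\<exists>!x. y - t *\<^sub>R q x = x"
        by (intro banach_fix_type[of "1/2"]) auto
      then obtain x where "y - t *\<^sub>R q x = x" by blast
      then have x: "g x = y" unfolding g_def by (metis diff_add_cancel)
      have "x \<in> B"
        using out[of x] x y by (cases "norm x > R") (auto simp: B_def)
      then show "y \<in> g ` B" using x by auto
    qed
    have mat: "matrix (\<lambda>h. h + t *\<^sub>R (M x *v h)) = mat 1 + t *\<^sub>R M x" for x
    proof -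
      have "(\<lambda>h. h + t *\<^sub>R (M x *v h)) = (\<lambda>h. (mat 1 + t *\<^sub>R M x) *v h)"
        by (simp add: fun_eq_iff matrix_vector_mult_add_rdistrib scaleR_matrix_vector_assoc)
      then show ?thesis by simp
    qed
    have "has_bochner_integral lborel
        (\<lambda>x. indicator B x * \<bar>det (matrix (\<lambda>h. h + t *\<^sub>R (M x *v h)))\<bar>) (measure lborel (g ` B))"
    proof (rule measure_differentiable_image)
      show "(g has_derivative (\<lambda>h. h + t *\<^sub>R (M x *v h))) (at x within B)" for x
        unfolding g_def by (intro derivative_intros has_derivative_at_withinI[OF der])
      show "inj_on g B" using inj by (auto intro: inj_onI)
      show "(\<lambda>x. det (matrix (\<lambda>h. h + t *\<^sub>R (M x *v h)))) \<in> borel_measurable borel"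
        unfolding mat det_eq_sum_csig by (intro borel_measurable_continuous_onI continuous_intros cont)
    qed (auto simp: img, auto simp: B_def)
    moreover have "\<bar>det (matrix (\<lambda>h. h + t *\<^sub>R (M x *v h)))\<bar> = det (mat 1 + t *\<^sub>R M x)" for x
      using det_id_add_pos[of "M x" K t] K' t unfolding mat by simp
    ultimately show ?thesis
      unfolding img by (simp add: has_bochner_integral_iff bint_def set_lebesgue_integral_def B_def)
  qed
  \<comment> \<open>The coefficient of order 0 is the volume of the ball, which cancels against the
    other side; it is therefore set to 0.\<close>
  define c where "c j = (if j = 0 then 0 else bint R (\<lambda>x. csig j (M x)))" for j
  have "(\<Sum>j\<le>CARD('n). c j * t ^ j) = 0" if t: "0 < t" "t < 1 / (2 * K + 1)" for t
  proof -
    have "t * (2 * K + 1) < 1" using t K by (simp add: field_simps)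
    then have "t * K \<le> 1/2" using t by (simp add: algebra_simps)
    then have "measure lborel B = bint R (\<lambda>x. det (mat 1 + t *\<^sub>R M x))" using det_int t by simp
    also have "\<dots> = (\<Sum>j\<le>CARD('n). bint R (\<lambda>x. csig j (M x) * t ^ j))"
      unfolding det_eq_sum_csig by (rule bint_sum) (auto intro!: continuous_intros cont)
    also have "\<dots> = (\<Sum>j\<le>CARD('n). t ^ j * bint R (\<lambda>x. csig j (M x)))"
      by (simp add: mult.commute[of _ "t ^ _"] bint_cmult)
    also have "\<dots> = bint R (\<lambda>x::real^'n. 1) + (\<Sum>j\<le>CARD('n). c j * t ^ j)"
      by (simp add: sum.atMost_shift c_def mult_ac)
    also have "bint R (\<lambda>x::real^'n. 1) = measure lborel B"
      by (simp add: bint_def B_def set_lebesgue_integral_def)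
    finally show ?thesis by simp
  qed
  then have "c j = 0"
    using poly_sum_zero_on_interval[of "1 / (2 * K + 1)" c "CARD('n)" j] K j' by simp
  then show ?thesis using j by (simp add: c_def)
qed

section \<open>Newton tensors are divergence free\<close>

text \<open>Once continuously differentiable, with named gradient: test functions below contain
  \<open>|p|^2\<close>, and \<open>p\<close> is no better than that.\<close>

definition has_grad :: "(real^'n \<Rightarrow> real) \<Rightarrow> (real^'n \<Rightarrow> real^'n) \<Rightarrow> bool" where
  "has_grad f F \<longleftrightarrow> (\<forall>x. (f has_derivative (\<lambda>h. F x \<bullet> h)) (at x)) \<and> continuous_on UNIV F"

lemma has_gradD:
  assumes "has_grad f F"
  shows "(f has_derivative (\<lambda>h. F x \<bullet> h)) (at x)" "continuous_on UNIV F" "continuous_on UNIV f"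
proof -
  show d: "(f has_derivative (\<lambda>h. F x \<bullet> h)) (at x)" for x using assms by (simp add: has_grad_def)
  show "continuous_on UNIV F" using assms by (simp add: has_grad_def)
  show "continuous_on UNIV f"
    using d by (metis continuous_at_imp_continuous_on has_derivative_continuous)
qed

lemma has_grad_const: "has_grad (\<lambda>x. c) (\<lambda>x. 0)"
  by (simp add: has_grad_def)

lemma has_grad_add:
  assumes f: "has_grad f F" and g: "has_grad g G"
  shows "has_grad (\<lambda>x. f x + g x) (\<lambda>x. F x + G x)"
  unfolding has_grad_def
proof (intro conjI allI)
  show "((\<lambda>x. f x + g x) has_derivative (\<lambda>h. (F x + G x) \<bullet> h)) (at x)" for x
    using has_derivative_add[OF has_gradD(1)[OF f, of x] has_gradD(1)[OF g, of x]]
    by (simp add: inner_add_left)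
qed (intro continuous_intros has_gradD(2)[OF f] has_gradD(2)[OF g])

lemma has_grad_mult:
  assumes f: "has_grad f F" and g: "has_grad g G"
  shows "has_grad (\<lambda>x. f x * g x) (\<lambda>x. f x *\<^sub>R G x + g x *\<^sub>R F x)"
  unfolding has_grad_def
proof (intro conjI allI)
  show "((\<lambda>x. f x * g x) has_derivative (\<lambda>h. (f x *\<^sub>R G x + g x *\<^sub>R F x) \<bullet> h)) (at x)" for x
    using has_derivative_mult[OF has_gradD(1)[OF f, of x] has_gradD(1)[OF g, of x]]
    by (simp add: inner_add_left mult.commute)
qed (intro continuous_intros has_gradD[OF f] has_gradD[OF g])

lemma has_grad_compose:
  assumes f: "has_grad f F" and \<phi>: "\<And>x. (\<phi> has_real_derivative \<phi>' (f x)) (at (f x))"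
    and c: "continuous_on (range f) \<phi>'"
  shows "has_grad (\<lambda>x. \<phi> (f x)) (\<lambda>x. \<phi>' (f x) *\<^sub>R F x)"
  unfolding has_grad_def
proof (intro conjI allI)
  show "((\<lambda>x. \<phi> (f x)) has_derivative (\<lambda>h. (\<phi>' (f x) *\<^sub>R F x) \<bullet> h)) (at x)" for x
    using has_derivative_compose[OF has_gradD(1)[OF f, of x] \<phi>[of x, unfolded has_field_derivative_def]]
    by (simp add: mult.commute)
  have "continuous_on UNIV (\<lambda>x. \<phi>' (f x))"
    using continuous_on_compose[OF has_gradD(3)[OF f], of \<phi>'] c by (simp add: comp_def)
  then show "continuous_on UNIV (\<lambda>x. \<phi>' (f x) *\<^sub>R F x)"
    by (intro continuous_intros has_gradD(2)[OF f])
qed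

lemma has_grad_power:
  assumes "has_grad f F"
  shows "has_grad (\<lambda>x. f x ^ N) (\<lambda>x. (real N * f x ^ (N - 1)) *\<^sub>R F x)"
  by (rule has_grad_compose[OF assms, of "\<lambda>t. t ^ N"]) (auto intro!: derivative_eq_intros continuous_intros)

text \<open>\<open>Tn m H a b\<close> is the Newton tensor \<open>T\<^sub>m(H)[a,b]\<close>: \<open>csig (Suc m)\<close> is affine along rank-one matrices.\<close>

definition Tn :: "nat \<Rightarrow> real^'n^'n \<Rightarrow> real^'n \<Rightarrow> real^'n \<Rightarrow> real" where
  "Tn m H a b = csig (Suc m) (H + outer a b) - csig (Suc m) H"

lemma continuous_on_outer [continuous_intros]:
  assumes "continuous_on S a" "continuous_on S b"
  shows "continuous_on S (\<lambda>x. outer (a x) (b x))"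
  unfolding outer_def using assms by (intro continuous_intros) 

lemma continuous_on_Tn [continuous_intros]:
  assumes "continuous_on S H" "continuous_on S a" "continuous_on S b"
  shows "continuous_on S (\<lambda>x. Tn m (H x) (a x) (b x))"
  unfolding Tn_def using assms by (intro continuous_intros)

lemma Tn_diagonalized:
  fixes Q :: "real^'n^'n"
  assumes Q: "orthogonal_matrix Q"
  shows "Tn m (Q ** diagm l ** transpose Q) a b =
     (\<Sum>i\<in>UNIV. (a v* Q) $ i * (b v* Q) $ i * esym (UNIV - {i}) l m)"
  by (simp add: Tn_def csig_rank_one[OF Q] csig_diagonalized[OF Q])

lemma Tn_linear:
  assumes "transpose H = H"
  shows "Tn m H a (c *\<^sub>R x + d *\<^sub>R y) = c * Tn m H a x + d * Tn m H a y"
proof -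
  obtain Q l where Q: "orthogonal_matrix Q" "H = Q ** diagm l ** transpose Q"
    using spectral_theorem[OF assms] .
  have "((c *\<^sub>R x + d *\<^sub>R y) v* Q) $ i = c * (x v* Q) $ i + d * (y v* Q) $ i" for i
    by (simp add: vector_matrix_mult_def sum.distrib sum_distrib_left algebra_simps)
  then show ?thesis
    unfolding Q(2) Tn_diagonalized[OF Q(1)]
    by (simp add: sum.distrib sum_distrib_left algebra_simps)
qed

lemma Tn_scale: "transpose H = H \<Longrightarrow> Tn m H a (c *\<^sub>R x) = c * Tn m H a x"
  using Tn_linear[of H m a c x 0 0] by simp

lemma esym_scale:
  assumes "finite S"
  shows "esym S (\<lambda>i. c * l i) j = c ^ j * esym S l j"
  using assms
proof (induction S arbitrary: j rule: finite_induct)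
  case empty
  then show ?case by (cases j) (auto simp: esym_def)
next
  case (insert a S)
  then show ?case by (cases j) (auto simp: esym_insert algebra_simps)
qed

lemma csig_scale_rank_one:
  fixes H :: "real^'n^'n"
  assumes "transpose H = H"
  shows "csig (Suc m) (c *\<^sub>R H + outer a b) = c ^ Suc m * csig (Suc m) H + c ^ m * Tn m H a b"
proof -
  obtain Q l where Q: "orthogonal_matrix Q" "H = Q ** diagm l ** transpose Q"
    using spectral_theorem[OF assms] .
  have "c *\<^sub>R diagm l = (diagm (\<lambda>i. c * l i) :: real^'n^'n)" by (simp add: diagm_def vec_eq_iff)
  then have cH: "c *\<^sub>R H = Q ** diagm (\<lambda>i. c * l i) ** transpose Q"
    unfolding Q(2) by (metis matrix_scalar_ac scalar_matrix_assoc)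
  show ?thesis
    unfolding cH csig_rank_one[OF Q(1)] unfolding Q(2) Tn_diagonalized[OF Q(1)] csig_diagonalized[OF Q(1)]
    by (simp add: esym_scale sum_distrib_left mult_ac)
qed

text \<open>The field \<open>\<Psi> p\<close> has Jacobian \<open>\<Psi> H + outer p \<Xi>\<close>,
  so \<open>bint_csig_eq_0\<close> applies to it. Up to the factor \<open>m + 1\<close> this is the
  weak form of \<open>div (T_m p) = (m + 1) \<sigma>_(m+1)\<close> tested with
  \<open>\<Psi>^(m+1)\<close>.\<close>

lemma newton_tensor_divergence_root:
  fixes p :: "real^'n \<Rightarrow> real^'n"
  assumes p: "\<And>x. (p has_derivative (\<lambda>h. H x *v h)) (at x)" and cH: "continuous_on UNIV H"
    and sym: "\<And>x. transpose (H x) = H x"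
    and \<Psi>: "has_grad \<Psi> \<Xi>" and supp: "\<And>x. norm x \<ge> R \<Longrightarrow> \<Psi> x = 0" and R: "R > 0"
  shows "bint R (\<lambda>x. \<Psi> x ^ Suc m * csig (Suc m) (H x) + \<Psi> x ^ m * Tn m (H x) (p x) (\<Xi> x)) = 0"
proof -
  have cp: "continuous_on UNIV p"
    using p by (metis continuous_at_imp_continuous_on has_derivative_continuous)
  have "bint R (\<lambda>x. csig (Suc m) (\<Psi> x *\<^sub>R H x + outer (p x) (\<Xi> x))) = 0"
  proof (rule bint_csig_eq_0[where q = "\<lambda>x. \<Psi> x *\<^sub>R p x"])
    fix x
    have "outer (p x) (\<Xi> x) *v h = (\<Xi> x \<bullet> h) *\<^sub>R p x" for h
      by (simp add: outer_def matrix_vector_mult_def inner_vec_def vec_eq_iff sum_distrib_left sum_distrib_right mult_ac)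
    then have "(\<lambda>h. (\<Psi> x *\<^sub>R H x + outer (p x) (\<Xi> x)) *v h) = (\<lambda>h. \<Psi> x *\<^sub>R (H x *v h) + (\<Xi> x \<bullet> h) *\<^sub>R p x)"
      by (simp add: fun_eq_iff matrix_vector_mult_add_rdistrib scaleR_matrix_vector_assoc)
    then show "((\<lambda>x. \<Psi> x *\<^sub>R p x) has_derivative (\<lambda>h. (\<Psi> x *\<^sub>R H x + outer (p x) (\<Xi> x)) *v h)) (at x)"
      using has_derivative_scaleR[OF has_gradD(1)[OF \<Psi>, of x] p[of x]] by simp
  next
    show "continuous_on UNIV (\<lambda>x. \<Psi> x *\<^sub>R H x + outer (p x) (\<Xi> x))"
      by (intro continuous_intros has_gradD[OF \<Psi>] cH cp)
  qed (use supp R in auto)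
  then show ?thesis by (simp only: csig_scale_rank_one[OF sym])
qed

text \<open>The same weak identity for test functions \<open>f \<eta>^N\<close> that need not be a
  power of order \<open>m + 1\<close>, with \<open>f\<close> of either sign.\<close>

lemma newton_tensor_divergence:
  fixes p :: "real^'n \<Rightarrow> real^'n"
  assumes p: "\<And>x. (p has_derivative (\<lambda>h. H x *v h)) (at x)" and cH: "continuous_on UNIV H"
    and sym: "\<And>x. transpose (H x) = H x"
    and \<eta>: "has_grad \<eta> \<Xi>" and supp: "\<And>x. norm x \<ge> R \<Longrightarrow> \<eta> x = 0" and R: "R > 0"
    and f: "has_grad f F" and N: "N \<ge> Suc m"
  shows "bint R (\<lambda>x. (real m + 1) * csig (Suc m) (H x) * f x * \<eta> x ^ N
     + \<eta> x ^ N * Tn m (H x) (p x) (F x) + real N * \<eta> x ^ (N - 1) * f x * Tn m (H x) (p x) (\<Xi> x)) = 0"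
proof -
  have cp: "continuous_on UNIV p"
    using p by (metis continuous_at_imp_continuous_on has_derivative_continuous)
  define J where "J f F x = (real m + 1) * csig (Suc m) (H x) * f x * \<eta> x ^ Suc m
     + \<eta> x ^ Suc m * Tn m (H x) (p x) (F x) + (real m + 1) * \<eta> x ^ m * f x * Tn m (H x) (p x) (\<Xi> x)"
    for f :: "real^'n \<Rightarrow> real" and F :: "real^'n \<Rightarrow> real^'n" and x
  \<comment> \<open>A positive \<open>f\<close> is the power of order \<open>m + 1\<close> of the
    differentiable function \<open>\<phi> (f x)\<close>, so \<open>\<Psi> = \<eta> \<phi>(f)\<close>
    is admissible in the previous lemma.\<close>
  have pos: "bint R (J f F) = 0" if f: "has_grad f F" and f0: "\<And>x. f x > 0" for f F
  proof -
    define \<phi> where "\<phi> t = exp (ln t / (real m + 1))" for t :: real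
    have \<phi>p: "\<phi> t ^ Suc m = t" if "t > 0" for t
    proof -
      have "\<phi> t ^ Suc m = exp (real (Suc m) * (ln t / (real m + 1)))"
        unfolding \<phi>_def by (rule exp_of_nat_mult[symmetric])
      also have "real (Suc m) * (ln t / (real m + 1)) = ln t" by (simp add: field_simps)
      finally show ?thesis using that by simp
    qed
    have g: "has_grad (\<lambda>x. \<phi> (f x)) (\<lambda>x. (\<phi> (f x) / ((real m + 1) * f x)) *\<^sub>R F x)"
    proof (rule has_grad_compose[OF f])
      show "(\<phi> has_real_derivative \<phi> (f x) / ((real m + 1) * f x)) (at (f x))" for x
        unfolding \<phi>_def by (rule derivative_eq_intros refl f0 | simp add: f0)+
      show "continuous_on (range f) (\<lambda>a. \<phi> a / ((real m + 1) * a))"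
        unfolding \<phi>_def using f0 by (auto intro!: continuous_intros simp: less_imp_neq[THEN not_sym] add_nonneg_eq_0_iff)
    qed
    have z: "bint R (\<lambda>x. (\<eta> x * \<phi> (f x)) ^ Suc m * csig (Suc m) (H x) + (\<eta> x * \<phi> (f x)) ^ m *
        Tn m (H x) (p x) (\<eta> x *\<^sub>R ((\<phi> (f x) / ((real m + 1) * f x)) *\<^sub>R F x) + \<phi> (f x) *\<^sub>R \<Xi> x)) = 0"
      by (rule newton_tensor_divergence_root[OF p cH sym has_grad_mult[OF \<eta> g]]) (use supp R in auto)
    have "(\<eta> x * \<phi> (f x)) ^ Suc m * csig (Suc m) (H x) + (\<eta> x * \<phi> (f x)) ^ m *
        Tn m (H x) (p x) (\<eta> x *\<^sub>R ((\<phi> (f x) / ((real m + 1) * f x)) *\<^sub>R F x) + \<phi> (f x) *\<^sub>R \<Xi> x)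
       = 1 / (real m + 1) * J f F x" for x
    proof -
      define y where "y = \<phi> (f x)"
      have y: "y * y ^ m = f x" using \<phi>p[OF f0[of x]] by (simp add: y_def)
      have T: "Tn m (H x) (p x) (\<eta> x *\<^sub>R ((y / ((real m + 1) * f x)) *\<^sub>R F x) + y *\<^sub>R \<Xi> x)
         = \<eta> x * (y / ((real m + 1) * f x)) * Tn m (H x) (p x) (F x) + y * Tn m (H x) (p x) (\<Xi> x)"
        using Tn_linear[OF sym, of m x "p x" "\<eta> x * (y / ((real m + 1) * f x))" "F x" y "\<Xi> x"] by simp
      have "y ^ m * (y / ((real m + 1) * f x)) = f x / ((real m + 1) * f x)"
        using y by (simp add: mult.commute)
      also have "\<dots> = 1 / (real m + 1)" using f0[of x] by simp
      finally have e: "y ^ m * (y / ((real m + 1) * f x)) = 1 / (real m + 1)" .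
      have "(\<eta> x * y) ^ m * (\<eta> x * c * s) = (\<eta> x ^ Suc m * s) * (y ^ m * c)" for c s
        by (simp add: power_mult_distrib mult_ac)
      then have 1: "(\<eta> x * y) ^ m * (\<eta> x * (y / ((real m + 1) * f x)) * s) = \<eta> x ^ Suc m * s / (real m + 1)" for s
        by (simp only: e) simp
      have 2: "(\<eta> x * y) ^ m * (y * s) = \<eta> x ^ m * f x * s" "(\<eta> x * y) ^ Suc m = \<eta> x ^ Suc m * f x" for s
        using y by (simp_all add: power_mult_distrib mult_ac)
      define M where "M = real m + 1"
      have M: "M \<noteq> 0" by (simp add: M_def)
      show ?thesis
        unfolding y_def[symmetric] T distrib_left[of "(\<eta> x * y) ^ m"] 1 2 J_def
        unfolding M_def[symmetric]
        using M by (simp add: add_divide_distrib mult_ac)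
    qed
    then have "bint R (\<lambda>x. 1 / (real m + 1) * J f F x) = 0" using z by simp
    then show ?thesis unfolding bint_cmult by simp
  qed
  have any: "bint R (J f F) = 0" if f: "has_grad f F" for f F
  proof -
    \<comment> \<open>Any \<open>f\<close> is the difference of the positive functions
      \<open>f^2 + f + 1\<close> and \<open>f^2 + 1\<close>, and \<open>J\<close> is linear in the
      pair of function and gradient.\<close>
    define a b where "a x = f x * f x + f x + 1" and "b x = f x * f x + 1" for x
    define A B where "A x = f x *\<^sub>R F x + f x *\<^sub>R F x + F x" and "B x = f x *\<^sub>R F x + f x *\<^sub>R F x" for x
    have a: "has_grad a A"
      using has_grad_add[OF has_grad_add[OF has_grad_mult[OF f f] f] has_grad_const[of 1]]
      by (simp add: a_def[abs_def] A_def[abs_def])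
    have b: "has_grad b B"
      using has_grad_add[OF has_grad_mult[OF f f] has_grad_const[of 1]]
      by (simp add: b_def[abs_def] B_def[abs_def])
    have "a x > 0" for x
    proof -
      have "4 * a x = (2 * f x + 1)\<^sup>2 + 3" by (simp add: a_def power2_eq_square algebra_simps)
      then show ?thesis using zero_le_power2[of "2 * f x + 1"] by linarith
    qed
    moreover have "b x > 0" for x by (simp add: b_def add_nonneg_pos)
    ultimately have z: "bint R (J a A) = 0" "bint R (J b B) = 0" using pos a b by auto
    have "J f F x = J a A x - J b B x" for x
    proof -
      have "Tn m (H x) (p x) (A x) = Tn m (H x) (p x) (B x) + Tn m (H x) (p x) (F x)"
        using Tn_linear[OF sym, of m x "p x" 1 "B x" 1 "F x"] by (simp add: A_def B_def)
      then show ?thesis by (simp add: J_def a_def b_def algebra_simps)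
    qed
    then have "bint R (J f F) = bint R (\<lambda>x. J a A x - J b B x)" by (intro bint_cong)
    also have "\<dots> = bint R (J a A) - bint R (J b B)"
      unfolding J_def by (rule bint_diff) (intro continuous_intros cH cp has_gradD[OF a] has_gradD[OF b] has_gradD[OF \<eta>])+
    finally show ?thesis using z by simp
  qed
  \<comment> \<open>The powers of \<open>\<eta>\<close> beyond \<open>m + 1\<close> are absorbed
    into \<open>f\<close>.\<close>
  obtain d where d: "N = Suc m + d" using N le_Suc_ex by blast
  have J0: "bint R (J (\<lambda>x. \<eta> x ^ d * f x) (\<lambda>x. \<eta> x ^ d *\<^sub>R F x + f x *\<^sub>R ((real d * \<eta> x ^ (d - 1)) *\<^sub>R \<Xi> x))) = 0"
    by (intro any has_grad_mult has_grad_power \<eta> f)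
  have J1: "J (\<lambda>x. \<eta> x ^ d * f x) (\<lambda>x. \<eta> x ^ d *\<^sub>R F x + f x *\<^sub>R ((real d * \<eta> x ^ (d - 1)) *\<^sub>R \<Xi> x)) x =
     (real m + 1) * csig (Suc m) (H x) * f x * \<eta> x ^ N
     + \<eta> x ^ N * Tn m (H x) (p x) (F x) + real N * \<eta> x ^ (N - 1) * f x * Tn m (H x) (p x) (\<Xi> x)" for x
  proof -
    have T: "Tn m (H x) (p x) (\<eta> x ^ d *\<^sub>R F x + f x *\<^sub>R ((real d * \<eta> x ^ (d - 1)) *\<^sub>R \<Xi> x)) =
       \<eta> x ^ d * Tn m (H x) (p x) (F x) + f x * (real d * \<eta> x ^ (d - 1)) * Tn m (H x) (p x) (\<Xi> x)"
      using Tn_linear[OF sym, of m x "p x" "\<eta> x ^ d" "F x" "f x * (real d * \<eta> x ^ (d - 1))" "\<Xi> x"] by simp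
    have 1: "real d * (\<eta> x ^ Suc m * \<eta> x ^ (d - 1)) = real d * \<eta> x ^ (N - 1)"
      using d by (cases d) (simp_all add: power_add)
    have "J (\<lambda>x. \<eta> x ^ d * f x) (\<lambda>x. \<eta> x ^ d *\<^sub>R F x + f x *\<^sub>R ((real d * \<eta> x ^ (d - 1)) *\<^sub>R \<Xi> x)) x =
      (real m + 1) * csig (Suc m) (H x) * f x * (\<eta> x ^ Suc m * \<eta> x ^ d)
     + (\<eta> x ^ Suc m * \<eta> x ^ d) * Tn m (H x) (p x) (F x)
     + (real d * (\<eta> x ^ Suc m * \<eta> x ^ (d - 1)) + (real m + 1) * (\<eta> x ^ m * \<eta> x ^ d)) * f x * Tn m (H x) (p x) (\<Xi> x)"
      unfolding J_def T by (simp add: algebra_simps)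
    also have "\<eta> x ^ Suc m * \<eta> x ^ d = \<eta> x ^ N" by (simp only: d power_add)
    also have "\<eta> x ^ m * \<eta> x ^ d = \<eta> x ^ (N - 1)" by (simp add: d power_add)
    finally show ?thesis unfolding 1 by (simp add: d algebra_simps)
  qed
  show ?thesis by (rule trans[OF bint_cong[OF J1[symmetric]] J0])
qed

section \<open>Pointwise inequalities in the cone\<close>

lemma orthogonal_vector_matrix_inner:
  fixes Q :: "real^'n^'n"
  assumes "orthogonal_matrix Q"
  shows "(\<Sum>i\<in>UNIV. (a v* Q) $ i * (b v* Q) $ i) = a \<bullet> b"
proof -
  have "(a v* Q) \<bullet> (b v* Q) = a \<bullet> (Q *v (b v* Q))"
    by (simp add: dot_lmul_matrix)
  also have "Q *v (b v* Q) = b"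
    using assms unfolding transpose_matrix_vector[symmetric] matrix_vector_mul_assoc
    by (simp add: orthogonal_matrix_def)
  finally show ?thesis by (simp add: inner_vec_def)
qed

lemma Tn_0: "transpose H = H \<Longrightarrow> Tn 0 H a b = a \<bullet> b"
  by (rule spectral_theorem[of H]) (auto simp: Tn_diagonalized orthogonal_vector_matrix_inner)

lemma esym_remove_le:
  fixes l :: "'n::finite \<Rightarrow> real"
  assumes pos: "\<And>j. j \<le> k \<Longrightarrow> esym UNIV l j > 0" and m: "m < k"
  shows "esym (UNIV - {i}) l m \<le> CARD('n) * esym UNIV l m"
proof -
  have "esym (UNIV - {i}) l m \<le> (\<Sum>i\<in>UNIV. esym (UNIV - {i}) l m)"
    using esym_remove_pos[OF finite UNIV_I pos m] by (intro member_le_sum) (auto intro: less_imp_le)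
  also have "\<dots> = (real CARD('n) - real m) * esym UNIV l m" by (rule sum_esym_remove) simp
  also have "\<dots> \<le> CARD('n) * esym UNIV l m"
    using pos[of m] m by (intro mult_right_mono) auto
  finally show ?thesis .
qed

lemma Tn_nonneg:
  assumes sym: "transpose H = H" and pos: "\<And>j. j \<le> k \<Longrightarrow> csig j H > 0" and m: "m < k"
  shows "Tn m H a a \<ge> 0"
proof -
  obtain Q l where Q: "orthogonal_matrix Q" "H = Q ** diagm l ** transpose Q"
    using spectral_theorem[OF sym] .
  have "esym UNIV l j > 0" if "j \<le> k" for j
    using pos[OF that] by (simp add: Q csig_diagonalized)
  then have "esym (UNIV - {i}) l m > 0" for i by (intro esym_remove_pos[where k = k] m) auto
  then show ?thesis
    unfolding Q(2) Tn_diagonalized[OF Q(1)] by (intro sum_nonneg) (simp add: less_imp_le)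
qed

text \<open>For \<open>m < k\<close> the Newton tensor is positive, and by
  \<open>esym_remove_le\<close> its eigenvalues are at most \<open>n \<sigma>_m\<close>. In use,
  \<open>b\<close> is the gradient of a cutoff.\<close>

lemma Tn_Cauchy_Schwarz:
  fixes H :: "real^'n^'n"
  assumes sym: "transpose H = H" and pos: "\<And>j. j \<le> k \<Longrightarrow> csig j H > 0" and m: "m < k"
  shows "(Tn m H a b)\<^sup>2 \<le> Tn m H a a * (CARD('n) * csig m H * (b \<bullet> b))"
proof -
  obtain Q l where Q: "orthogonal_matrix Q" "H = Q ** diagm l ** transpose Q"
    using spectral_theorem[OF sym] .
  have pos': "esym UNIV l j > 0" if "j \<le> k" for j
    using pos[OF that] by (simp add: Q csig_diagonalized)
  define d where "d i = esym (UNIV - {i}) l m" for i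
  have d: "d i > 0" for i unfolding d_def by (rule esym_remove_pos[where k = k]) (use pos' m in auto)
  define x y where "x i = (a v* Q) $ i" and "y i = (b v* Q) $ i" for i
  have "(Tn m H a b)\<^sup>2 = (\<Sum>i\<in>UNIV. (sqrt (d i) * x i) * (sqrt (d i) * y i))\<^sup>2"
  proof -
    have "(sqrt (d i) * x i) * (sqrt (d i) * y i) = x i * y i * (sqrt (d i) * sqrt (d i))" for i
      by (simp only: mult_ac)
    then have eq: "(sqrt (d i) * x i) * (sqrt (d i) * y i) = x i * y i * d i" for i
      using d[of i] by (simp add: less_imp_le)
    show ?thesis
      unfolding eq unfolding x_def y_def d_def unfolding Q(2) Tn_diagonalized[OF Q(1)] ..
  qed
  also have "\<dots> \<le> (\<Sum>i\<in>UNIV. (sqrt (d i) * x i)\<^sup>2) * (\<Sum>i\<in>UNIV. (sqrt (d i) * y i)\<^sup>2)"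
    by (rule Cauchy_Schwarz_ineq_sum)
  also have "(\<Sum>i\<in>UNIV. (sqrt (d i) * x i)\<^sup>2) = Tn m H a a"
    unfolding Q(2) Tn_diagonalized[OF Q(1)]
    using d by (intro sum.cong refl) (simp add: power_mult_distrib less_imp_le x_def d_def power2_eq_square)
  also have "(\<Sum>i\<in>UNIV. (sqrt (d i) * y i)\<^sup>2) \<le> (\<Sum>i\<in>UNIV. (CARD('n) * csig m H) * (y i * y i))"
  proof (intro sum_mono)
    fix i
    have "(sqrt (d i) * y i)\<^sup>2 = d i * (y i * y i)"
      using d[of i] by (simp add: power_mult_distrib less_imp_le power2_eq_square)
    also have "\<dots> \<le> (CARD('n) * csig m H) * (y i * y i)"
      using esym_remove_le[OF pos' m, of i] by (intro mult_right_mono) (auto simp: d_def Q csig_diagonalized)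
    finally show "(sqrt (d i) * y i)\<^sup>2 \<le> (CARD('n) * csig m H) * (y i * y i)" .
  qed
  also have "\<dots> = CARD('n) * csig m H * (b \<bullet> b)"
    by (simp only: y_def orthogonal_vector_matrix_inner[OF Q(1)] flip: sum_distrib_left)
  finally show ?thesis using Tn_nonneg[OF sym pos m] by (simp add: mult_left_mono)
qed

text \<open>The recursion \<open>T_(m+1) = \<sigma>_(m+1) 1 - T_m H\<close> of the Newton tensors;
  eigenvalue by eigenvalue it is \<open>esym_remove\<close>.\<close>

lemma Tn_Hessian_mult:
  fixes H :: "real^'n^'n"
  assumes sym: "transpose H = H"
  shows "Tn m H a (H *v a) = (a \<bullet> a) * csig (Suc m) H - Tn (Suc m) H a a"
proof -
  obtain Q l where Q: "orthogonal_matrix Q" "H = Q ** diagm l ** transpose Q"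
    using spectral_theorem[OF sym] .
  have "(H *v a) v* Q = transpose Q *v (Q ** diagm l ** transpose Q *v a)"
    by (simp add: Q)
  also have "\<dots> = (transpose Q ** Q) ** diagm l *v (transpose Q *v a)"
    by (simp only: matrix_vector_mul_assoc matrix_mul_assoc)
  also have "\<dots> = diagm l *v (a v* Q)"
    using Q(1) by (simp add: orthogonal_matrix_def)
  finally have Ha: "((H *v a) v* Q) $ i = l i * (a v* Q) $ i" for i
    by (simp add: matrix_vector_mult_def diagm_def if_distrib[of "\<lambda>x. x * _"] cong: if_cong)
  have r: "l i * esym (UNIV - {i}) l m = esym UNIV l (Suc m) - esym (UNIV - {i}) l (Suc m)" for i
    using esym_remove[of UNIV i l m] by simp
  have "Tn m H a (H *v a) = (\<Sum>i\<in>UNIV. (a v* Q) $ i * ((H *v a) v* Q) $ i * esym (UNIV - {i}) l m)"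
    by (subst (1) Q(2)) (rule Tn_diagonalized[OF Q(1)])
  also have "\<dots> = (\<Sum>i\<in>UNIV. (a v* Q) $ i * (a v* Q) $ i * esym UNIV l (Suc m)
      - (a v* Q) $ i * (a v* Q) $ i * esym (UNIV - {i}) l (Suc m))"
    by (intro sum.cong refl) (simp add: Ha r[symmetric] right_diff_distrib[symmetric] mult_ac)
  also have "\<dots> = (a \<bullet> a) * csig (Suc m) H - Tn (Suc m) H a a"
    unfolding Q(2) Tn_diagonalized[OF Q(1)] csig_diagonalized[OF Q(1)] sum_subtractf
    by (simp only: orthogonal_vector_matrix_inner[OF Q(1)] flip: sum_distrib_right)
  finally show ?thesis .
qed

lemma outer_uminus: "outer a (- b) = - outer a b"
  by (simp add: outer_def vec_eq_iff)

text \<open>The matrix \<open>w H - outer p p\<close> is a positive multiple of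
  \<open>- D^2 u\<close>, so this translates the cone condition and the equation into statements
  about \<open>w\<close>, \<open>p\<close> and \<open>H\<close>.\<close>

lemma csig_minus_rank_one:
  assumes "transpose H = H"
  shows "csig (Suc m) (w *\<^sub>R H - outer p p) = w ^ m * (w * csig (Suc m) H - Tn m H p p)"
  using csig_scale_rank_one[OF assms, of m w p "- p"] Tn_scale[OF assms, of m p "-1" p]
  by (simp add: outer_uminus algebra_simps)

text \<open>Adding \<open>outer p p\<close> to a matrix of the cone increases
  \<open>csig (Suc m)\<close> by \<open>T_m(A)[p,p]\<close>, which is nonnegative; hence
  \<open>w H\<close>, and with it \<open>H\<close>, stays in the cone.\<close>

lemma csig_pos_add_rank_one:
  fixes A H :: "real^'n^'n"
  assumes symA: "transpose A = A" and symH: "transpose H = H"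
    and pos: "\<And>j. j \<le> k \<Longrightarrow> csig j A > 0" and j: "j \<le> k"
    and A: "A = w *\<^sub>R H - outer p p" and w: "w > 0"
  shows "csig j H > 0"
proof (cases j)
  case (Suc m)
  have "outer 0 0 = (0 :: real^'n^'n)" by (simp add: outer_def vec_eq_iff)
  moreover have "Tn m H 0 0 = 0" using Tn_scale[OF symH, of m 0 0 0] by simp
  ultimately have "w ^ Suc m * csig (Suc m) H = csig (Suc m) (w *\<^sub>R H)"
    using csig_scale_rank_one[OF symH, of m w 0 0] by simp
  also have "w *\<^sub>R H = A + outer p p" by (simp add: A)
  also have "csig (Suc m) (A + outer p p) = csig (Suc m) A + Tn m A p p" by (simp add: Tn_def)
  also have "\<dots> > 0"
  proof -
    have "Tn m A p p \<ge> 0" using Suc j pos by (intro Tn_nonneg[OF symA, where k = k]) auto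
    then show ?thesis using pos[of "Suc m"] Suc j by simp
  qed
  finally have "w ^ Suc m * csig (Suc m) H > 0" .
  moreover have "w ^ Suc m > 0" using w by simp
  ultimately show ?thesis using Suc by (metis zero_less_mult_pos)
qed simp

text \<open>With \<open>E i = e - 2 * t i\<close> and \<open>a\<close> the symmetric function of order \<open>k - 2\<close> without \<open>i\<close> and \<open>j\<close>, the
  identity \<open>a * (s i * E j - s j * E i) = (s i - s j) * (2 * s i * s j - a * e)\<close> reduces the estimate to
  \<open>a * e \<le> s i * s j\<close>, which is Newton's inequality.\<close>

lemma esym_pair_estimate:
  fixes l :: "'n::finite \<Rightarrow> real"
  assumes pos: "\<And>j. j \<le> k \<Longrightarrow> esym UNIV l j > 0" and k: "k \<ge> 2"
  defines "s \<equiv> \<lambda>i. esym (UNIV - {i}) l (k - 1)" and "t \<equiv> \<lambda>i. esym (UNIV - {i}) l k"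
  defines "e \<equiv> esym UNIV l k"
  shows "(s i - s j)\<^sup>2 * e\<^sup>2 \<le> ((e - 2 * t i)\<^sup>2 * s j + (e - 2 * t j)\<^sup>2 * s i) * (s i + s j)"
proof (cases "i = j")
  case True
  have "s j > 0" unfolding s_def by (rule esym_remove_pos[where k = k]) (use pos k in auto)
  then show ?thesis using True by simp
next
  case False
  obtain m where m: "k = Suc (Suc m)" using le_Suc_ex[OF k] by auto
  let ?U = "UNIV - {i} - {j}"
  have U: "UNIV - {j} - {i} = ?U" by blast
  define a b c x y where "a = esym ?U l m" and "b = esym ?U l (Suc m)" and "c = esym ?U l (Suc (Suc m))"
    and "x = l i" and "y = l j"
  have si: "s i = b + y * a" and ti: "t i = c + y * b"
    using esym_remove[of "UNIV - {i}" j l] False by (simp_all add: s_def t_def m a_def b_def c_def y_def)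
  have sj: "s j = b + x * a" and tj: "t j = c + x * b"
    using esym_remove[of "UNIV - {j}" i l] False by (simp_all add: s_def t_def m U a_def b_def c_def x_def)
  have e: "e = t i + x * s i"
    using esym_remove[of UNIV i l "Suc m"] by (simp add: e_def t_def s_def m x_def)
  have pos_i: "esym (UNIV - {i}) l r > 0" if "r < k" for r
    by (rule esym_remove_pos[where k = k]) (use pos that in auto)
  have pos_j: "esym (UNIV - {j}) l r > 0" if "r < k" for r
    by (rule esym_remove_pos[where k = k]) (use pos that in auto)
  have s: "s i > 0" "s j > 0" using pos_i[of "k - 1"] pos_j[of "k - 1"] k by (simp_all add: s_def)
  have a: "a > 0" unfolding a_def
    by (rule esym_remove_pos[where k = "k - 1"]) (use pos_i m False in auto)
  have e0: "e > 0" using pos[of k] by (simp add: e_def)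
  have "a * c \<le> b\<^sup>2" unfolding a_def b_def c_def by (rule esym_newton_weak) simp
  then have se: "a * e \<le> s i * s j" by (simp add: e si sj ti power2_eq_square algebra_simps)
  define D where "D = s i * (e - 2 * t j) - s j * (e - 2 * t i)"
  have aD: "a * D = (s i - s j) * (2 * (s i * s j) - a * e)"
    by (simp add: D_def e si sj ti tj algebra_simps)
  have "a * e \<le> 2 * (s i * s j) - a * e" using se by simp
  then have "(a * e)\<^sup>2 \<le> (2 * (s i * s j) - a * e)\<^sup>2"
    using a e0 by (intro power_mono) auto
  then have "(s i - s j)\<^sup>2 * (a * e)\<^sup>2 \<le> (a * D)\<^sup>2"
    unfolding aD power_mult_distrib by (intro mult_left_mono) auto
  then have "a\<^sup>2 * ((s i - s j)\<^sup>2 * e\<^sup>2) \<le> a\<^sup>2 * D\<^sup>2" by (simp add: power_mult_distrib mult_ac)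
  then have "(s i - s j)\<^sup>2 * e\<^sup>2 \<le> D\<^sup>2" using a by simp
  also have "\<dots> \<le> D\<^sup>2 + s i * s j * ((e - 2 * t i) + (e - 2 * t j))\<^sup>2" using s by simp
  also have "\<dots> = ((e - 2 * t i)\<^sup>2 * s j + (e - 2 * t j)\<^sup>2 * s i) * (s i + s j)"
    by (simp add: D_def power2_eq_square algebra_simps)
  finally show ?thesis .
qed

text \<open>After expansion in \<open>l i\<close>, the right side minus the left side is
  \<open>2 (k - 1) t^2 - 2 (k + 1) s r\<close>, which is nonnegative by Newton's inequality at order
  \<open>k\<close> for the remaining \<open>2k - 1\<close> values.\<close>

lemma esym_remove_newton_square:
  fixes l :: "'n::finite \<Rightarrow> real" and i :: 'n
  assumes n: "CARD('n) = 2 * k" and k: "k \<ge> 2"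
  defines "s \<equiv> esym (UNIV - {i}) l (k - 1)" and "t \<equiv> esym (UNIV - {i}) l k"
  defines "e \<equiv> esym UNIV l k"
  shows "(e - 2 * t)\<^sup>2 \<le> e\<^sup>2 + 2 * (real k - 1) * t * e - 2 * (real k + 1) * esym UNIV l (Suc k) * s"
proof -
  obtain m where m: "k = Suc m" using k by (cases k) auto
  define r where "r = esym (UNIV - {i}) l (Suc k)"
  have e: "e = t + l i * s" using esym_remove[of UNIV i l m] by (simp add: e_def t_def s_def m)
  have e': "esym UNIV l (Suc k) = r + l i * t"
    using esym_remove[of UNIV i l k] by (simp add: r_def t_def)
  have c: "card (UNIV - {i}) = 2 * k - 1" using n by simp
  have "real k * ((real k + 1) * (s * r)) \<le> real k * ((real k - 1) * t\<^sup>2)"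
    using esym_newton[of "UNIV - {i}" m l] k unfolding c
    by (simp add: m s_def r_def t_def algebra_simps of_nat_diff)
  then have "(real k + 1) * (s * r) \<le> (real k - 1) * t\<^sup>2"
    using k by (subst (asm) mult_le_cancel_left_pos) auto
  then show ?thesis unfolding e e' by (simp add: power2_eq_square algebra_simps)
qed

text \<open>For \<open>p = \<nabla>w\<close> and \<open>H = D\<^sup>2w\<close>, \<open>defect\<close> is \<open>- w\<^sup>k div V\<close> and \<open>flux\<close> is \<open>w\<^sup>k\<^sup>+\<^sup>1 (V \<bullet> x)\<close>.\<close>

definition defect :: "nat \<Rightarrow> real \<Rightarrow> real^'n^'n \<Rightarrow> real^'n \<Rightarrow> real" where
  "defect k w H p = csig 1 H * csig k H - 2 * (real k + 1) * csig (Suc k) H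
     + ((p \<bullet> p) * csig k H - csig 1 H * Tn (k - 1) H p p + 2 * (real k - 1) * Tn k H p p) / w"

definition flux :: "nat \<Rightarrow> real \<Rightarrow> real \<Rightarrow> real^'n^'n \<Rightarrow> real^'n \<Rightarrow> real^'n \<Rightarrow> real" where
  "flux k c w H p x = 2 * w * Tn k H p x - (p \<bullet> p) * Tn (k - 1) H p x - c * (p \<bullet> x)"

lemma sum_square_le_card:
  fixes f :: "'a \<Rightarrow> real"
  assumes "finite I" "\<And>i. i \<in> I \<Longrightarrow> (f i)\<^sup>2 \<le> B"
  shows "(\<Sum>i\<in>I. f i)\<^sup>2 \<le> (real (card I))\<^sup>2 * B"
proof -
  have "(\<Sum>i\<in>I. f i)\<^sup>2 \<le> (\<Sum>i\<in>I. (f i)\<^sup>2) * card I"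
    using Cauchy_Schwarz_ineq_sum[of f "\<lambda>_. 1" I] by simp
  also have "\<dots> \<le> (card I * B) * card I"
    using sum_bounded_above[of I "\<lambda>i. (f i)\<^sup>2" B] assms by (intro mult_right_mono) auto
  finally show ?thesis by (simp add: power2_eq_square mult_ac)
qed

section \<open>Defect and flux in an eigenbasis of the Hessian\<close>

context
  fixes k :: nat and Q :: "real^'n^'n" and l :: "'n \<Rightarrow> real" and p x :: "real^'n" and w c :: real
  assumes n: "CARD('n) = 2 * k" and k: "k \<ge> 2" and Q: "orthogonal_matrix Q"
    and pos: "\<And>j. j \<le> k \<Longrightarrow> esym UNIV l j > 0" and w: "w > 0" and c: "c > 0"
    and eq: "w * esym UNIV l k - Tn (k - 1) (Q ** diagm l ** transpose Q) p p = c"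
begin

private abbreviation "H \<equiv> Q ** diagm l ** transpose Q"
private abbreviation "q \<equiv> \<lambda>i. (p v* Q) $ i"
private abbreviation "y \<equiv> \<lambda>i. (x v* Q) $ i"
private abbreviation "e \<equiv> esym UNIV l k"
private abbreviation "s \<equiv> \<lambda>i. esym (UNIV - {i}) l (k - 1)"
private abbreviation "t \<equiv> \<lambda>i. esym (UNIV - {i}) l k"
text \<open>\<open>N\<close> is the Newton-Maclaurin deficit, with constant \<open>2 (k + 1)\<close>
  because \<open>n = 2k\<close>. \<open>Z\<close> collects the squares that will control the
  flux.\<close>

private abbreviation "N \<equiv> esym UNIV l 1 * e - 2 * (real k + 1) * esym UNIV l (Suc k)"
private abbreviation "Z \<equiv> \<Sum>i\<in>UNIV. (q i)\<^sup>2 * (e - 2 * t i)\<^sup>2"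

private lemma e_pos: "e > 0" and s_pos: "s i > 0"
proof -
  show "e > 0" using pos[of k] by simp
  show "s i > 0" by (rule esym_remove_pos[where k = k]) (use pos k in auto)
qed

private lemma T_eqs:
  "p \<bullet> p = (\<Sum>i\<in>UNIV. (q i)\<^sup>2)" "p \<bullet> x = (\<Sum>i\<in>UNIV. q i * y i)" "x \<bullet> x = (\<Sum>i\<in>UNIV. (y i)\<^sup>2)"
  "Tn (k - 1) H p p = (\<Sum>i\<in>UNIV. (q i)\<^sup>2 * s i)" "Tn k H p p = (\<Sum>i\<in>UNIV. (q i)\<^sup>2 * t i)"
  "Tn (k - 1) H p x = (\<Sum>i\<in>UNIV. q i * y i * s i)" "Tn k H p x = (\<Sum>i\<in>UNIV. q i * y i * t i)"
  by (simp_all only: orthogonal_vector_matrix_inner[OF Q] Tn_diagonalized[OF Q] power2_eq_square)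

private lemma w_eq: "w * e = c + (\<Sum>i\<in>UNIV. (q i)\<^sup>2 * s i)"
  using eq unfolding T_eqs by simp

private lemma N_nonneg: "N \<ge> 0"
proof -
  have "real k * (2 * (real k + 1) * esym UNIV l (Suc k)) \<le> real k * (esym UNIV l 1 * e)"
    using newton_maclaurin(1)[of UNIV k l] pos k by (simp add: n algebra_simps)
  then show ?thesis using k by simp
qed

text \<open>Multiplication by \<open>w e\<close>, followed by \<open>w e = c + T_(k-1)[p,p]\<close>
  from the equation, makes the defect \<open>c N\<close> plus a sum of \<open>(q i)^2 G i\<close>,
  and each \<open>G i\<close> dominates a square by
  \<open>esym_remove_newton_square\<close>.\<close>

private lemma defect_bound: "c * N + Z \<le> w * e * defect k w H p"
proof -
  define G where "G i = e\<^sup>2 + 2 * (real k - 1) * t i * e - 2 * (real k + 1) * esym UNIV l (Suc k) * s i" for i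
  have G: "(e - 2 * t i)\<^sup>2 \<le> G i" for i
    using esym_remove_newton_square[OF n k, of l i] by (simp add: G_def)
  have "w * e * defect k w H p = (w * e) * N + e * ((p \<bullet> p) * e - esym UNIV l 1 * Tn (k - 1) H p p + 2 * (real k - 1) * Tn k H p p)"
    using w by (simp add: defect_def csig_diagonalized[OF Q] field_simps)
  also have "\<dots> = c * N + (\<Sum>i\<in>UNIV. (q i)\<^sup>2 * (s i * N + e * (e - esym UNIV l 1 * s i + 2 * (real k - 1) * t i)))"
    unfolding w_eq T_eqs
    by (simp add: sum_distrib_left sum_distrib_right sum.distrib sum_subtractf algebra_simps)
  also have "(\<Sum>i\<in>UNIV. (q i)\<^sup>2 * (s i * N + e * (e - esym UNIV l 1 * s i + 2 * (real k - 1) * t i))) = (\<Sum>i\<in>UNIV. (q i)\<^sup>2 * G i)"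
    by (intro sum.cong refl) (simp add: G_def power2_eq_square algebra_simps)
  finally have "w * e * defect k w H p = c * N + (\<Sum>i\<in>UNIV. (q i)\<^sup>2 * G i)" .
  moreover have "Z \<le> (\<Sum>i\<in>UNIV. (q i)\<^sup>2 * G i)" using G by (intro sum_mono mult_left_mono) auto
  ultimately show ?thesis by linarith
qed

private lemma Z_nonneg: "Z \<ge> 0"
  by (intro sum_nonneg) auto

private lemma defect_nonneg': "defect k w H p \<ge> 0"
proof -
  have "0 \<le> w * e * defect k w H p"
    using defect_bound N_nonneg Z_nonneg c by (smt (verit) mult_nonneg_nonneg)
  then have "(w * e) * 0 \<le> (w * e) * defect k w H p" by simp
  moreover have "w * e > 0" using w e_pos by simp
  ultimately show ?thesis by (simp only: mult_le_cancel_left_pos)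
qed

text \<open>As \<open>c > 0\<close>, a vanishing defect forces \<open>N = 0\<close>, the equality
  case of Newton-Maclaurin.\<close>

private lemma defect_zero': 
  assumes "defect k w H p = 0"
  shows "l i = esym UNIV l 1 / CARD('n)"
proof -
  have "c * N \<le> 0" using defect_bound Z_nonneg assms by simp
  then have "N = 0" using N_nonneg c by (simp add: mult_le_0_iff)
  then have "(real k + 1) * real (card (UNIV :: 'n set)) * esym UNIV l (Suc k)
      = (real (card (UNIV :: 'n set)) - real k) * (esym UNIV l 1 * esym UNIV l k)"
    by (simp add: n algebra_simps)
  then have "2 * real (card (UNIV :: 'n set)) * esym UNIV l 2 = (real (card (UNIV :: 'n set)) - 1) * (esym UNIV l 1)\<^sup>2"
    using newton_maclaurin(2)[of UNIV k l] pos k n by auto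
  then show ?thesis by (intro all_equal_if_newton_eq) auto
qed

text \<open>In the product of \<open>(q i)^2 (q j)^2\<close> with \<open>esym_pair_estimate\<close>,
  each summand splits into a factor \<open>(q i)^2 (e - 2 t i)^2 \<le> Z\<close> and a factor
  \<open>(q j)^2 s j \<le> w e\<close>, or the same with \<open>i\<close> and \<open>j\<close>
  exchanged; \<open>Z\<close> in turn is at most \<open>w e\<close> times the defect.\<close>

private lemma pair_bound:
  "(q i)\<^sup>2 * (q j)\<^sup>2 * (s i - s j)\<^sup>2 \<le> 8 * CARD('n) * w\<^sup>2 * defect k w H p * esym UNIV l (k - 1)"
proof -
  have Zi: "(q i)\<^sup>2 * (e - 2 * t i)\<^sup>2 \<le> Z" for i by (intro member_le_sum) auto
  have bi: "(q i)\<^sup>2 * s i \<le> w * e" for i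
  proof -
    have "(q i)\<^sup>2 * s i \<le> (\<Sum>i\<in>UNIV. (q i)\<^sup>2 * s i)"
      by (intro member_le_sum mult_nonneg_nonneg zero_le_power2 less_imp_le[OF s_pos] finite UNIV_I)
    then show ?thesis using w_eq c by linarith
  qed
  have si: "s i \<le> CARD('n) * esym UNIV l (k - 1)" for i
    by (rule esym_remove_le[where k = k]) (use pos k in auto)
  have Zw: "Z \<le> w * e * defect k w H p"
    using defect_bound mult_nonneg_nonneg[of c N] c N_nonneg by linarith
  define Ei Ej where "Ei = (e - 2 * t i)\<^sup>2" and "Ej = (e - 2 * t j)\<^sup>2"
  have nn: "Ei \<ge> 0" "Ej \<ge> 0" "s i \<ge> 0" "s j \<ge> 0" using s_pos[of i] s_pos[of j] by (simp_all add: Ei_def Ej_def)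
  have "e\<^sup>2 * ((q i)\<^sup>2 * (q j)\<^sup>2 * (s i - s j)\<^sup>2) = (q i)\<^sup>2 * (q j)\<^sup>2 * ((s i - s j)\<^sup>2 * e\<^sup>2)"
    by (simp only: mult_ac)
  also have "\<dots> \<le> (q i)\<^sup>2 * (q j)\<^sup>2 * ((Ei * s j + Ej * s i) * (s i + s j))"
    using esym_pair_estimate[OF pos k, of i j] unfolding Ei_def Ej_def by (intro mult_left_mono) auto
  also have "\<dots> = (((q i)\<^sup>2 * Ei) * ((q j)\<^sup>2 * s j) + ((q j)\<^sup>2 * Ej) * ((q i)\<^sup>2 * s i)) * (s i + s j)"
    by (simp add: algebra_simps)
  also have "\<dots> \<le> (Z * (w * e) + Z * (w * e)) * (s i + s j)"
  proof -
    have "((q i)\<^sup>2 * Ei) * ((q j)\<^sup>2 * s j) \<le> Z * (w * e)"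
      by (rule mult_mono) (use Zi[of i] bi[of j] nn Z_nonneg in \<open>auto simp: Ei_def\<close>)
    moreover have "((q j)\<^sup>2 * Ej) * ((q i)\<^sup>2 * s i) \<le> Z * (w * e)"
      by (rule mult_mono) (use Zi[of j] bi[of i] nn Z_nonneg in \<open>auto simp: Ej_def\<close>)
    ultimately show ?thesis using nn by (intro mult_right_mono add_mono) auto
  qed
  also have "\<dots> \<le> (Z * (w * e) + Z * (w * e)) * (2 * (CARD('n) * esym UNIV l (k - 1)))"
    using si[of i] si[of j] Z_nonneg w e_pos by (intro mult_left_mono) auto
  also have "\<dots> = Z * (4 * (w * e) * (CARD('n) * esym UNIV l (k - 1)))"
    by (simp add: algebra_simps)
  also have "\<dots> \<le> (w * e * defect k w H p) * (4 * (w * e) * (CARD('n) * esym UNIV l (k - 1)))"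
    using w e_pos pos[of "k - 1"] by (intro mult_right_mono[OF Zw]) auto
  also have "\<dots> \<le> e\<^sup>2 * (8 * CARD('n) * w\<^sup>2 * defect k w H p * esym UNIV l (k - 1))"
  proof -
    have "0 \<le> e\<^sup>2 * (CARD('n) * w\<^sup>2 * defect k w H p * esym UNIV l (k - 1))"
      using defect_nonneg' pos[of "k - 1"] by (intro mult_nonneg_nonneg) auto
    then show ?thesis by (simp add: power2_eq_square algebra_simps)
  qed
  finally show ?thesis using e_pos by (subst (asm) mult_le_cancel_left_pos) auto
qed

private lemma flux_bound':
  "(flux k c w H p x)\<^sup>2 \<le> 16 * CARD('n) ^ 5 * w\<^sup>2 * defect k w H p * (w * e + (p \<bullet> p) * esym UNIV l (k - 1)) * (x \<bullet> x)"
proof -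
  define D where "D = defect k w H p"
  define m where "m = esym UNIV l (k - 1)"
  have m: "m > 0" using pos[of "k - 1"] by (simp add: m_def)
  have D: "D \<ge> 0" using defect_nonneg' by (simp add: D_def)
  \<comment> \<open>Substituting \<open>c = w e - T_(k-1)[p,p]\<close> splits the flux as
    \<open>- w X1 - X2\<close>. \<open>X1\<close> is controlled by \<open>Z\<close>;
    \<open>X2\<close> measures the failure of \<open>p\<close> to be an eigenvector of
    \<open>T_(k-1)\<close> and involves only the differences bounded by
    \<open>pair_bound\<close>.\<close>
  define X1 where "X1 = (\<Sum>i\<in>UNIV. (q i * (e - 2 * t i)) * y i)"
  define X2 where "X2 = (\<Sum>ij\<in>UNIV \<times> UNIV. (q (snd ij))\<^sup>2 * q (fst ij) * y (fst ij) * (s (fst ij) - s (snd ij)))"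
  have X2: "X2 = (p \<bullet> p) * (\<Sum>i\<in>UNIV. q i * y i * s i) - (\<Sum>i\<in>UNIV. (q i)\<^sup>2 * s i) * (\<Sum>i\<in>UNIV. q i * y i)"
  proof -
    have "X2 = (\<Sum>i\<in>UNIV. \<Sum>j\<in>UNIV. (q j)\<^sup>2 * (q i * y i * s i) - (q j)\<^sup>2 * s j * (q i * y i))"
      unfolding X2_def sum.cartesian_product' by (simp add: algebra_simps)
    also have "\<dots> = (\<Sum>i\<in>UNIV. (p \<bullet> p) * (q i * y i * s i) - (\<Sum>i\<in>UNIV. (q i)\<^sup>2 * s i) * (q i * y i))"
      unfolding sum_subtractf T_eqs by (simp only: sum_distrib_right)
    also have "\<dots> = (p \<bullet> p) * (\<Sum>i\<in>UNIV. q i * y i * s i) - (\<Sum>i\<in>UNIV. (q i)\<^sup>2 * s i) * (\<Sum>i\<in>UNIV. q i * y i)"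
      unfolding sum_subtractf by (simp only: sum_distrib_left)
    finally show ?thesis .
  qed
  have fl: "flux k c w H p x = - (w * X1) - X2"
  proof -
    have c': "c = w * e - (\<Sum>i\<in>UNIV. (q i)\<^sup>2 * s i)" using w_eq by simp
    have "w * X1 = w * e * (\<Sum>i\<in>UNIV. q i * y i) - 2 * w * (\<Sum>i\<in>UNIV. q i * y i * t i)"
      by (simp add: X1_def sum_distrib_left sum_subtractf[symmetric] algebra_simps)
    then show ?thesis unfolding flux_def X2 T_eqs(2,6,7) c' by (simp add: algebra_simps)
  qed
  have Zw: "Z \<le> w * e * D"
    using defect_bound mult_nonneg_nonneg[of c N] c N_nonneg unfolding D_def by linarith
  have "X1\<^sup>2 \<le> Z * (x \<bullet> x)"
    using Cauchy_Schwarz_ineq_sum[of "\<lambda>i. q i * (e - 2 * t i)" y UNIV]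
    unfolding X1_def T_eqs by (simp add: power_mult_distrib)
  also have "\<dots> \<le> (w * e * D) * (x \<bullet> x)" by (intro mult_right_mono Zw) auto
  finally have 1: "(w * X1)\<^sup>2 \<le> w\<^sup>2 * ((w * e * D) * (x \<bullet> x))"
    unfolding power_mult_distrib by (intro mult_left_mono) auto
  define B where "B = (p \<bullet> p) * (x \<bullet> x) * (8 * CARD('n) * w\<^sup>2 * D * m)"
  have bd: "((q j)\<^sup>2 * q i * y i * (s i - s j))\<^sup>2 \<le> B" for i j
  proof -
    have "((q j)\<^sup>2 * q i * y i * (s i - s j))\<^sup>2 = ((q j)\<^sup>2 * (y i)\<^sup>2) * ((q i)\<^sup>2 * (q j)\<^sup>2 * (s i - s j)\<^sup>2)"
      by (simp add: power2_eq_square mult_ac)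
    also have "\<dots> \<le> ((p \<bullet> p) * (x \<bullet> x)) * (8 * CARD('n) * w\<^sup>2 * D * m)"
    proof (rule mult_mono[OF _ pair_bound[folded D_def m_def]])
      have "(q j)\<^sup>2 \<le> p \<bullet> p" unfolding T_eqs by (intro member_le_sum) auto
      moreover have "(y i)\<^sup>2 \<le> x \<bullet> x" unfolding T_eqs by (intro member_le_sum) auto
      ultimately show "(q j)\<^sup>2 * (y i)\<^sup>2 \<le> (p \<bullet> p) * (x \<bullet> x)" by (rule mult_mono) auto
    qed auto
    finally show ?thesis by (simp add: B_def)
  qed
  have "X2\<^sup>2 \<le> (real (card (UNIV \<times> UNIV :: ('n \<times> 'n) set)))\<^sup>2 * B"
    unfolding X2_def by (rule sum_square_le_card) (use bd in auto)
  then have 2: "X2\<^sup>2 \<le> real CARD('n) ^ 4 * B"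
    by (simp add: card_cartesian_product power2_eq_square power4_eq_xxxx mult_ac)
  \<comment> \<open>The power \<open>n^5\<close> comes from \<open>X2\<close>: \<open>n^4\<close> is
    the squared number of index pairs and one more \<open>n\<close> stems from
    \<open>pair_bound\<close>. The term with \<open>X1\<close> is enlarged to the same
    constant.\<close>
  have "1 \<le> real CARD('n)" using n k by simp
  then have one: "1 \<le> real CARD('n) ^ 5" by (rule one_le_power)
  have "(flux k c w H p x)\<^sup>2 \<le> 2 * (w * X1)\<^sup>2 + 2 * X2\<^sup>2"
    using zero_le_power2[of "w * X1 - X2"] unfolding fl by (simp add: power2_eq_square algebra_simps)
  also have "\<dots> \<le> 2 * (w\<^sup>2 * ((w * e * D) * (x \<bullet> x))) + 2 * (real CARD('n) ^ 4 * B)"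
    using 1 2 by simp
  also have "\<dots> \<le> real CARD('n) ^ 5 * (16 * (w\<^sup>2 * ((w * e * D) * (x \<bullet> x)))) + 2 * (real CARD('n) ^ 4 * B)"
  proof -
    define V where "V = w\<^sup>2 * ((w * e * D) * (x \<bullet> x))"
    have V: "0 \<le> V" using w e_pos D by (simp add: V_def)
    have "real CARD('n) ^ 5 * (16 * V) = 16 * (real CARD('n) ^ 5 * V)" by simp
    moreover have "1 * V \<le> real CARD('n) ^ 5 * V" by (rule mult_right_mono[OF one V])
    ultimately have "2 * V \<le> real CARD('n) ^ 5 * (16 * V)" using V by linarith
    then show ?thesis by (simp only: V_def add_right_mono)
  qed
  also have "\<dots> = 16 * CARD('n) ^ 5 * w\<^sup>2 * D * (w * e + (p \<bullet> p) * m) * (x \<bullet> x)"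
    by (simp add: B_def eval_nat_numeral algebra_simps)
  finally show ?thesis by (simp add: D_def m_def)
qed

lemmas diagonal_pointwise = defect_nonneg' defect_zero' flux_bound'

end

lemma
  fixes H :: "real^'n^'n" and k :: nat and w c :: real
  assumes n: "CARD('n) = 2 * k" and k: "k \<ge> 2" and sym: "transpose H = H"
    and pos: "\<And>j. j \<le> k \<Longrightarrow> csig j H > 0" and w: "w > 0" and c: "c > 0"
    and eq: "w * csig k H - Tn (k - 1) H p p = c"
  shows defect_nonneg: "defect k w H p \<ge> 0"
    and defect_eq_0_imp: "defect k w H p = 0 \<Longrightarrow> H = (csig 1 H / CARD('n)) *\<^sub>R mat 1"
    and flux_bound: "(flux k c w H p x)\<^sup>2 \<le> 16 * CARD('n) ^ 5 * w\<^sup>2 * defect k w H p *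
       (w * csig k H + (p \<bullet> p) * csig (k - 1) H) * (x \<bullet> x)"
proof -
  obtain Q l where Q: "orthogonal_matrix Q" and H: "H = Q ** diagm l ** transpose Q"
    using spectral_theorem[OF sym] .
  have pos': "esym UNIV l j > 0" if "j \<le> k" for j
    using pos[OF that] by (simp add: H csig_diagonalized[OF Q])
  have eq': "w * esym UNIV l k - Tn (k - 1) (Q ** diagm l ** transpose Q) p p = c"
    using eq unfolding H csig_diagonalized[OF Q] .
  note dp = diagonal_pointwise[OF n k Q pos' w c eq', folded H]
  show "defect k w H p \<ge> 0" by (rule dp(1))
  show "(flux k c w H p x)\<^sup>2 \<le> 16 * CARD('n) ^ 5 * w\<^sup>2 * defect k w H p *
       (w * csig k H + (p \<bullet> p) * csig (k - 1) H) * (x \<bullet> x)"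
    using dp(3)[of x] by (simp add: H csig_diagonalized[OF Q])
  assume z: "defect k w H p = 0"
  define a where "a = esym UNIV l 1 / CARD('n)"
  have "l = (\<lambda>i. a)" using dp(2)[OF _ z] by (auto simp: a_def)
  then have "H = Q ** (a *\<^sub>R mat 1) ** transpose Q"
  proof -
    have "diagm (\<lambda>i::'n. a) = a *\<^sub>R mat 1" by (simp add: diagm_def mat_def vec_eq_iff)
    then show ?thesis using H \<open>l = _\<close> by simp
  qed
  also have "\<dots> = a *\<^sub>R mat 1"
    using Q by (simp add: matrix_scalar_ac orthogonal_matrix_def flip: scalar_matrix_assoc)
  finally have "H = a *\<^sub>R mat 1" .
  moreover have "csig 1 H = esym UNIV l 1" unfolding H by (rule csig_diagonalized[OF Q])
  ultimately show "H = (csig 1 H / CARD('n)) *\<^sub>R mat 1" by (simp only: a_def)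
qed

section \<open>Cutoff functions\<close>

lemma has_grad_inner_self: "has_grad (\<lambda>x::real^'n. x \<bullet> x) (\<lambda>x. 2 *\<^sub>R x)"
  unfolding has_grad_def
proof (intro conjI allI)
  show "((\<lambda>x::real^'n. x \<bullet> x) has_derivative (\<lambda>h. (2 *\<^sub>R x) \<bullet> h)) (at x)" for x
    by (rule has_derivative_eq_rhs[OF has_derivative_inner[OF has_derivative_ident has_derivative_ident]])
       (auto simp: inner_commute)
qed (intro continuous_intros)

definition bump :: "real \<Rightarrow> real^'n \<Rightarrow> real" where
  "bump R x = max 0 (1 - (x \<bullet> x) / R\<^sup>2)"

text \<open>Squaring makes the truncated paraboloid continuously differentiable. Its gradient
  carries the factor \<open>x\<close>, so it is \<open>O(1/R)\<close> in general but
  \<open>O(R^-2)\<close> on a fixed ball, which \<open>G_eq_0\<close> exploits.\<close>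

definition cutoff :: "real \<Rightarrow> real^'n \<Rightarrow> real" where
  "cutoff R x = (bump R x)\<^sup>2"

definition cutoff_grad :: "real \<Rightarrow> real^'n \<Rightarrow> real^'n" where
  "cutoff_grad R x = (- 4 * bump R x / R\<^sup>2) *\<^sub>R x"

lemma max_0_square_derivative: "((\<lambda>t::real. (max 0 t)\<^sup>2) has_real_derivative 2 * max 0 t) (at t)"
proof -
  consider "t > 0" | "t < 0" | "t = 0" by linarith
  then show ?thesis
  proof cases
    case 1
    have "((\<lambda>t. t\<^sup>2) has_real_derivative 2 * t) (at t)" by (auto intro!: derivative_eq_intros)
    then have "((\<lambda>t. (max 0 t)\<^sup>2) has_real_derivative 2 * t) (at t)"
      by (rule has_field_derivative_transform_within_open[of _ _ _ "{0<..}"]) (use 1 in auto)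
    then show ?thesis using 1 by simp
  next
    case 2
    have "((\<lambda>t. 0) has_real_derivative 0) (at t)" by simp
    then have "((\<lambda>t. (max 0 t)\<^sup>2) has_real_derivative 0) (at t)"
      by (rule has_field_derivative_transform_within_open[of _ _ _ "{..<0}"]) (use 2 in auto)
    then show ?thesis using 2 by simp
  next
    case 3
    have "((\<lambda>h. ((max 0 (0 + h))\<^sup>2 - (max 0 0)\<^sup>2) / h) \<longlongrightarrow> 0) (at (0::real))"
    proof (rule Lim_null_comparison[where g = abs])
      show "\<forall>\<^sub>F h in at (0::real). norm (((max 0 (0 + h))\<^sup>2 - (max 0 0)\<^sup>2) / h) \<le> \<bar>h\<bar>"
        by (intro eventuallyI) (auto simp: power2_eq_square max_def)
      show "(abs \<longlongrightarrow> 0) (at (0::real))" by (rule tendsto_rabs_zero) simp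
    qed
    then show ?thesis using 3 by (simp add: DERIV_def)
  qed
qed

lemma has_grad_cutoff: "has_grad (cutoff R :: real^'n \<Rightarrow> real) (cutoff_grad R)"
proof -
  have "has_grad (\<lambda>x::real^'n. 1 + (-1 / R\<^sup>2) * (x \<bullet> x)) (\<lambda>x. 0 + ((-1 / R\<^sup>2) *\<^sub>R (2 *\<^sub>R x) + (x \<bullet> x) *\<^sub>R 0))"
    by (intro has_grad_add has_grad_const has_grad_mult has_grad_inner_self)
  then have f: "has_grad (\<lambda>x::real^'n. 1 - (x \<bullet> x) / R\<^sup>2) (\<lambda>x. (- 2 / R\<^sup>2) *\<^sub>R x)" by simp
  have "has_grad (\<lambda>x::real^'n. (max 0 (1 - (x \<bullet> x) / R\<^sup>2))\<^sup>2) (\<lambda>x. (2 * max 0 (1 - (x \<bullet> x) / R\<^sup>2)) *\<^sub>R ((- 2 / R\<^sup>2) *\<^sub>R x))"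
    by (rule has_grad_compose[OF f max_0_square_derivative]) (intro continuous_intros)
  moreover have "cutoff R = (\<lambda>x::real^'n. (max 0 (1 - (x \<bullet> x) / R\<^sup>2))\<^sup>2)"
    by (simp add: fun_eq_iff cutoff_def bump_def)
  moreover have "cutoff_grad R = (\<lambda>x::real^'n. (2 * max 0 (1 - (x \<bullet> x) / R\<^sup>2)) *\<^sub>R ((- 2 / R\<^sup>2) *\<^sub>R x))"
    by (simp add: fun_eq_iff cutoff_grad_def bump_def)
  ultimately show ?thesis by (simp only:)
qed

lemma bump_bounds: "0 \<le> bump R x" "bump R x \<le> 1"
  by (auto simp: bump_def)

lemma cutoff_bounds: "0 \<le> cutoff R x" "cutoff R x \<le> 1"
  using bump_bounds[of R x] by (auto simp: cutoff_def power_le_one)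

lemma cutoff_eq_0: "R > 0 \<Longrightarrow> norm x \<ge> R \<Longrightarrow> cutoff R x = 0"
  using power_mono[of R "norm x" 2] by (simp add: cutoff_def bump_def power2_norm_eq_inner divide_simps)

lemma cutoff_ge_half:
  assumes "R > 0" "norm x \<le> R / 2"
  shows "cutoff R x \<ge> 1/2"
proof -
  have "(norm x)\<^sup>2 \<le> (R / 2)\<^sup>2" using assms by (intro power_mono) auto
  then have "(x \<bullet> x) / R\<^sup>2 \<le> 1/4" using assms by (simp add: power2_norm_eq_inner power_divide field_simps)
  moreover have "bump R x \<ge> 1 - (x \<bullet> x) / R\<^sup>2" by (simp add: bump_def)
  ultimately have "bump R x \<ge> 3/4" by linarith
  then have "(3/4)\<^sup>2 \<le> (bump R x)\<^sup>2" by (intro power_mono) auto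
  then show ?thesis by (simp add: cutoff_def power2_eq_square)
qed

lemma cutoff_grad_bound1: "cutoff_grad R x \<bullet> cutoff_grad R x \<le> 16 * (x \<bullet> x) / R ^ 4"
proof -
  have "cutoff_grad R x \<bullet> cutoff_grad R x = (bump R x)\<^sup>2 * (16 * (x \<bullet> x) / R ^ 4)"
    by (simp add: cutoff_grad_def power2_eq_square power4_eq_xxxx mult_ac)
  also have "\<dots> \<le> 1 * (16 * (x \<bullet> x) / R ^ 4)"
    using bump_bounds[of R x] by (intro mult_right_mono) (auto simp: power_le_one)
  finally show ?thesis by simp
qed

lemma cutoff_grad_bound2:
  assumes "R > 0"
  shows "cutoff_grad R x \<bullet> cutoff_grad R x \<le> 16 / R\<^sup>2"
proof (cases "bump R x = 0")
  case False
  then have "x \<bullet> x \<le> R\<^sup>2" using assms by (auto simp: bump_def max_def divide_simps split: if_splits)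
  then have "16 * (x \<bullet> x) / R ^ 4 \<le> 16 * R\<^sup>2 / R ^ 4"
    using assms by (intro divide_right_mono mult_left_mono) auto
  also have "\<dots> = 16 / R\<^sup>2" using assms by (simp add: power2_eq_square power4_eq_xxxx)
  finally show ?thesis using cutoff_grad_bound1[of R x] by linarith
qed (use assms in \<open>simp add: cutoff_grad_def\<close>)

lemma young_weighted:
  fixes T A B :: real
  assumes "T\<^sup>2 \<le> A * B" "A \<ge> 0" "B \<ge> 0"
  shows "\<bar>T\<bar> \<le> A / 2 + B / 2"
proof -
  have "T\<^sup>2 \<le> ((A + B) / 2)\<^sup>2"
    using assms(1) zero_le_power2[of "A - B"] by (simp add: power2_eq_square field_simps)
  then show ?thesis using assms abs_le_square_iff[of T "(A + B) / 2"] by (simp add: field_simps)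
qed

lemma has_grad_inverse_power:
  assumes w: "has_grad w p" and pos: "\<And>x. w x > 0"
  shows "has_grad (\<lambda>x. 1 / w x ^ m) (\<lambda>x. (- (real m / w x ^ Suc m)) *\<^sub>R p x)"
proof (rule has_grad_compose[OF w, of "\<lambda>t. 1 / t ^ m"])
  fix x
  have "w x \<noteq> 0" using pos[of x] by simp
  then have "((\<lambda>t. 1 / t ^ m) has_real_derivative
      (0 * w x ^ m - 1 * (real m * w x ^ (m - Suc 0))) / (w x ^ m * w x ^ m)) (at (w x))"
    by (intro DERIV_divide DERIV_const DERIV_pow) auto
  also have "(0 * w x ^ m - 1 * (real m * w x ^ (m - Suc 0))) / (w x ^ m * w x ^ m) = - (real m / w x ^ Suc m)"
    using \<open>w x \<noteq> 0\<close> by (cases m) (simp_all add: divide_simps)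
  finally show "((\<lambda>t. 1 / t ^ m) has_real_derivative - (real m / w x ^ Suc m)) (at (w x))" .
next
  have "t \<noteq> 0" if "t \<in> range w" for t using pos that by (metis less_irrefl imageE)
  then show "continuous_on (range w) (\<lambda>t. - (real m / t ^ Suc m))"
    by (intro continuous_intros) auto
qed

lemma bint_mono_radius:
  assumes "continuous_on UNIV f" "\<And>x. f x \<ge> 0" "r \<le> R"
  shows "bint r f \<le> bint R f"
  unfolding bint_def set_lebesgue_integral_def
  using bint_integrable[OF assms(1), of r] bint_integrable[OF assms(1), of R] assms(2,3)
  by (intro integral_mono) (auto simp: set_integrable_def indicator_def)

lemma bint_mono_annulus:
  assumes f: "continuous_on UNIV f" and g: "continuous_on UNIV g" and le: "\<And>x. r < norm x \<Longrightarrow> f x \<le> g x" and r: "r \<le> R"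
  shows "bint R f - bint r f \<le> bint R g - bint r g"
proof -
  have *: "bint R h - bint r h = (\<integral>x. indicator (cball 0 R) x * h x - indicator (cball 0 r) x * h x \<partial>lborel)"
    and "integrable lborel (\<lambda>x. indicator (cball 0 R) x * h x - indicator (cball 0 r) x * h x)"
    if "continuous_on UNIV h" for h :: "real^'n \<Rightarrow> real"
    unfolding bint_def set_lebesgue_integral_def
    using bint_integrable[OF that, of r] bint_integrable[OF that, of R] by (auto simp: set_integrable_def)
  note i = this
  show ?thesis unfolding i(1)[OF f] i(1)[OF g]
    by (rule integral_mono[OF i(2)[OF f] i(2)[OF g]]) (use le r in \<open>auto simp: indicator_def\<close>)
qed

lemma bint_eq_0_imp:
  fixes f :: "real^'n \<Rightarrow> real"
  assumes f: "continuous_on UNIV f" and nn: "\<And>x. f x \<ge> 0" and z: "\<And>R. R > 0 \<Longrightarrow> bint R f = 0"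
  shows "f x = 0"
proof (rule ccontr)
  assume "f x \<noteq> 0"
  then have p: "f x > 0" using nn[of x] by simp
  have "isCont f x" using f by (simp add: continuous_on_eq_continuous_at)
  then obtain d where d: "d > 0" "\<And>y. dist y x < d \<Longrightarrow> dist (f y) (f x) < f x / 2"
    using p unfolding continuous_at_eps_delta by (metis half_gt_zero)
  define R where "R = norm x + d"
  have sub: "ball x d \<subseteq> cball 0 R"
  proof
    fix y assume "y \<in> ball x d"
    then show "y \<in> cball 0 R" using norm_triangle_ineq[of x "y - x"] by (simp add: R_def dist_norm norm_minus_commute)
  qed
  have "f x / 2 * measure lborel (ball x d) = (\<integral>y. indicator (ball x d) y * (f x / 2) \<partial>lborel)"
    by simp
  also have "\<dots> \<le> (\<integral>y. indicator (cball 0 R) y * f y \<partial>lborel)"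
  proof (rule integral_mono)
    show "integrable lborel (\<lambda>y. indicator (cball 0 R) y * f y)"
      using bint_integrable[OF f, of R] by (simp add: set_integrable_def)
    show "integrable lborel (\<lambda>y. indicator (ball x d) y * (f x / 2))"
      using emeasure_bounded_finite[of "ball x d"]
      by (intro integrable_mult_left integrable_real_indicator) auto
    show "indicator (ball x d) y * (f x / 2) \<le> indicator (cball 0 R) y * f y" for y
    proof (cases "y \<in> ball x d")
      case True
      then have "dist (f y) (f x) < f x / 2" by (intro d) (simp add: dist_commute)
      then have "f x / 2 \<le> f y" unfolding dist_real_def by linarith
      then show ?thesis using True sub by auto
    qed (use nn in auto)
  qed
  also have "\<dots> = 0" using z[of R] d by (simp add: bint_def set_lebesgue_integral_def R_def add_nonneg_pos)
  finally have "f x / 2 * measure lborel (ball x d) \<le> 0" .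
  moreover have "measure lborel (ball x d) > 0" using d(1) content_ball_gt_0_iff[of x d] by blast
  ultimately show False using p by (simp add: mult_le_0_iff)
qed

section \<open>Integral estimates\<close>

text \<open>What the integral estimates use of a solution. \<open>T_le\<close> is the cone condition
  for \<open>- D^2 u\<close>: by \<open>csig_minus_rank_one\<close> it says that
  \<open>csig (Suc j)\<close> of \<open>w H - outer p p\<close> is nonnegative. \<open>eqn\<close>
  is the equation.\<close>

locale quadratic_growth_solution =
  fixes k :: nat and c :: real and w :: "real^'n \<Rightarrow> real" and p :: "real^'n \<Rightarrow> real^'n" and H :: "real^'n \<Rightarrow> real^'n^'n"
  assumes dim: "CARD('n) = 2 * k" and k2: "k \<ge> 2" and c_pos: "c > 0"
    and grad_w: "has_grad w p"
    and der_p: "\<And>x. (p has_derivative (\<lambda>h. H x *v h)) (at x)"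
    and cont_H: "continuous_on UNIV H"
    and sym: "\<And>x. transpose (H x) = H x"
    and w_pos: "\<And>x. w x > 0"
    and sig_pos: "\<And>j x. j \<le> k \<Longrightarrow> csig j (H x) > 0"
    and T_le: "\<And>j x. j < k \<Longrightarrow> Tn j (H x) (p x) (p x) \<le> w x * csig (Suc j) (H x)"
    and eqn: "\<And>x. w x * csig k (H x) - Tn (k - 1) (H x) (p x) (p x) = c"
begin

abbreviation "\<eta> \<equiv> cutoff :: real \<Rightarrow> real^'n \<Rightarrow> real"
abbreviation "\<xi> \<equiv> cutoff_grad :: real \<Rightarrow> real^'n \<Rightarrow> real^'n"
abbreviation "sg j x \<equiv> csig j (H x)"
abbreviation "b j x \<equiv> Tn j (H x) (p x) (p x)"

lemma w_nonzero [simp]: "w x \<noteq> 0"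
  using w_pos[of x] by simp

lemma conts: "continuous_on UNIV w" "continuous_on UNIV p" "continuous_on UNIV H"
    "continuous_on UNIV (\<eta> R)" "continuous_on UNIV (\<xi> R)"
  using has_gradD(2,3)[OF grad_w] has_gradD(2,3)[OF has_grad_cutoff] cont_H by auto

lemma b_nonneg: "m < k \<Longrightarrow> b m x \<ge> 0"
  by (rule Tn_nonneg[OF sym, where k = k]) (auto intro: sig_pos)

lemma div0:
  assumes "R > 0" "Suc m \<le> N" "has_grad f F"
  shows "bint R (\<lambda>x. (real m + 1) * sg (Suc m) x * f x * \<eta> R x ^ N + \<eta> R x ^ N * Tn m (H x) (p x) (F x)
     + real N * \<eta> R x ^ (N - 1) * f x * Tn m (H x) (p x) (\<xi> R x)) = 0"
  by (rule newton_tensor_divergence[OF der_p cont_H sym has_grad_cutoff _ assms(1,3,2)])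
     (use assms cutoff_eq_0 in auto)

text \<open>Cauchy-Schwarz for \<open>T_m\<close>, then Young's inequality with weight
  \<open>1/w\<close>. The first half can be absorbed by \<open>\<sigma>_(m+1)\<close> through
  \<open>T_le\<close>; the second has one order less, costs \<open>R^-2\<close> and gives up two
  powers of \<open>\<eta>\<close>.\<close>

lemma cutoff_term:
  assumes m: "m < k" and R: "R > 0"
  shows "\<bar>real (M + 2) * \<eta> R x ^ (M + 2 - 1) * Tn m (H x) (p x) (\<xi> R x)\<bar>
    \<le> \<eta> R x ^ (M + 2) * (b m x / w x) / 2
       + (16 * real CARD('n) * (real (M + 2))\<^sup>2 / R\<^sup>2) * (sg m x * w x * \<eta> R x ^ M) / 2"
proof (rule young_weighted)
  let ?T = "Tn m (H x) (p x) (\<xi> R x)" and ?e = "\<eta> R x"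
  have e: "?e \<ge> 0" by (rule cutoff_bounds)
  have "?T\<^sup>2 \<le> b m x * (real CARD('n) * sg m x * (\<xi> R x \<bullet> \<xi> R x))"
    by (rule Tn_Cauchy_Schwarz[OF sym, where k = k]) (use sig_pos m in auto)
  also have "\<dots> \<le> b m x * (real CARD('n) * sg m x * (16 / R\<^sup>2))"
    using b_nonneg[OF m] sig_pos[of m x] m cutoff_grad_bound2[OF R, of x] by (intro mult_left_mono) auto
  finally have T: "?T\<^sup>2 \<le> b m x * (real CARD('n) * sg m x * (16 / R\<^sup>2))" .
  have "(real (M + 2) * ?e ^ (M + 2 - 1) * ?T)\<^sup>2 = ((real (M + 2))\<^sup>2 * (?e ^ (M + 2) * ?e ^ M)) * ?T\<^sup>2"
    by (simp add: power_mult_distrib power_add power2_eq_square)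
  also have "\<dots> \<le> ((real (M + 2))\<^sup>2 * (?e ^ (M + 2) * ?e ^ M)) * (b m x * (real CARD('n) * sg m x * (16 / R\<^sup>2)))"
    using e by (intro mult_left_mono T) auto
  also have "\<dots> = ?e ^ (M + 2) * (b m x / w x) * ((16 * real CARD('n) * (real (M + 2))\<^sup>2 / R\<^sup>2) * (sg m x * w x * ?e ^ M))"
    by (simp add: field_simps)
  finally show "(real (M + 2) * ?e ^ (M + 2 - 1) * ?T)\<^sup>2 \<le>
    ?e ^ (M + 2) * (b m x / w x) * ((16 * real CARD('n) * (real (M + 2))\<^sup>2 / R\<^sup>2) * (sg m x * w x * ?e ^ M))" .
  show "0 \<le> ?e ^ (M + 2) * (b m x / w x)" using e b_nonneg[OF m] w_pos[of x] by simp
  show "0 \<le> (16 * real CARD('n) * (real (M + 2))\<^sup>2 / R\<^sup>2) * (sg m x * w x * ?e ^ M)"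
    using e sig_pos[of m x] m w_pos[of x] by simp
qed

text \<open>The factor \<open>w x / w x ^ m\<close> is \<open>w\<^sup>1\<^sup>-\<^sup>m\<close>, also for \<open>m = 0\<close>.\<close>

definition I :: "nat \<Rightarrow> nat \<Rightarrow> real \<Rightarrow> real" where
  "I m N R = bint R (\<lambda>x. sg m x * w x / w x ^ m * \<eta> R x ^ N)"

text \<open>Has the scaling of \<open>I (Suc m)\<close>: one order of the symmetric function and one
  factor \<open>w\<close> are traded for \<open>|p|^2\<close>.\<close>

definition L :: "nat \<Rightarrow> nat \<Rightarrow> real \<Rightarrow> real" where
  "L m N R = bint R (\<lambda>x. (p x \<bullet> p x) * sg m x / w x ^ Suc m * \<eta> R x ^ N)"

text \<open>The Caccioppoli step: the divergence identity for \<open>T_m\<close> is tested with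
  \<open>w^(-m) \<eta>^(M+2)\<close>. Differentiating \<open>w^(-m)\<close> has the bad sign, but
  \<open>T_le\<close> lets the leading term pay for it.\<close>

lemma I_step:
  assumes m: "m < k" and R: "R > 0" and M: "Suc m \<le> M + 2"
  shows "I (Suc m) (M + 2) R \<le> (16 * real CARD('n) * (real (M + 2))\<^sup>2 / R\<^sup>2) * I m M R"
proof -
  define K where "K = 16 * real CARD('n) * (real (M + 2))\<^sup>2 / R\<^sup>2"
  define f1 f2 where "f1 x = sg (Suc m) x * w x / w x ^ Suc m * \<eta> R x ^ (M + 2)"
    and "f2 x = sg m x * w x / w x ^ m * \<eta> R x ^ M" for x
  have cf: "continuous_on UNIV f1" "continuous_on UNIV f2"
    unfolding f1_def f2_def by (intro continuous_intros conts; simp)+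
  define J where "J x = (real m + 1) * sg (Suc m) x * (1 / w x ^ m) * \<eta> R x ^ (M + 2)
     + \<eta> R x ^ (M + 2) * Tn m (H x) (p x) ((- (real m / w x ^ Suc m)) *\<^sub>R p x)
     + real (M + 2) * \<eta> R x ^ (M + 2 - 1) * (1 / w x ^ m) * Tn m (H x) (p x) (\<xi> R x)" for x
  have J0: "bint R J = 0"
    unfolding J_def by (rule div0[OF R M has_grad_inverse_power[OF grad_w w_pos]])
  have "1/2 * f1 x - K / 2 * f2 x \<le> J x" for x
  proof -
    define W e a \<beta> Z ct where "W = 1 / w x ^ m" and "e = \<eta> R x ^ (M + 2)" and "a = sg (Suc m) x"
      and "\<beta> = b m x / w x" and "Z = K * (sg m x * w x * \<eta> R x ^ M)"
      and "ct = real (M + 2) * \<eta> R x ^ (M + 2 - 1) * Tn m (H x) (p x) (\<xi> R x)"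
    have W: "W > 0" and e: "e \<ge> 0" using w_pos[of x] cutoff_bounds[of R x] by (simp_all add: W_def e_def)
    have \<beta>: "\<beta> \<le> a" using T_le[OF m, of x] w_pos[of x] by (simp add: \<beta>_def a_def field_simps)
    have "\<bar>ct\<bar> \<le> e * \<beta> / 2 + Z / 2"
      using cutoff_term[OF m R, of M x] unfolding ct_def e_def \<beta>_def Z_def K_def .
    then have "- (e * \<beta> / 2 + Z / 2) \<le> ct" by linarith
    then have 1: "W * (- (e * \<beta> / 2 + Z / 2)) \<le> W * ct" using W by (intro mult_left_mono) auto
    \<comment> \<open>With \<open>\<beta> \<le> a\<close>, the leading part
      \<open>(m + 1) a - m \<beta>\<close> minus the loss \<open>\<beta> / 2\<close> to the cutoff
      term is still at least \<open>a / 2\<close>.\<close>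
    have 2: "0 \<le> W * e * ((real m + 1/2) * (a - \<beta>))" using W e \<beta> by (intro mult_nonneg_nonneg) auto
    have J: "J x = W * e * ((real m + 1) * a - real m * \<beta>) + W * ct"
      unfolding J_def Tn_scale[OF sym] by (simp add: W_def e_def a_def \<beta>_def ct_def field_simps)
    have 3: "1/2 * f1 x = 1/2 * (W * e * a)"
      "K / 2 * f2 x = W * Z / 2"
      by (simp_all add: f1_def f2_def W_def e_def a_def Z_def field_simps)
    have "W * e * ((real m + 1) * a - real m * \<beta>) + W * ct - (1/2 * (W * e * a) - W * Z / 2)
        = (W * ct - W * (- (e * \<beta> / 2 + Z / 2))) + W * e * ((real m + 1/2) * (a - \<beta>))"
      by (simp add: algebra_simps add_divide_distrib diff_divide_distrib)
    then show ?thesis unfolding J 3 using 1 2 by linarith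
  qed
  then have "bint R (\<lambda>x. 1/2 * f1 x - K / 2 * f2 x) \<le> bint R J"
    unfolding J_def by (intro bint_mono continuous_intros conts cf) auto
  also have "bint R (\<lambda>x. 1/2 * f1 x - K / 2 * f2 x)
     = bint R (\<lambda>x. 1/2 * f1 x) - bint R (\<lambda>x. K / 2 * f2 x)"
    by (intro bint_diff continuous_intros cf)
  also have "\<dots> = 1/2 * I (Suc m) (M + 2) R - K / 2 * I m M R"
    by (simp only: bint_cmult I_def f1_def f2_def)
  finally show ?thesis using J0 unfolding K_def[symmetric] by simp
qed

lemma has_grad_norm_grad: "has_grad (\<lambda>x. p x \<bullet> p x) (\<lambda>x. 2 *\<^sub>R (H x *v p x))"
  unfolding has_grad_def
proof (intro conjI allI)
  show "((\<lambda>x. p x \<bullet> p x) has_derivative (\<lambda>h. (2 *\<^sub>R (H x *v p x)) \<bullet> h)) (at x)" for x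
  proof (rule has_derivative_eq_rhs[OF has_derivative_inner[OF der_p der_p]], rule ext)
    fix h
    show "p x \<bullet> (H x *v h) + (H x *v h) \<bullet> p x = (2 *\<^sub>R (H x *v p x)) \<bullet> h"
      unfolding inner_commute[of "H x *v h" "p x"] dot_symmetric_matrix[OF sym] by simp
  qed
  have "continuous_on UNIV (\<lambda>x. H x *v p x)"
    unfolding matrix_vector_mult_def by (intro continuous_intros conts)
  then show "continuous_on UNIV (\<lambda>x. 2 *\<^sub>R (H x *v p x))" by (intro continuous_intros)
qed

lemma has_grad_norm_grad_div:
  "has_grad (\<lambda>x. (p x \<bullet> p x) * (1 / w x ^ m))
     (\<lambda>x. (p x \<bullet> p x) *\<^sub>R ((- (real m / w x ^ Suc m)) *\<^sub>R p x) + (1 / w x ^ m) *\<^sub>R (2 *\<^sub>R (H x *v p x)))"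
  by (rule has_grad_mult[OF has_grad_norm_grad has_grad_inverse_power[OF grad_w w_pos]])

lemma Tn_norm_grad_div:
  "Tn j (H x) (p x) ((p x \<bullet> p x) *\<^sub>R ((- (real m / w x ^ Suc m)) *\<^sub>R p x) + (1 / w x ^ m) *\<^sub>R (2 *\<^sub>R (H x *v p x)))
    = - (real m * (p x \<bullet> p x) / w x ^ Suc m) * b j x + 2 / w x ^ m * ((p x \<bullet> p x) * sg (Suc j) x - b (Suc j) x)"
  using Tn_linear[OF sym, of j x "p x" "(p x \<bullet> p x) * (- (real m / w x ^ Suc m))" "p x" "2 / w x ^ m" "H x *v p x"]
  by (simp add: Tn_Hessian_mult[OF sym])

text \<open>Now the test function is \<open>|p|^2 w^(-m-2) \<eta>^(M+2)\<close>. The gradient of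
  \<open>|p|^2\<close> is \<open>2 H p\<close>, and \<open>Tn_Hessian_mult\<close> converts
  \<open>T_m[p, H p]\<close> into \<open>|p|^2 \<sigma>_(m+1)\<close>, which helps, minus
  \<open>T_(m+1)[p,p]\<close>, which \<open>T_le\<close> at order \<open>m + 1\<close> bounds by the
  integrand of \<open>I (Suc (Suc m))\<close>.\<close>

lemma L_step:
  assumes m: "Suc m < k" and R: "R > 0" and M: "Suc m \<le> M + 2"
  shows "L (Suc m) (M + 2) R \<le> 4 * I (Suc (Suc m)) (M + 2) R + (16 * real CARD('n) * (real (M + 2))\<^sup>2 / R\<^sup>2) * L m M R"
proof -
  define K where "K = 16 * real CARD('n) * (real (M + 2))\<^sup>2 / R\<^sup>2"
  define F where "F = (\<lambda>x. (p x \<bullet> p x) *\<^sub>R ((- (real (m + 2) / w x ^ Suc (m + 2))) *\<^sub>R p x) + (1 / w x ^ (m + 2)) *\<^sub>R (2 *\<^sub>R (H x *v p x)))"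
  have gF: "has_grad (\<lambda>x. (p x \<bullet> p x) * (1 / w x ^ (m + 2))) F"
    unfolding F_def by (rule has_grad_norm_grad_div)
  define f1 f2 f3 where "f1 x = (p x \<bullet> p x) * sg (Suc m) x / w x ^ Suc (Suc m) * \<eta> R x ^ (M + 2)"
    and "f2 x = sg (Suc (Suc m)) x * w x / w x ^ Suc (Suc m) * \<eta> R x ^ (M + 2)"
    and "f3 x = (p x \<bullet> p x) * sg m x / w x ^ Suc m * \<eta> R x ^ M" for x
  have cf: "continuous_on UNIV f1" "continuous_on UNIV f2" "continuous_on UNIV f3"
    unfolding f1_def f2_def f3_def by (intro continuous_intros conts; simp)+
  define J where "J x = (real m + 1) * sg (Suc m) x * ((p x \<bullet> p x) * (1 / w x ^ (m + 2))) * \<eta> R x ^ (M + 2)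
     + \<eta> R x ^ (M + 2) * Tn m (H x) (p x) (F x)
     + real (M + 2) * \<eta> R x ^ (M + 2 - 1) * ((p x \<bullet> p x) * (1 / w x ^ (m + 2))) * Tn m (H x) (p x) (\<xi> R x)" for x
  have J0: "bint R J = 0"
    unfolding J_def by (rule div0[OF R M gF])
  note cF = has_gradD(2)[OF gF]
  have mk: "m < k" using m by simp
  have "1/2 * f1 x - (2 * f2 x + K / 2 * f3 x) \<le> J x" for x
  proof -
    define W e a a2 \<beta> Z ct s where "W = 1 / w x ^ (m + 2)" and "e = \<eta> R x ^ (M + 2)" and "a = sg (Suc m) x"
      and "a2 = sg (Suc (Suc m)) x" and "\<beta> = b m x / w x" and "Z = K * (sg m x * w x * \<eta> R x ^ M)"
      and "ct = real (M + 2) * \<eta> R x ^ (M + 2 - 1) * Tn m (H x) (p x) (\<xi> R x)" and "s = p x \<bullet> p x"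
    have W: "W > 0" and e: "e \<ge> 0" and s: "s \<ge> 0"
      using w_pos[of x] cutoff_bounds[of R x] by (simp_all add: W_def e_def s_def)
    have \<beta>: "\<beta> \<le> a" using T_le[OF mk, of x] w_pos[of x] by (simp add: \<beta>_def a_def field_simps)
    have b2: "b (Suc m) x \<le> w x * a2" using T_le[OF m, of x] by (simp add: a2_def)
    have "\<bar>ct\<bar> \<le> e * \<beta> / 2 + Z / 2"
      using cutoff_term[OF mk R, of M x] unfolding ct_def e_def \<beta>_def Z_def K_def .
    then have "- (e * \<beta> / 2 + Z / 2) \<le> ct" by linarith
    then have 1: "(s * W) * (- (e * \<beta> / 2 + Z / 2)) \<le> (s * W) * ct" using W s by (intro mult_left_mono) auto
    have 2: "0 \<le> W * e * s * ((real m + 5/2) * (a - \<beta>))" using W e \<beta> s by (intro mult_nonneg_nonneg) auto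
    have 4: "0 \<le> W * e * (w x * a2 - b (Suc m) x)" using W e b2 by (intro mult_nonneg_nonneg) auto
    have J: "J x = W * e * ((real m + 1) * a * s - (real m + 2) * s * \<beta> + 2 * (s * a - b (Suc m) x)) + (s * W) * ct"
      unfolding J_def F_def Tn_norm_grad_div by (simp add: W_def e_def a_def \<beta>_def ct_def s_def field_simps)
    have 3: "1/2 * f1 x = 1/2 * (W * e * a * s)"
      "2 * f2 x = 2 * (W * e * (w x * a2))"
      "K / 2 * f3 x = (s * W) * Z / 2"
      by (simp_all add: f1_def f2_def f3_def W_def e_def a_def a2_def s_def Z_def field_simps)
    have "W * e * ((real m + 1) * a * s - (real m + 2) * s * \<beta> + 2 * (s * a - b (Suc m) x)) + (s * W) * ct
        - (1/2 * (W * e * a * s) - (2 * (W * e * (w x * a2)) + (s * W) * Z / 2))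
       = ((s * W) * ct - (s * W) * (- (e * \<beta> / 2 + Z / 2))) + W * e * s * ((real m + 5/2) * (a - \<beta>))
        + 2 * (W * e * (w x * a2 - b (Suc m) x))"
      by (simp add: algebra_simps add_divide_distrib diff_divide_distrib)
    then show ?thesis unfolding J 3 using 1 2 4 by linarith
  qed
  then have "bint R (\<lambda>x. 1/2 * f1 x - (2 * f2 x + K / 2 * f3 x)) \<le> bint R J"
    unfolding J_def by (intro bint_mono continuous_intros conts cF cf) auto
  also have "bint R (\<lambda>x. 1/2 * f1 x - (2 * f2 x + K / 2 * f3 x))
     = bint R (\<lambda>x. 1/2 * f1 x)
      - (bint R (\<lambda>x. 2 * f2 x)
      + bint R (\<lambda>x. K / 2 * f3 x))"
  proof -
    have c: "continuous_on UNIV (\<lambda>x. r * f1 x)" "continuous_on UNIV (\<lambda>x. r * f2 x)" "continuous_on UNIV (\<lambda>x. r * f3 x)" for r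
      by (intro continuous_intros cf)+
    show ?thesis
      unfolding bint_diff[OF c(1) continuous_on_add[OF c(2,3)]] bint_add[OF c(2,3)] ..
  qed
  also have "\<dots> = 1/2 * L (Suc m) (M + 2) R - (2 * I (Suc (Suc m)) (M + 2) R + K / 2 * L m M R)"
    by (simp only: bint_cmult I_def L_def f1_def f2_def f3_def)
  finally show ?thesis using J0 unfolding K_def[symmetric] by simp
qed


text \<open>The function \<open>- div V\<close>.\<close>

definition G :: "real^'n \<Rightarrow> real" where
  "G x = defect k (w x) (H x) (p x) / w x ^ k"

text \<open>The density that \<open>flux_bound\<close> pairs with the defect; with the cutoff its
  integral is \<open>I k\<close> plus \<open>L (k - 1)\<close>.\<close>

definition Kf :: "real^'n \<Rightarrow> real" where
  "Kf x = (w x * sg k x + (p x \<bullet> p x) * sg (k - 1) x) / w x ^ k"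

lemma G_nonneg: "G x \<ge> 0"
  unfolding G_def using defect_nonneg[OF dim k2 sym sig_pos w_pos c_pos eqn, of x] w_pos[of x] by simp

lemma Kf_nonneg: "Kf x \<ge> 0"
  unfolding Kf_def using w_pos[of x] sig_pos[of k x] sig_pos[of "k - 1" x] by (simp add: less_imp_le)

lemma conts2: "continuous_on UNIV G" "continuous_on UNIV Kf"
  unfolding G_def Kf_def defect_def by (intro continuous_intros conts; simp)+

text \<open>The weak form of \<open>G = - div V\<close>. The three terms of \<open>V\<close> are
  scalar multiples of \<open>T_k p\<close>, \<open>T_(k-1) p\<close> and \<open>T_0 p = p\<close>,
  so each is covered by \<open>div0\<close>; the identity is
  \<open>2 J1 - J2 - c J3\<close>.\<close>

lemma flux_identity:
  assumes R: "R > 0" and N: "Suc k \<le> N"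
  shows "bint R (\<lambda>x. G x * \<eta> R x ^ N)
     = bint R (\<lambda>x. real N * \<eta> R x ^ (N - 1) * (flux k c (w x) (H x) (p x) (\<xi> R x) / w x ^ Suc k))"
proof -
  have k1: "Suc (k - 1) = k" "real (k - 1) + 1 = real k" using k2 by (simp_all add: of_nat_diff)
  define F where "F = (\<lambda>x. (p x \<bullet> p x) *\<^sub>R ((- (real (Suc k) / w x ^ Suc (Suc k))) *\<^sub>R p x) + (1 / w x ^ Suc k) *\<^sub>R (2 *\<^sub>R (H x *v p x)))"
  have gF: "has_grad (\<lambda>x. (p x \<bullet> p x) * (1 / w x ^ Suc k)) F"
    unfolding F_def by (rule has_grad_norm_grad_div)
  define J1 where "J1 x = (real k + 1) * sg (Suc k) x * (1 / w x ^ k) * \<eta> R x ^ N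
     + \<eta> R x ^ N * Tn k (H x) (p x) ((- (real k / w x ^ Suc k)) *\<^sub>R p x)
     + real N * \<eta> R x ^ (N - 1) * (1 / w x ^ k) * Tn k (H x) (p x) (\<xi> R x)" for x
  define J2 where "J2 x = (real (k - 1) + 1) * sg (Suc (k - 1)) x * ((p x \<bullet> p x) * (1 / w x ^ Suc k)) * \<eta> R x ^ N
     + \<eta> R x ^ N * Tn (k - 1) (H x) (p x) (F x)
     + real N * \<eta> R x ^ (N - 1) * ((p x \<bullet> p x) * (1 / w x ^ Suc k)) * Tn (k - 1) (H x) (p x) (\<xi> R x)" for x
  define J3 where "J3 x = (real 0 + 1) * sg (Suc 0) x * (1 / w x ^ Suc k) * \<eta> R x ^ N
     + \<eta> R x ^ N * Tn 0 (H x) (p x) ((- (real (Suc k) / w x ^ Suc (Suc k))) *\<^sub>R p x)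
     + real N * \<eta> R x ^ (N - 1) * (1 / w x ^ Suc k) * Tn 0 (H x) (p x) (\<xi> R x)" for x
  have z: "bint R J1 = 0" "bint R J2 = 0" "bint R J3 = 0"
    unfolding J1_def J2_def J3_def
    using N by (intro div0 R has_grad_inverse_power[OF grad_w w_pos] gF; simp)+
  have cJ: "continuous_on UNIV J1" "continuous_on UNIV J2" "continuous_on UNIV J3"
    unfolding J1_def J2_def J3_def by (intro continuous_intros conts has_gradD(2)[OF gF]; simp)+
  have pt: "2 * J1 x - J2 x - c * J3 x = real N * \<eta> R x ^ (N - 1) * (flux k c (w x) (H x) (p x) (\<xi> R x) / w x ^ Suc k)
      - G x * \<eta> R x ^ N" for x
  proof -
    define W e s y1 y2 y3 v t where "W = 1 / w x ^ Suc (Suc k)" and "e = \<eta> R x ^ N" and "s = p x \<bullet> p x"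
      and "y1 = Tn k (H x) (p x) (\<xi> R x)" and "y2 = Tn (k - 1) (H x) (p x) (\<xi> R x)" and "y3 = p x \<bullet> \<xi> R x"
      and "v = real N * \<eta> R x ^ (N - 1)" and "t = w x"
    define a0 a1 a2 b1 b2 where "a0 = sg 1 x" and "a1 = sg k x" and "a2 = sg (Suc k) x" and "b1 = b (k - 1) x" and "b2 = b k x"
    have w1: "r / w x ^ Suc k = r * (t * W)" and w0: "r / w x ^ k = r * (t * t * W)" and w2: "r / w x ^ Suc (Suc k) = r * W" for r
      by (simp_all add: W_def t_def field_simps)
    \<comment> \<open>The equation enters here: with \<open>c\<close> eliminated, the pointwise
      claim is a polynomial identity.\<close>
    have c': "c = t * a1 - b1" using eqn[of x] by (simp add: t_def a1_def b1_def)
    have J1': "J1 x = (real k + 1) * a2 * (t * t * W) * e - e * (k * (t * W) * b2) + v * (t * t * W) * y1"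
      unfolding J1_def Tn_scale[OF sym] w1 w0
      by (simp add: e_def a2_def b2_def v_def y1_def)
    have J2': "J2 x = real k * a1 * (s * (t * W)) * e + e * (- (real (Suc k) * s * W * b1) + 2 * (t * W) * (s * a1 - b2)) + v * (s * (t * W)) * y2"
      unfolding J2_def F_def Tn_norm_grad_div unfolding w1 w2 k1
      by (simp add: e_def a1_def b1_def b2_def v_def y2_def s_def)
    have J3': "J3 x = a0 * (t * W) * e - e * (real (Suc k) * W * s) + v * (t * W) * y3"
      unfolding J3_def Tn_0[OF sym] w1 w2
      by (simp add: e_def a0_def s_def v_def y3_def)
    have G': "G x = (a0 * a1 - 2 * (real k + 1) * a2) * (t * t * W) + (s * a1 - a0 * b1 + 2 * (real k - 1) * b2) * (t * W)"
      unfolding G_def defect_def w0 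
      by (simp add: a0_def a1_def a2_def b1_def b2_def s_def t_def[symmetric] distrib_right)
         (use w_pos[of x] in \<open>simp add: t_def field_simps\<close>)
    have fl: "flux k c (w x) (H x) (p x) (\<xi> R x) / w x ^ Suc k = (2 * t * y1 - s * y2 - c * y3) * (t * W)"
      unfolding flux_def w1 by (simp add: y1_def y2_def y3_def s_def t_def)
    show ?thesis
      unfolding J1' J2' J3' G' fl e_def[symmetric] v_def[symmetric] unfolding c'
      by (simp add: algebra_simps)
  qed
  have "0 = bint R (\<lambda>x. 2 * J1 x - J2 x - c * J3 x)"
  proof -
    have 1: "continuous_on UNIV (\<lambda>x. 2 * J1 x)" and 3: "continuous_on UNIV (\<lambda>x. c * J3 x)"
      by (intro continuous_intros cJ)+
    show ?thesis
      unfolding bint_diff[OF continuous_on_diff[OF 1 cJ(2)] 3] bint_diff[OF 1 cJ(2)] bint_cmult z by simp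
  qed
  also have "\<dots> = bint R (\<lambda>x. real N * \<eta> R x ^ (N - 1) * (flux k c (w x) (H x) (p x) (\<xi> R x) / w x ^ Suc k))
      - bint R (\<lambda>x. G x * \<eta> R x ^ N)"
    unfolding pt flux_def by (intro bint_diff continuous_intros conts conts2; simp)
  finally show ?thesis by simp
qed

text \<open>The weight \<open>A\<close> stays free: 1 where a part of the defect is to be absorbed,
  large where the defect has little mass and the density has to be suppressed.\<close>

lemma flux_young:
  assumes A: "A > 0"
  shows "\<bar>real (M + 2) * \<eta> R x ^ (M + 2 - 1) * (flux k c (w x) (H x) (p x) (\<xi> R x) / w x ^ Suc k)\<bar>
    \<le> A * (G x * \<eta> R x ^ (M + 2)) / 2
      + (16 * real CARD('n) ^ 5 * (real (M + 2))\<^sup>2 / A) * ((\<xi> R x \<bullet> \<xi> R x) * (Kf x * \<eta> R x ^ M)) / 2"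
proof (rule young_weighted)
  let ?f = "flux k c (w x) (H x) (p x) (\<xi> R x)" and ?e = "\<eta> R x" and ?X = "\<xi> R x \<bullet> \<xi> R x"
  let ?D = "16 * real CARD('n) ^ 5"
  have e: "?e \<ge> 0" by (rule cutoff_bounds)
  have "?f\<^sup>2 \<le> ?D * (w x)\<^sup>2 * defect k (w x) (H x) (p x) * (w x * sg k x + (p x \<bullet> p x) * sg (k - 1) x) * ?X"
    using flux_bound[OF dim k2 sym sig_pos w_pos c_pos eqn, of x "\<xi> R x"] by simp
  also have "\<dots> = ?D * (w x)\<^sup>2 * (G x * w x ^ k) * (Kf x * w x ^ k) * ?X"
    by (simp add: G_def Kf_def)
  also have "\<dots> = (?D * G x * Kf x * ?X) * (w x ^ Suc k)\<^sup>2"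
    by (simp add: power2_eq_square mult_ac)
  finally have "?f\<^sup>2 / (w x ^ Suc k)\<^sup>2 \<le> ?D * G x * Kf x * ?X"
    using w_pos[of x] by (simp add: pos_divide_le_eq)
  then have f: "(?f / w x ^ Suc k)\<^sup>2 \<le> ?D * G x * Kf x * ?X" by (simp only: power_divide)
  have "(real (M + 2) * ?e ^ (M + 2 - 1) * (?f / w x ^ Suc k))\<^sup>2
      = ((real (M + 2))\<^sup>2 * (?e ^ (M + 2) * ?e ^ M)) * (?f / w x ^ Suc k)\<^sup>2"
    unfolding power_mult_distrib by (simp add: power_add power2_eq_square)
  also have "\<dots> \<le> ((real (M + 2))\<^sup>2 * (?e ^ (M + 2) * ?e ^ M)) * (?D * G x * Kf x * ?X)"
    using e by (intro mult_left_mono f) auto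
  also have "\<dots> = (A * (G x * ?e ^ (M + 2))) * ((?D * (real (M + 2))\<^sup>2 / A) * (?X * (Kf x * ?e ^ M)))"
    using A by simp
  finally show "(real (M + 2) * ?e ^ (M + 2 - 1) * (?f / w x ^ Suc k))\<^sup>2
     \<le> (A * (G x * ?e ^ (M + 2))) * ((?D * (real (M + 2))\<^sup>2 / A) * (?X * (Kf x * ?e ^ M)))" .
  show "0 \<le> A * (G x * ?e ^ (M + 2))" using A G_nonneg e by simp
  show "0 \<le> (?D * (real (M + 2))\<^sup>2 / A) * (?X * (Kf x * ?e ^ M))" using A Kf_nonneg e by simp
qed

text \<open>Iterates \<open>I_step\<close> from \<open>I 0 0\<close>, the integral of
  \<open>w\<close>. Each step gives up two powers of the cutoff, hence the exponent
  \<open>2 m\<close>. The constant is chosen before \<open>R\<close>, and growth is asked only at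
  that \<open>R\<close>, because it is known only along a sequence.\<close>

lemma I_bound:
  assumes "C \<ge> 0"
  shows "m \<le> k \<Longrightarrow> \<exists>C'\<ge>0. \<forall>R>0. bint R w \<le> C * R ^ (2 * k + 2) \<longrightarrow> I m (2 * m) R \<le> C' * R ^ (2 * k + 2) / R ^ (2 * m)"
proof (induction m)
  case 0
  show ?case using assms by (intro exI[of _ C]) (simp add: I_def)
next
  case (Suc m)
  then obtain C' where C': "C' \<ge> 0" "\<And>R. R > 0 \<Longrightarrow> bint R w \<le> C * R ^ (2 * k + 2) \<Longrightarrow> I m (2 * m) R \<le> C' * R ^ (2 * k + 2) / R ^ (2 * m)"
    by auto
  define D where "D = 16 * real CARD('n) * (real (2 * m + 2))\<^sup>2"
  have D: "D \<ge> 0" by (simp add: D_def)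
  have "I (Suc m) (2 * Suc m) R \<le> D * C' * R ^ (2 * k + 2) / R ^ (2 * Suc m)"
    if R: "R > 0" "bint R w \<le> C * R ^ (2 * k + 2)" for R
  proof -
    have "I (Suc m) (2 * m + 2) R \<le> D / R\<^sup>2 * I m (2 * m) R"
      unfolding D_def using Suc.prems R by (intro I_step) auto
    also have "\<dots> \<le> D / R\<^sup>2 * (C' * R ^ (2 * k + 2) / R ^ (2 * m))"
      using C'(2)[OF R] D by (intro mult_left_mono) auto
    also have "\<dots> = D * C' * R ^ (2 * k + 2) / R ^ (2 * Suc m)"
      by (simp add: power_add power2_eq_square)
    finally show ?thesis by simp
  qed
  then show ?case using D C' by (intro exI[of _ "D * C'"]) auto
qed

text \<open>Starts from \<open>L 0 2 R \<le> I 1 2 R\<close>, which is \<open>T_le\<close> at order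
  0, that is \<open>|p|^2 \<le> w \<sigma>_1\<close>.\<close>

lemma L_bound:
  assumes C: "C \<ge> 0"
  shows "m < k \<Longrightarrow> \<exists>C'\<ge>0. \<forall>R>0. bint R w \<le> C * R ^ (2 * k + 2) \<longrightarrow> L m (2 * m + 2) R \<le> C' * R ^ (2 * k) / R ^ (2 * m)"
proof (induction m)
  case 0
  obtain C' where C': "C' \<ge> 0" "\<And>R. R > 0 \<Longrightarrow> bint R w \<le> C * R ^ (2 * k + 2) \<Longrightarrow> I 1 2 R \<le> C' * R ^ (2 * k + 2) / R ^ 2"
    using I_bound[OF C, of 1] k2 by auto
  have "L 0 2 R \<le> I 1 2 R" for R
    unfolding L_def I_def
  proof (rule bint_mono)
    fix x
    have "p x \<bullet> p x \<le> w x * sg 1 x"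
      using T_le[of 0 x] k2 by (simp add: Tn_0[OF sym])
    then have "(p x \<bullet> p x) / w x \<le> sg 1 x" using w_pos[of x] by (simp add: pos_divide_le_eq mult.commute)
    then show "p x \<bullet> p x * sg 0 x / w x ^ Suc 0 * \<eta> R x ^ 2 \<le> sg 1 x * w x / w x ^ 1 * \<eta> R x ^ 2"
      using mult_right_mono[of "(p x \<bullet> p x) / w x" "sg 1 x" "\<eta> R x ^ 2"] by simp
  qed (intro continuous_intros conts; simp)+
  then have "L 0 2 R \<le> C' * R ^ (2 * k)" if "R > 0" "bint R w \<le> C * R ^ (2 * k + 2)" for R
    using C'(2)[OF that] that(1) by (simp add: power_add power2_eq_square) (metis order_trans)
  then show ?case using C' by (intro exI[of _ C']) (auto simp flip: numeral_2_eq_2)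
next
  case (Suc m)
  then obtain C1 where C1: "C1 \<ge> 0" "\<And>R. R > 0 \<Longrightarrow> bint R w \<le> C * R ^ (2 * k + 2) \<Longrightarrow> L m (2 * m + 2) R \<le> C1 * R ^ (2 * k) / R ^ (2 * m)"
    by auto
  obtain C2 where C2: "C2 \<ge> 0" "\<And>R. R > 0 \<Longrightarrow> bint R w \<le> C * R ^ (2 * k + 2) \<Longrightarrow>
      I (Suc (Suc m)) (2 * Suc (Suc m)) R \<le> C2 * R ^ (2 * k + 2) / R ^ (2 * Suc (Suc m))"
    using I_bound[OF C, of "Suc (Suc m)"] Suc.prems by auto
  define D where "D = 16 * real CARD('n) * (real (2 * m + 2 + 2))\<^sup>2"
  have D: "D \<ge> 0" by (simp add: D_def)
  have "L (Suc m) (2 * Suc m + 2) R \<le> (4 * C2 + D * C1) * R ^ (2 * k) / R ^ (2 * Suc m)"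
    if R: "R > 0" "bint R w \<le> C * R ^ (2 * k + 2)" for R
  proof -
    have "L (Suc m) (2 * m + 2 + 2) R \<le> 4 * I (Suc (Suc m)) (2 * m + 2 + 2) R + D / R\<^sup>2 * L m (2 * m + 2) R"
      unfolding D_def using Suc.prems R by (intro L_step) auto
    also have "\<dots> \<le> 4 * (C2 * R ^ (2 * k + 2) / R ^ (2 * Suc (Suc m))) + D / R\<^sup>2 * (C1 * R ^ (2 * k) / R ^ (2 * m))"
      using C1(2)[OF R] C2(2)[OF R] D by (intro add_mono mult_left_mono) (auto simp: add_ac)
    also have "\<dots> = (4 * C2 + D * C1) * R ^ (2 * k) / R ^ (2 * Suc m)"
      using R by (simp add: power_add power2_eq_square field_simps)
    finally show ?thesis by (simp add: add_ac)
  qed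
  then show ?case using D C1 C2 by (intro exI[of _ "4 * C2 + D * C1"]) auto
qed

lemma Kf_bound:
  assumes C: "C \<ge> 0"
  shows "\<exists>C'\<ge>0. \<forall>R>0. bint R w \<le> C * R ^ (2 * k + 2) \<longrightarrow> bint R (\<lambda>x. Kf x * \<eta> R x ^ (2 * k)) \<le> C' * R\<^sup>2"
proof -
  have k1: "Suc (k - 1) = k" "2 * (k - 1) + 2 = 2 * k" using k2 by auto
  obtain C1 where C1: "C1 \<ge> 0" "\<And>R. R > 0 \<Longrightarrow> bint R w \<le> C * R ^ (2 * k + 2) \<Longrightarrow> L (k - 1) (2 * k) R \<le> C1 * R ^ (2 * k) / R ^ (2 * (k - 1))"
    using L_bound[OF C, of "k - 1"] k2 unfolding k1 by auto
  obtain C2 where C2: "C2 \<ge> 0" "\<And>R. R > 0 \<Longrightarrow> bint R w \<le> C * R ^ (2 * k + 2) \<Longrightarrow> I k (2 * k) R \<le> C2 * R ^ (2 * k + 2) / R ^ (2 * k)"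
    using I_bound[OF C, of k] by auto
  have "bint R (\<lambda>x. Kf x * \<eta> R x ^ (2 * k)) \<le> (C1 + C2) * R\<^sup>2"
    if R: "R > 0" "bint R w \<le> C * R ^ (2 * k + 2)" for R
  proof -
    have "bint R (\<lambda>x. Kf x * \<eta> R x ^ (2 * k)) = bint R (\<lambda>x. sg k x * w x / w x ^ k * \<eta> R x ^ (2 * k)
       + (p x \<bullet> p x) * sg (k - 1) x / w x ^ Suc (k - 1) * \<eta> R x ^ (2 * k))"
      unfolding Kf_def k1 by (intro bint_cong) (simp add: field_simps)
    also have "\<dots> = I k (2 * k) R + L (k - 1) (2 * k) R"
      unfolding I_def L_def by (intro bint_add continuous_intros conts; simp)
    also have "\<dots> \<le> C2 * R ^ (2 * k + 2) / R ^ (2 * k) + C1 * R ^ (2 * k) / R ^ (2 * (k - 1))"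
      using C1(2)[OF R] C2(2)[OF R] by simp
    also have "\<dots> = (C1 + C2) * R\<^sup>2"
    proof -
      have e: "R ^ (2 * k) = R ^ (2 * (k - 1)) * R\<^sup>2" "R ^ (2 * k + 2) = R ^ (2 * k) * R\<^sup>2"
        using k1 by (metis power_add)+
      have "C2 * R ^ (2 * k + 2) / R ^ (2 * k) = C2 * R\<^sup>2" unfolding e(2) using R by simp
      moreover have "C1 * R ^ (2 * k) / R ^ (2 * (k - 1)) = C1 * R\<^sup>2" unfolding e(1) using R by simp
      ultimately show ?thesis by (simp add: distrib_right)
    qed
    finally show ?thesis .
  qed
  then show ?thesis using C1 C2 by (intro exI[of _ "C1 + C2"]) auto
qed


text \<open>Serves twice: as growth exponent \<open>n + 2\<close>, and as cutoff exponent, two above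
  the \<open>2 k\<close> that remains on \<open>Kf\<close> after Young's inequality.\<close>

abbreviation "NN \<equiv> 2 * k + 2"

definition "DD = 16 * real (2 * k) ^ 5 * (real (2 * k + 2))\<^sup>2"

lemma DD_nonneg: "DD \<ge> 0"
  by (simp add: DD_def)

section \<open>From a bounded to a vanishing defect integral\<close>

definition "Fl R x = real NN * \<eta> R x ^ (NN - 1) * (flux k c (w x) (H x) (p x) (\<xi> R x) / w x ^ Suc k)"

lemma cont_pieces: "continuous_on UNIV (\<lambda>x. G x * \<eta> R x ^ NN)" "continuous_on UNIV (\<lambda>x. Kf x * \<eta> R x ^ (2 * k))"
    "continuous_on UNIV (Fl R)"
  unfolding Fl_def[abs_def] flux_def by (intro continuous_intros conts conts2; simp)+

lemma cont_rhs: "continuous_on UNIV (\<lambda>x. a * (G x * \<eta> R x ^ NN) + a' * (Kf x * \<eta> R x ^ (2 * k)))"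
    "continuous_on UNIV (\<lambda>x. a * G x + a' * (Kf x * \<eta> R x ^ (2 * k)))"
  by (intro continuous_on_add continuous_on_mult_left cont_pieces conts2)+

lemma pieces_nonneg: "G x * \<eta> R x ^ NN \<ge> 0" "Kf x * \<eta> R x ^ (2 * k) \<ge> 0"
  using G_nonneg[of x] Kf_nonneg[of x] cutoff_bounds[of R x] by simp_all

lemma bint_lincomb:
  assumes "continuous_on UNIV f" "continuous_on UNIV g"
  shows "bint R (\<lambda>x. a * f x + a' * g x) = a * bint R f + a' * bint R g"
proof -
  have "continuous_on UNIV (\<lambda>x. a * f x)" "continuous_on UNIV (\<lambda>x. a' * g x)"
    using assms by (intro continuous_intros; simp)+
  then show ?thesis by (simp add: bint_add bint_cmult)
qed

lemma flux_le:
  assumes A: "A > 0" and X: "\<xi> R x \<bullet> \<xi> R x \<le> X"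
  shows "Fl R x
     \<le> A / 2 * (G x * \<eta> R x ^ NN) + DD * X / (2 * A) * (Kf x * \<eta> R x ^ (2 * k))"
proof -
  have "DD / A * ((\<xi> R x \<bullet> \<xi> R x) * (Kf x * \<eta> R x ^ (2 * k))) / 2 \<le> DD / A * (X * (Kf x * \<eta> R x ^ (2 * k))) / 2"
    using A X pieces_nonneg DD_nonneg by (intro divide_right_mono mult_left_mono mult_right_mono) auto
  also have "\<dots> = DD * X / (2 * A) * (Kf x * \<eta> R x ^ (2 * k))" by simp
  finally have "DD / A * ((\<xi> R x \<bullet> \<xi> R x) * (Kf x * \<eta> R x ^ (2 * k))) / 2 \<le> DD * X / (2 * A) * (Kf x * \<eta> R x ^ (2 * k))" .
  moreover have "A * (G x * \<eta> R x ^ NN) / 2 = A / 2 * (G x * \<eta> R x ^ NN)" by simp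
  ultimately show ?thesis using flux_young[OF A, of "2 * k" R x, unfolded dim, folded DD_def Fl_def] by linarith
qed

text \<open>With \<open>A = 1\<close> half of the defect integral returns on the right and is
  absorbed; what remains is \<open>O(R^-2)\<close> times the \<open>O(R^2)\<close> of
  \<open>Kf_bound\<close>.\<close>

lemma defect_integral_bound:
  assumes C: "C \<ge> 0"
  shows "\<exists>C'. \<forall>R>0. bint R w \<le> C * R ^ NN \<longrightarrow> bint R (\<lambda>x. G x * \<eta> R x ^ NN) \<le> C'"
proof -
  obtain CK where CK: "CK \<ge> 0" "\<And>R. R > 0 \<Longrightarrow> bint R w \<le> C * R ^ NN \<Longrightarrow> bint R (\<lambda>x. Kf x * \<eta> R x ^ (2 * k)) \<le> CK * R\<^sup>2"
    using Kf_bound[OF C] by auto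
  have "bint R (\<lambda>x. G x * \<eta> R x ^ NN) \<le> 16 * DD * CK" if R: "R > 0" "bint R w \<le> C * R ^ NN" for R
  proof -
    let ?X = "16 / R\<^sup>2"
    have "bint R (\<lambda>x. G x * \<eta> R x ^ NN) = bint R (Fl R)"
      unfolding Fl_def[abs_def] using R by (intro flux_identity) auto
    also have "\<dots> \<le> bint R (\<lambda>x. 1 / 2 * (G x * \<eta> R x ^ NN) + DD * ?X / (2 * 1) * (Kf x * \<eta> R x ^ (2 * k)))"
      by (rule bint_mono[OF cont_pieces(3) cont_rhs(1) flux_le[OF _ cutoff_grad_bound2[OF R(1)]]]) simp
    also have "\<dots> = 1 / 2 * bint R (\<lambda>x. G x * \<eta> R x ^ NN) + DD * ?X / (2 * 1) * bint R (\<lambda>x. Kf x * \<eta> R x ^ (2 * k))"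
      by (rule bint_lincomb[OF cont_pieces(1,2)])
    also have "DD * ?X / (2 * 1) * bint R (\<lambda>x. Kf x * \<eta> R x ^ (2 * k)) \<le> DD * ?X / (2 * 1) * (CK * R\<^sup>2)"
      using DD_nonneg by (intro mult_left_mono CK(2) R) auto
    also have "\<dots> = 8 * DD * CK" using R by simp
    finally show ?thesis by linarith
  qed
  then show ?thesis by blast
qed

text \<open>The gradient of the cutoff is only \<open>O(1/R)\<close>, which gives boundedness of the integral. To see that it
  vanishes, split at a fixed radius \<open>\<rho>\<close>: inside the gradient is \<open>O(1/R\<^sup>2)\<close>, outside the integral of \<open>G\<close> is small.\<close>

lemma G_eq_0:
  assumes R: "filterlim R at_top sequentially" and C: "C > 0"
    and growth: "\<And>j. bint (R j) w \<le> C * R j ^ NN"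
  shows "G x = 0"
proof (rule bint_eq_0_imp[OF conts2(1) G_nonneg])
  fix r :: real assume r: "r > 0"
  have C0: "C \<ge> 0" using C by simp
  obtain CK where CK: "CK \<ge> 0" "\<And>R. R > 0 \<Longrightarrow> bint R w \<le> C * R ^ NN \<Longrightarrow> bint R (\<lambda>x. Kf x * \<eta> R x ^ (2 * k)) \<le> CK * R\<^sup>2"
    using Kf_bound[OF C0] by auto
  obtain CG where CG: "\<And>R. R > 0 \<Longrightarrow> bint R w \<le> C * R ^ NN \<Longrightarrow> bint R (\<lambda>x. G x * \<eta> R x ^ NN) \<le> CG"
    using defect_integral_bound[OF C0] by auto
  have big: "\<exists>j. R j \<ge> B" for B
    using R unfolding filterlim_at_top eventually_sequentially by blast
  \<comment> \<open>On the ball of radius \<open>s \<le> S / 2\<close> the cutoff at scale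
    \<open>S\<close> is at least 1/2, which costs the factor \<open>2 ^ NN\<close>.\<close>
  have core: "bint s G \<le> 2 ^ NN * bint S (\<lambda>x. G x * \<eta> S x ^ NN)" if s: "s > 0" "S \<ge> 2 * s" for s S
  proof -
    have "bint s G \<le> bint s (\<lambda>x. 2 ^ NN * (G x * \<eta> S x ^ NN))"
    proof (rule bint_mono[OF conts2(1) continuous_on_mult_left[OF cont_pieces(1)]])
      fix x :: "real^'n" assume "norm x \<le> s"
      then have "\<eta> S x \<ge> 1/2" using s by (intro cutoff_ge_half) auto
      then have "(2 * (1/2)) ^ NN \<le> (2 * \<eta> S x) ^ NN" by (intro power_mono) auto
      then have "G x * 1 \<le> G x * (2 * \<eta> S x) ^ NN" by (intro mult_left_mono G_nonneg) simp
      then show "G x \<le> 2 ^ NN * (G x * \<eta> S x ^ NN)" unfolding power_mult_distrib by (simp add: mult_ac)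
    qed
    also have "\<dots> = 2 ^ NN * bint s (\<lambda>x. G x * \<eta> S x ^ NN)" by (rule bint_cmult)
    also have "\<dots> \<le> 2 ^ NN * bint S (\<lambda>x. G x * \<eta> S x ^ NN)"
      using s by (intro mult_left_mono bint_mono_radius cont_pieces pieces_nonneg) auto
    finally show ?thesis .
  qed
  define g where "g s = bint s G" for s
  have bdd: "g s \<le> 2 ^ NN * CG" if s: "s > 0" for s
  proof -
    obtain j where j: "R j \<ge> 2 * s" using big by blast
    have "g s \<le> 2 ^ NN * bint (R j) (\<lambda>x. G x * \<eta> (R j) x ^ NN)" unfolding g_def by (rule core[OF s j])
    also have "\<dots> \<le> 2 ^ NN * CG" using j s by (intro mult_left_mono CG growth) auto
    finally show ?thesis .
  qed
  define S where "S = (SUP s\<in>{0<..}. g s)"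
  have bdd': "bdd_above (g ` {0<..})" using bdd by (auto intro!: bdd_aboveI)
  have gS: "g s \<le> S" if "s > 0" for s unfolding S_def using that by (intro cSUP_upper bdd') auto
  have small: "g r \<le> 2 ^ NN * (6 * d)" if d: "d > 0" for d
  proof -
    \<comment> \<open>Order of choices: \<open>A\<close> makes the density term outside
      \<open>\<rho>\<close> at most \<open>d\<close>; then \<open>\<rho>\<close> leaves at most
      \<open>2 d / A\<close> of the integral of \<open>G\<close> outside, so that term is at most
      \<open>d\<close> too; then \<open>T\<close> is so large that the density term inside is at
      most \<open>d\<close>. Absorbing one half turns \<open>3 d\<close> into
      \<open>6 d\<close>.\<close>
    define A where "A = 8 * DD * CK / d + 1"
    have A: "A > 0" using CK d DD_nonneg by (simp add: A_def add_nonneg_pos)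
    have Ad: "8 * DD * CK / A \<le> d"
    proof -
      have "8 * DD * CK \<le> d * A" using d by (simp add: A_def distrib_left)
      then show ?thesis using A by (simp add: pos_divide_le_eq)
    qed
    have "S - 2 * d / A < S" using d A by simp
    then obtain \<rho> where \<rho>: "\<rho> > 0" "S - 2 * d / A < g \<rho>"
      unfolding S_def using less_cSUP_iff[OF _ bdd', of "S - 2 * d / A"] by (auto simp: S_def)
    define B where "B = 2 * r + 2 * \<rho> + 1 + 8 * DD * \<rho>\<^sup>2 * CK / d"
    obtain j where j: "R j \<ge> B" using big by blast
    have B0: "8 * DD * \<rho>\<^sup>2 * CK / d \<ge> 0" using d CK DD_nonneg by simp
    define T where "T = R j"
    have T: "T \<ge> 2 * r" "T \<ge> \<rho>" "T \<ge> 1" "T \<ge> 8 * DD * \<rho>\<^sup>2 * CK / d"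
      using j r \<rho>(1) B0 unfolding B_def T_def by linarith+
    have T0: "T > 0" using T by simp
    have gr: "bint T w \<le> C * T ^ NN" using growth[of j] by (simp add: T_def)
    let ?Gn = "\<lambda>x. G x * \<eta> T x ^ NN" and ?Kn = "\<lambda>x. Kf x * \<eta> T x ^ (2 * k)"
    have KT: "bint T ?Kn \<le> CK * T\<^sup>2" by (rule CK(2)[OF T0 gr])
    have K\<rho>: "bint \<rho> ?Kn \<le> bint T ?Kn" by (intro bint_mono_radius cont_pieces pieces_nonneg T)
    have K0: "bint \<rho> ?Kn \<ge> 0"
      unfolding bint_def set_lebesgue_integral_def using pieces_nonneg by (intro integral_nonneg_AE) auto
    have "bint \<rho> (Fl T) \<le> bint \<rho> (\<lambda>x. 1 / 2 * ?Gn x + DD * (16 * \<rho>\<^sup>2 / T ^ 4) / (2 * 1) * ?Kn x)"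
    proof (rule bint_mono[OF cont_pieces(3) cont_rhs(1) flux_le])
      fix x :: "real^'n" assume "norm x \<le> \<rho>"
      then have "x \<bullet> x \<le> \<rho>\<^sup>2" using power_mono[of "norm x" \<rho> 2] by (simp add: power2_norm_eq_inner)
      then have "16 * (x \<bullet> x) / T ^ 4 \<le> 16 * \<rho>\<^sup>2 / T ^ 4" by (intro divide_right_mono mult_left_mono) auto
      then show "\<xi> T x \<bullet> \<xi> T x \<le> 16 * \<rho>\<^sup>2 / T ^ 4" using cutoff_grad_bound1[of T x] by linarith
    qed auto
    also have "\<dots> = 1 / 2 * bint \<rho> ?Gn + DD * (16 * \<rho>\<^sup>2 / T ^ 4) / (2 * 1) * bint \<rho> ?Kn"
      by (rule bint_lincomb[OF cont_pieces(1,2)])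
    also have "\<dots> \<le> 1 / 2 * bint T ?Gn + DD * (16 * \<rho>\<^sup>2 / T ^ 4) / (2 * 1) * (CK * T\<^sup>2)"
      using K\<rho> KT T DD_nonneg by (intro add_mono mult_left_mono bint_mono_radius cont_pieces pieces_nonneg) auto
    also have "DD * (16 * \<rho>\<^sup>2 / T ^ 4) / (2 * 1) * (CK * T\<^sup>2) = 8 * DD * \<rho>\<^sup>2 * CK / T\<^sup>2"
      using T0 by (simp add: power2_eq_square power4_eq_xxxx)
    also have "\<dots> \<le> d"
    proof -
      have "8 * DD * \<rho>\<^sup>2 * CK \<le> d * T" using T(4) d by (simp add: pos_divide_le_eq mult.commute)
      also have "\<dots> \<le> d * T\<^sup>2" using T d by (simp add: power2_eq_square)
      finally show ?thesis using T0 by (simp add: pos_divide_le_eq)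
    qed
    finally have in\<rho>: "bint \<rho> (Fl T) \<le> 1 / 2 * bint T ?Gn + d" by simp
    have "bint T (Fl T) - bint \<rho> (Fl T) \<le> bint T (\<lambda>x. A / 2 * G x + DD * (16 / T\<^sup>2) / (2 * A) * ?Kn x)
        - bint \<rho> (\<lambda>x. A / 2 * G x + DD * (16 / T\<^sup>2) / (2 * A) * ?Kn x)"
    proof (rule bint_mono_annulus[OF cont_pieces(3) cont_rhs(2) _ T(2)])
      fix x :: "real^'n"
      have "\<eta> T x ^ NN \<le> 1" using cutoff_bounds[of T x] by (intro power_le_one)
      then have "?Gn x \<le> G x" using G_nonneg[of x] by (intro mult_left_le)
      then have "A / 2 * ?Gn x \<le> A / 2 * G x" using A by simp
      then show "Fl T x \<le> A / 2 * G x + DD * (16 / T\<^sup>2) / (2 * A) * ?Kn x"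
        using flux_le[OF A cutoff_grad_bound2[OF T0], of x] by linarith
    qed
    also have "\<dots> = A / 2 * (g T - g \<rho>) + DD * (16 / T\<^sup>2) / (2 * A) * (bint T ?Kn - bint \<rho> ?Kn)"
      unfolding bint_lincomb[OF conts2(1) cont_pieces(2)] g_def by (simp add: algebra_simps)
    also have "\<dots> \<le> A / 2 * (2 * d / A) + DD * (16 / T\<^sup>2) / (2 * A) * (CK * T\<^sup>2)"
      using gS[OF T0] \<rho> KT K0 A DD_nonneg by (intro add_mono mult_left_mono) auto
    also have "\<dots> = d + 8 * DD * CK / A" using A T0 by simp
    also have "\<dots> \<le> 2 * d" using Ad by simp
    finally have out\<rho>: "bint T (Fl T) - bint \<rho> (Fl T) \<le> 2 * d" .
    have "bint T ?Gn = bint T (Fl T)" unfolding Fl_def[abs_def] using T0 by (intro flux_identity) auto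
    then have "bint T ?Gn \<le> 6 * d" using in\<rho> out\<rho> by linarith
    then have "2 ^ NN * bint T ?Gn \<le> 2 ^ NN * (6 * d)" by simp
    then show ?thesis using core[OF r T(1)] unfolding g_def by linarith
  qed
  have "g r \<le> 0"
  proof (rule ccontr)
    assume "\<not> ?thesis"
    then have p: "g r > 0" by simp
    define d where "d = g r / (2 ^ NN * 12)"
    have "d > 0" using p by (simp add: d_def)
    then have "g r \<le> 2 ^ NN * (6 * d)" by (rule small)
    also have "\<dots> = g r / 2" by (simp add: d_def)
    finally show False using p by simp
  qed
  moreover have "g r \<ge> 0"
    unfolding g_def bint_def set_lebesgue_integral_def using G_nonneg by (intro integral_nonneg_AE) auto
  ultimately show "bint r G = 0" by (simp add: g_def)
qed

lemma Hessian_scalar: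
  assumes "filterlim R at_top sequentially" "C > 0" "\<And>j. bint (R j) w \<le> C * R j ^ NN"
  shows "H x = (sg 1 x / CARD('n)) *\<^sub>R mat 1"
proof -
  have "defect k (w x) (H x) (p x) = 0"
    using G_eq_0[OF assms, of x] by (simp add: G_def)
  then show ?thesis using defect_eq_0_imp[OF dim k2 sym sig_pos w_pos c_pos eqn, of x] by simp
qed

end

section \<open>From solutions of the equation to the quadratic variable\<close>

lemma has_derivative_imp_grad:
  assumes "(f has_derivative (\<lambda>h. F \<bullet> h)) (at x)"
  shows "grad f x = F"
proof -
  have "frechet_derivative f (at x) = (\<lambda>h. F \<bullet> h)"
    using frechet_derivative_at[OF assms] by simp
  then show ?thesis by (simp add: grad_def vec_eq_iff inner_axis)
qed

lemma has_derivative_imp_hessian: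
  assumes f: "has_grad f F" and F: "(F has_derivative (\<lambda>h. M *v h)) (at x)"
  shows "hessian f x = M"
proof -
  have "grad f = F" using has_derivative_imp_grad[OF has_gradD(1)[OF f]] by auto
  moreover have "frechet_derivative F (at x) = (\<lambda>h. M *v h)"
    using frechet_derivative_at[OF F] by simp
  ultimately show ?thesis by (simp add: hessian_def)
qed

lemma C2_imp_derivatives:
  assumes "C2 u"
  shows "has_grad u (grad u)" "(grad u has_derivative (\<lambda>h. hessian u x *v h)) (at x)" "continuous_on UNIV (hessian u)"
proof -
  have d: "u differentiable (at x)" "grad u differentiable (at x)" for x
    using assms by (auto simp: C2_def differentiable_on_def)
  show H: "(grad u has_derivative (\<lambda>h. hessian u x *v h)) (at x)" for x
  proof -
    have D: "(grad u has_derivative frechet_derivative (grad u) (at x)) (at x)"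
      using d(2) by (simp add: frechet_derivative_works)
    then show ?thesis
      using has_derivative_linear[OF D] by (simp add: hessian_def)
  qed
  have "(u has_derivative (\<lambda>h. grad u x \<bullet> h)) (at x)" for x
  proof -
    have D: "(u has_derivative frechet_derivative u (at x)) (at x)"
      using d(1) by (simp add: frechet_derivative_works)
    have lin: "linear (frechet_derivative u (at x))" by (rule has_derivative_linear[OF D])
    have "frechet_derivative u (at x) h = grad u x \<bullet> h" for h
    proof -
      have "frechet_derivative u (at x) h = frechet_derivative u (at x) (\<Sum>i\<in>UNIV. h $ i *\<^sub>R axis i 1)"
        by (simp add: basis_expansion[of h, unfolded scalar_mult_eq_scaleR])
      also have "\<dots> = grad u x \<bullet> h"
        by (simp add: linear_sum[OF lin] linear_cmul[OF lin] grad_def inner_vec_def mult.commute)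
      finally show ?thesis .
    qed
    then have "frechet_derivative u (at x) = (\<lambda>h. grad u x \<bullet> h)" by (rule ext)
    then show ?thesis using D by simp
  qed
  moreover have "continuous_on UNIV (grad u)"
    using d(2) by (simp add: differentiable_imp_continuous_on differentiable_on_def)
  ultimately show "has_grad u (grad u)" by (simp add: has_grad_def)
  show "continuous_on UNIV (hessian u)" using assms by (simp add: C2_def)
qed

lemma outer_mult_vec: "outer a b *v h = (b \<bullet> h) *\<^sub>R a"
  by (simp add: outer_def matrix_vector_mult_def inner_vec_def vec_eq_iff sum_distrib_left sum_distrib_right mult_ac)

lemma csig_scale:
  fixes H :: "real^'n^'n"
  assumes "transpose H = H"
  shows "csig j (c *\<^sub>R H) = c ^ j * csig j H"
proof (cases j)
  case (Suc m)
  have "outer 0 0 = (0 :: real^'n^'n)" by (simp add: outer_def vec_eq_iff)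
  then show ?thesis
    using csig_scale_rank_one[OF assms, of m c 0 0] Tn_scale[OF assms, of m 0 0 0] Suc by simp
qed simp

lemma csig_eq_sigma:
  assumes "transpose H = H" shows "csig j H = sigma j H"
  by (rule spectral_theorem[OF assms]) (simp add: csig_diagonalized sigma_diagonalized)

lemma transpose_scaleR: "transpose (c *\<^sub>R A) = c *\<^sub>R transpose A" for A :: "real^'n^'n"
  by (simp add: transpose_def vec_eq_iff)

lemma transpose_uminus': "transpose (- A) = - transpose A" for A :: "real^'n^'n"
  by (simp add: transpose_def vec_eq_iff)

lemma transpose_add': "transpose (A + B) = transpose A + transpose B" for A B :: "real^'n^'n"
  by (simp add: transpose_def vec_eq_iff)

lemma transpose_outer: "transpose (outer a b) = outer b a"
  by (simp add: transpose_def outer_def vec_eq_iff mult.commute)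

lemma outer_scaleR: "outer (r *\<^sub>R a) (t *\<^sub>R b) = (r * t) *\<^sub>R outer a b"
  by (simp add: outer_def vec_eq_iff)

lemma exp_quotient_power: "exp (- r / (real k + 1)) ^ (k + 1) * exp r = 1"
proof -
  have "exp (- r / (real k + 1)) ^ (k + 1) = exp (real (k + 1) * (- r / (real k + 1)))"
    by (rule exp_of_nat_mult[symmetric])
  also have "real (k + 1) * (- r / (real k + 1)) = - r" by (simp add: field_simps)
  finally show ?thesis by (simp add: exp_minus)
qed

text \<open>With \<open>\<kappa> = 1/(k+1)\<close> one has
  \<open>w H - outer p p = \<kappa> w^2 (- D^2 u)\<close>. Cone, \<open>T_le\<close> and equation
  all follow through \<open>csig_minus_rank_one\<close>. Applying \<open>\<sigma>_k\<close> gives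
  \<open>\<kappa>^k w^(2k) e^u\<close> on the right; since \<open>w^(k+1) e^u = 1\<close>, both
  sides carry \<open>w^(k-1)\<close>, and \<open>\<kappa>^k\<close> is left.\<close>

lemma admissible_imp_quadratic_growth_solution:
  fixes u :: "real^'n \<Rightarrow> real"
  assumes dim: "CARD('n) = 2 * k" and k: "k \<ge> 2" and adm: "admissible_solution k u"
  defines "w \<equiv> \<lambda>x. exp (- u x / (real k + 1))"
  obtains p H where "quadratic_growth_solution k ((1 / (real k + 1)) ^ k) w p H"
proof -
  define \<kappa> where "\<kappa> = 1 / (real k + 1)"
  have \<kappa>: "\<kappa> > 0" by (simp add: \<kappa>_def)
  have C2: "C2 u" and Gam: "\<And>x. - hessian u x \<in> Gamma_cone k" and E: "\<And>x. sigma k (- hessian u x) = exp (u x)"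
    using adm by (auto simp: admissible_solution_def)
  define q where "q = grad u"
  define U where "U x = hessian u x" for x
  note gu = C2_imp_derivatives[OF C2, folded q_def U_def[abs_def]]
  have symU: "transpose (- U x) = - U x" for x using Gam[of x] by (simp add: Gamma_cone_def U_def)
  have wexp: "w = (\<lambda>x. exp (- \<kappa> * u x))" by (simp add: w_def \<kappa>_def fun_eq_iff)
  define p where "p x = (- \<kappa> * w x) *\<^sub>R q x" for x
  have "has_grad (\<lambda>x. exp (- \<kappa> * u x)) (\<lambda>x. (- \<kappa> * exp (- \<kappa> * u x)) *\<^sub>R q x)"
    by (rule has_grad_compose[OF gu(1), of "\<lambda>t. exp (- \<kappa> * t)" "\<lambda>t. - \<kappa> * exp (- \<kappa> * t)"])
       (auto intro!: derivative_eq_intros continuous_intros)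
  then have gw: "has_grad w p" by (simp add: wexp p_def[abs_def])
  define H where "H x = (\<kappa> * w x) *\<^sub>R (- U x) + (\<kappa>\<^sup>2 * w x) *\<^sub>R outer (q x) (q x)" for x
  have symH: "transpose (H x) = H x" for x
    unfolding H_def transpose_add' transpose_scaleR symU transpose_outer ..
  have w0: "w x > 0" for x by (simp add: w_def)
  have A: "w x *\<^sub>R H x - outer (p x) (p x) = (\<kappa> * (w x)\<^sup>2) *\<^sub>R (- U x)" for x
    unfolding p_def outer_scaleR H_def
    by (simp add: scaleR_add_right scaleR_diff_right power2_eq_square mult_ac)
  have symA: "transpose ((\<kappa> * (w x)\<^sup>2) *\<^sub>R (- U x)) = (\<kappa> * (w x)\<^sup>2) *\<^sub>R (- U x)" for x
    unfolding transpose_scaleR symU ..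
  have sU: "csig j (- U x) > 0" if "j \<le> k" for j x
  proof (cases "j = 0")
    case False
    then show ?thesis using Gam[of x] that unfolding csig_eq_sigma[OF symU] unfolding U_def by (auto simp: Gamma_cone_def)
  qed simp
  have sA: "csig j ((\<kappa> * (w x)\<^sup>2) *\<^sub>R (- U x)) > 0" if "j \<le> k" for j x
    using sU[OF that, of x] \<kappa> w0[of x] unfolding csig_scale[OF symU] by simp
  have minus: "csig (Suc m) ((\<kappa> * (w x)\<^sup>2) *\<^sub>R (- U x)) = w x ^ m * (w x * csig (Suc m) (H x) - Tn m (H x) (p x) (p x))" for m x
    using csig_minus_rank_one[OF symH, of m "w x" x "p x"] unfolding A .
  have "quadratic_growth_solution k (\<kappa> ^ k) w p H"
  proof (unfold_locales)
    show "CARD('n) = 2 * k" "k \<ge> 2" by fact+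
    show "\<kappa> ^ k > 0" using \<kappa> by simp
    show "has_grad w p" by (rule gw)
    show "(p has_derivative (\<lambda>h. H x *v h)) (at x)" for x
    proof -
      have "((\<lambda>x. (- \<kappa> * w x) *\<^sub>R q x) has_derivative
         (\<lambda>h. (- \<kappa> * w x) *\<^sub>R (U x *v h) + (- \<kappa> * (p x \<bullet> h)) *\<^sub>R q x)) (at x)"
        by (rule has_derivative_scaleR[OF has_derivative_mult_right[OF has_gradD(1)[OF gw]] gu(2)])
      moreover have "(- \<kappa> * w x) *\<^sub>R (U x *v h) + (- \<kappa> * (p x \<bullet> h)) *\<^sub>R q x = H x *v h" for h
      proof -
        have mU: "(- U x) *v h = - (U x *v h)"
          by (simp add: matrix_vector_mult_def vec_eq_iff sum_negf)
        show ?thesis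
          unfolding H_def matrix_vector_mult_add_rdistrib scaleR_matrix_vector_assoc[symmetric] outer_mult_vec mU
          by (simp add: p_def power2_eq_square)
      qed
      ultimately show ?thesis by (simp add: p_def[abs_def])
    qed
    show "continuous_on UNIV H"
      unfolding H_def by (intro continuous_intros has_gradD(2)[OF gu(1)] has_gradD(3)[OF gw] gu(3))
    show "transpose (H x) = H x" for x by (rule symH)
    show "w x > 0" for x by (rule w0)
    show "csig j (H x) > 0" if "j \<le> k" for j x
      by (rule csig_pos_add_rank_one[OF symA symH sA that A[symmetric] w0])
    show "Tn j (H x) (p x) (p x) \<le> w x * csig (Suc j) (H x)" if "j < k" for j x
    proof -
      have "0 < w x ^ j * (w x * csig (Suc j) (H x) - Tn j (H x) (p x) (p x))"
        using sA[of "Suc j" x] that unfolding minus by simp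
      then show ?thesis using w0[of x] by (simp add: zero_less_mult_iff)
    qed
    show "w x * csig k (H x) - Tn (k - 1) (H x) (p x) (p x) = \<kappa> ^ k" for x
    proof -
      have k1: "Suc (k - 1) = k" using k by simp
      have "w x ^ (k - 1) * (w x * csig k (H x) - Tn (k - 1) (H x) (p x) (p x)) = csig k ((\<kappa> * (w x)\<^sup>2) *\<^sub>R (- U x))"
        using minus[of "k - 1" x] unfolding k1 by simp
      also have "\<dots> = (\<kappa> * (w x)\<^sup>2) ^ k * exp (u x)"
        using E[of x] unfolding csig_scale[OF symU] csig_eq_sigma[OF symU] unfolding U_def by simp
      also have "\<dots> = \<kappa> ^ k * (w x ^ (k - 1) * (w x ^ (k + 1) * exp (u x)))"
        using k1 by (simp add: power_mult_distrib power_mult[symmetric] power_add[symmetric] mult_2)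
          (metis add_Suc_right power_add power_Suc mult.commute)
      also have "w x ^ (k + 1) * exp (u x) = 1" unfolding w_def by (rule exp_quotient_power)
      finally show ?thesis using w0[of x] by simp
    qed
  qed
  then show ?thesis using that unfolding \<kappa>_def by blast
qed

section \<open>Symmetric functions and Newton tensors of the identity\<close>

lemma esym_const: "finite S \<Longrightarrow> esym S (\<lambda>_. 1) j = real (card S choose j)"
  using esym_eq_0[of S j "\<lambda>_. 1"]
  by (cases "j \<le> card S") (auto simp: esym_def coeff_linear_poly_power)

lemma diagm_one: "mat 1 ** diagm (\<lambda>_. 1) ** transpose (mat 1) = (mat 1 :: real^'n^'n)"
proof -
  have "diagm (\<lambda>_. 1) = (mat 1 :: real^'n^'n)" by (simp add: diagm_def mat_def vec_eq_iff)
  then show ?thesis by simp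
qed

lemma csig_mat_1: "csig j (mat 1 :: real^'n^'n) = real (CARD('n) choose j)"
  using csig_diagonalized[OF orthogonal_matrix_id, of j "\<lambda>_::'n. 1"] unfolding diagm_one by (simp add: esym_const)

lemma Tn_mat_1: "Tn m (mat 1 :: real^'n^'n) a b = (a \<bullet> b) * real ((CARD('n) - 1) choose m)"
  using Tn_diagonalized[OF orthogonal_matrix_id, of m "\<lambda>_::'n. 1" a b] unfolding diagm_one
  by (simp add: esym_const inner_vec_def sum_distrib_right)

section \<open>Rigidity and the bubbles\<close>

text \<open>The derivative of \<open>p $ i\<close> along a segment on which coordinate
  \<open>i\<close> is constant vanishes, so \<open>p $ i\<close> depends on that coordinate
  alone.\<close>

lemma scalar_Hessian_component:
  fixes p :: "real^'n \<Rightarrow> real^'n"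
  assumes p: "\<And>x. (p has_derivative (\<lambda>h. \<mu> x *\<^sub>R h)) (at x)" and xy: "x $ i = y $ i"
  shows "p x $ i = p y $ i"
proof -
  define f where "f t = p (x + t *\<^sub>R (y - x)) $ i" for t :: real
  have "(f has_real_derivative 0) (at t)" for t
  proof -
    have "((\<lambda>t. x + t *\<^sub>R (y - x)) has_derivative (\<lambda>h. h *\<^sub>R (y - x))) (at t)"
      by (auto intro!: derivative_eq_intros)
    from has_derivative_compose[OF this p]
    have "((\<lambda>t. p (x + t *\<^sub>R (y - x))) has_derivative (\<lambda>h. \<mu> (x + t *\<^sub>R (y - x)) *\<^sub>R (h *\<^sub>R (y - x)))) (at t)" .
    then have "(f has_derivative (\<lambda>h. (\<mu> (x + t *\<^sub>R (y - x)) *\<^sub>R (h *\<^sub>R (y - x))) $ i)) (at t)"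
      unfolding f_def by (rule bounded_linear.has_derivative[OF bounded_linear_vec_nth])
    then show ?thesis
      by (rule has_derivative_imp_has_field_derivative) (simp add: xy)
  qed
  then have "f 0 = f 1" by (intro DERIV_isconst_all) auto
  then show ?thesis by (simp add: f_def)
qed

text \<open>As the derivative of \<open>p $ i\<close> in direction \<open>i\<close>,
  \<open>\<mu>\<close> depends on coordinate \<open>i\<close> alone, and this for every
  \<open>i\<close>. Two different indices make it constant, without differentiating
  \<open>\<mu>\<close>.\<close>

lemma scalar_Hessian_constant:
  fixes p :: "real^'n \<Rightarrow> real^'n"
  assumes p: "\<And>x. (p has_derivative (\<lambda>h. \<mu> x *\<^sub>R h)) (at x)" and card: "CARD('n) \<ge> 2"
  shows "\<mu> x = \<mu> y"
proof -
  have same: "\<mu> x = \<mu> y" if xy: "x $ i = y $ i" for x y and i :: 'n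
  proof -
    have der: "((\<lambda>t. p (z + t *\<^sub>R axis i 1) $ i) has_real_derivative \<mu> z) (at 0)" for z
    proof -
      have "((\<lambda>t. z + t *\<^sub>R axis i 1) has_derivative (\<lambda>h. h *\<^sub>R axis i (1::real))) (at 0)"
        by (auto intro!: derivative_eq_intros)
      moreover have "(p has_derivative (\<lambda>h. \<mu> z *\<^sub>R h)) (at (z + 0 *\<^sub>R axis i 1))" using p[of z] by simp
      ultimately have "((\<lambda>t. p (z + t *\<^sub>R axis i 1)) has_derivative (\<lambda>h. \<mu> z *\<^sub>R (h *\<^sub>R axis i (1::real)))) (at 0)"
        by (rule has_derivative_compose)
      then have "((\<lambda>t. p (z + t *\<^sub>R axis i 1) $ i) has_derivative (\<lambda>h. (\<mu> z *\<^sub>R (h *\<^sub>R axis i (1::real))) $ i)) (at 0)"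
        by (rule bounded_linear.has_derivative[OF bounded_linear_vec_nth])
      then show ?thesis by (rule has_derivative_imp_has_field_derivative) simp
    qed
    have "p (x + t *\<^sub>R axis i 1) $ i = p (y + t *\<^sub>R axis i 1) $ i" for t
      by (rule scalar_Hessian_component[OF p]) (use xy in simp)
    then show ?thesis using der[of x] der[of y] by (simp add: DERIV_unique)
  qed
  obtain i j :: 'n where ij: "i \<noteq> j"
    using card by (metis card_2_iff' card_le_Suc0_iff_eq finite UNIV_I not_less_eq_eq numeral_2_eq_2)
  \<comment> \<open>An intermediate point that shares coordinate \<open>i\<close> with
    \<open>x\<close> and coordinate \<open>j\<close> with \<open>y\<close>.\<close>
  define z where "z = (\<chi> m. if m = i then x $ m else y $ m)"
  have "\<mu> x = \<mu> z" by (rule same[where i = i]) (simp add: z_def)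
  also have "\<dots> = \<mu> y" by (rule same[where i = j]) (use ij in \<open>simp add: z_def\<close>)
  finally show ?thesis .
qed

context quadratic_growth_solution
begin

text \<open>A constant scalar Hessian makes \<open>p\<close> affine and \<open>w\<close> quadratic
  around the zero \<open>x0\<close> of \<open>p\<close>. At \<open>x0\<close> the tensor term of the
  equation vanishes, which ties \<open>w x0\<close> to \<open>l\<close>.\<close>

lemma rigidity:
  assumes "filterlim R at_top sequentially" "C > 0" "\<And>j. bint (R j) w \<le> C * R j ^ NN"
  obtains x0 l where "l > 0" "w x0 > 0" "\<And>x. w x = w x0 * (1 + l * (norm (x - x0))\<^sup>2)"
    "w x0 ^ Suc k * (real ((2 * k) choose k) * (2 * l) ^ k) = c"
proof -
  define \<mu> where "\<mu> x = sg 1 x / CARD('n)" for x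
  have H: "H x = \<mu> x *\<^sub>R mat 1" for x unfolding \<mu>_def by (rule Hessian_scalar[OF assms])
  have dp: "(p has_derivative (\<lambda>h. \<mu> x *\<^sub>R h)) (at x)" for x
    using der_p[of x] unfolding H scaleR_matrix_vector_assoc[symmetric] by simp
  have \<mu>c: "\<mu> x = \<mu> 0" for x by (rule scalar_Hessian_constant[OF dp]) (use dim k2 in simp)
  define m where "m = \<mu> 0"
  have m: "m > 0" unfolding m_def \<mu>_def using sig_pos[of 1 0] k2 by simp
  have dp': "(p has_derivative (\<lambda>h. m *\<^sub>R h)) (at x)" for x using dp[of x] \<mu>c[of x] by (simp add: m_def)
  have "\<exists>v. \<forall>x\<in>UNIV. p x - m *\<^sub>R x = v"
  proof (rule has_derivative_zero_constant)
    show "((\<lambda>x. p x - m *\<^sub>R x) has_derivative (\<lambda>h. 0)) (at x within UNIV)" for x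
      using has_derivative_diff[OF dp'[of x] has_derivative_scaleR_right[OF has_derivative_ident, of m]] by simp
  qed simp
  then obtain v where v: "p x - m *\<^sub>R x = v" for x by auto
  define x0 where "x0 = - (v /\<^sub>R m)"
  have p: "p x = m *\<^sub>R (x - x0)" for x
    using v[of x] m by (simp add: x0_def scaleR_add_right algebra_simps)
  have "\<exists>d. \<forall>x\<in>UNIV. w x - (m / 2) * ((x - x0) \<bullet> (x - x0)) = d"
  proof (rule has_derivative_zero_constant)
    fix x
    have "((\<lambda>x. (m / 2) * ((x - x0) \<bullet> (x - x0))) has_derivative (\<lambda>h. (m / 2) * ((x - x0) \<bullet> h + h \<bullet> (x - x0)))) (at x)"
      by (auto intro!: derivative_eq_intros)
    from has_derivative_diff[OF has_gradD(1)[OF grad_w, of x] this]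
    show "((\<lambda>x. w x - (m / 2) * ((x - x0) \<bullet> (x - x0))) has_derivative (\<lambda>h. 0)) (at x within UNIV)"
      by (rule has_derivative_eq_rhs) (simp add: p inner_commute fun_eq_iff)
  qed simp
  then obtain d where d: "w x - (m / 2) * ((x - x0) \<bullet> (x - x0)) = d" for x by auto
  have dw: "d = w x0" using d[of x0] by simp
  define l where "l = m / (2 * w x0)"
  have l: "l > 0" using m w_pos by (simp add: l_def)
  have ml: "m = 2 * l * w x0" by (simp add: l_def)
  have wx: "w x = w x0 * (1 + l * (norm (x - x0))\<^sup>2)" for x
    using d[of x] unfolding dw ml by (simp add: power2_norm_eq_inner algebra_simps)
  have sym1: "transpose (mat 1 :: real^'n^'n) = mat 1" by simp
  have p0: "p x0 = 0" by (simp add: p)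
  have T: "Tn (k - 1) (H x0) (p x0) (p x0) = 0"
    using Tn_scale[OF sym, of "k - 1" x0 0 0 0] unfolding p0 by simp
  have "csig k (H x0) = m ^ k * real ((2 * k) choose k)"
    unfolding H csig_scale[OF sym1] csig_mat_1 dim using \<mu>c[of x0] by (simp add: m_def)
  then have "w x0 * (m ^ k * real ((2 * k) choose k)) = c" using eqn[of x0] T by simp
  moreover have "w x0 ^ Suc k * (real ((2 * k) choose k) * (2 * l) ^ k) = w x0 * (m ^ k * real ((2 * k) choose k))"
    unfolding ml by (simp add: power_mult_distrib)
  ultimately have c: "w x0 ^ Suc k * (real ((2 * k) choose k) * (2 * l) ^ k) = c" by (rule trans[rotated])
  show ?thesis by (rule that[OF l w_pos wx c])
qed

end

section \<open>Bubbles: identification, admissibility and total mass\<close>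

lemma bubble_factor_pos: "l > 0 \<Longrightarrow> 1 + l * (norm (x - x0))\<^sup>2 > (0::real)"
  by (intro add_pos_nonneg) auto

lemma has_grad_bubble_factor:
  "has_grad (\<lambda>x::real^'n. 1 + l * (norm (x - x0))\<^sup>2) (\<lambda>x. (2 * l) *\<^sub>R (x - x0))"
  unfolding has_grad_def
proof (intro conjI allI)
  fix x :: "real^'n"
  have "((\<lambda>x. 1 + l * ((x - x0) \<bullet> (x - x0))) has_derivative (\<lambda>h. l * ((x - x0) \<bullet> h + h \<bullet> (x - x0)))) (at x)"
    by (auto intro!: derivative_eq_intros)
  then show "((\<lambda>x. 1 + l * (norm (x - x0))\<^sup>2) has_derivative (\<lambda>h. ((2 * l) *\<^sub>R (x - x0)) \<bullet> h)) (at x)"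
    unfolding power2_norm_eq_inner
    by (rule has_derivative_eq_rhs) (simp add: fun_eq_iff inner_commute)
qed (intro continuous_intros)

lemma exp_bubble:
  fixes x0 x :: "real^'n"
  assumes l: "l > 0"
  shows "exp (bubble k x0 l x) = 2 ^ k * (real k + 1) ^ k * real ((2 * k) choose k) * l ^ k
     / (1 + l * (norm (x - x0))\<^sup>2) ^ (k + 1)"
proof -
  have "exp ((real k + 1) * ln (1 + l * (norm (x - x0))\<^sup>2)) = exp (ln (1 + l * (norm (x - x0))\<^sup>2)) ^ (k + 1)"
    by (subst exp_of_nat_mult[symmetric]) (simp add: add_ac)
  then show ?thesis
    using l bubble_factor_pos[OF l, of x x0] unfolding bubble_def exp_diff by simp
qed

lemma classification:
  fixes u :: "real^'n \<Rightarrow> real"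
  assumes k: "k \<ge> 2" and dim: "CARD('n) = 2 * k" and adm: "admissible_solution k u"
    and C: "C > 0" and R: "filterlim R at_top sequentially"
    and growth: "\<And>j. (LINT x:ball 0 (R j)|lborel. exp (- u x / (real k + 1))) \<le> C * R j ^ (CARD('n) + 2)"
  shows "\<exists>x0 l. l > 0 \<and> (\<forall>x. u x = bubble k x0 l x)"
proof -
  define w where "w = (\<lambda>x. exp (- u x / (real k + 1)))"
  obtain p H where "quadratic_growth_solution k ((1 / (real k + 1)) ^ k) w p H"
    using admissible_imp_quadratic_growth_solution[OF dim k adm] unfolding w_def by blast
  then interpret quadratic_growth_solution k "(1 / (real k + 1)) ^ k" w p H .
  obtain j0 where j0: "\<And>j. j \<ge> j0 \<Longrightarrow> R j \<ge> 1"
    using R unfolding filterlim_at_top eventually_sequentially by blast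
  \<comment> \<open>Half the radius puts the closed ball of \<open>bint\<close> inside the open ball
    of the hypothesis, at the price of \<open>2 ^ (2 * k + 2)\<close> in the constant; the shift by
    \<open>j0\<close> keeps the radii positive.\<close>
  define S where "S j = R (j + j0) * (1/2)" for j
  have limS: "filterlim S at_top sequentially"
    unfolding S_def
    by (rule filterlim_at_top_mult_tendsto_pos[where c = "1/2"])
       (auto intro: filterlim_compose[OF R] filterlim_add_const_nat_at_top)
  have grS: "bint (S j) w \<le> (C * 2 ^ (2 * k + 2)) * S j ^ (2 * k + 2)" for j
  proof -
    have R1: "R (j + j0) \<ge> 1" by (rule j0) simp
    have i: "set_integrable lborel (ball 0 (R (j + j0))) w"
      by (rule set_integrable_subset[OF bint_integrable[OF conts(1), of "R (j + j0)"]]) auto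
    have "bint (S j) w \<le> (LINT x:ball 0 (R (j + j0))|lborel. w x)"
      unfolding bint_def set_lebesgue_integral_def
    proof (rule integral_mono)
      show "integrable lborel (\<lambda>x. indicator (cball 0 (S j)) x *\<^sub>R w x)"
        using bint_integrable[OF conts(1), of "S j"] by (simp add: set_integrable_def)
      show "integrable lborel (\<lambda>x. indicator (ball 0 (R (j + j0))) x *\<^sub>R w x)"
        using i by (simp add: set_integrable_def)
      show "indicator (cball 0 (S j)) x *\<^sub>R w x \<le> indicator (ball 0 (R (j + j0))) x *\<^sub>R w x" for x
        using R1 w_pos[of x] by (auto simp: indicator_def S_def less_imp_le)
    qed
    also have "\<dots> \<le> C * R (j + j0) ^ (2 * k + 2)" using growth[of "j + j0"] by (simp add: w_def dim)
    also have "\<dots> = C * (2 * S j) ^ (2 * k + 2)" by (simp add: S_def)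
    finally show ?thesis by (simp only: power_mult_distrib mult_ac)
  qed
  have C': "C * 2 ^ (2 * k + 2) > 0" using C by simp
  obtain x0 l where l: "l > 0" and wx: "\<And>x. w x = w x0 * (1 + l * (norm (x - x0))\<^sup>2)"
    and c: "w x0 ^ Suc k * (real ((2 * k) choose k) * (2 * l) ^ k) = (1 / (real k + 1)) ^ k"
    using rigidity[OF limS C' grS] by metis
  have "u x = bubble k x0 l x" for x
  proof -
    have q: "1 + l * (norm (x - x0))\<^sup>2 > 0" by (rule bubble_factor_pos[OF l])
    have eu: "w y ^ (k + 1) * exp (u y) = 1" for y unfolding w_def by (rule exp_quotient_power)
    let ?K = "2 ^ k * (real k + 1) ^ k * real ((2 * k) choose k) * l ^ k"
    have K: "w x0 ^ (k + 1) * ?K = 1"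
    proof -
      have "w x0 ^ (k + 1) * ?K = (w x0 ^ Suc k * (real ((2 * k) choose k) * (2 * l) ^ k)) * (real k + 1) ^ k"
        by (simp add: power_mult_distrib mult_ac)
      also have "\<dots> = 1" unfolding c by (simp add: power_one_over)
      finally show ?thesis .
    qed
    have "w x ^ (k + 1) * exp (bubble k x0 l x) = w x0 ^ (k + 1) * ?K"
      unfolding exp_bubble[OF l] wx[of x] power_mult_distrib using q by simp
    then have "w x ^ (k + 1) * exp (bubble k x0 l x) = w x ^ (k + 1) * exp (u x)" using K eu[of x] by simp
    then show ?thesis using w_pos[of x] by simp
  qed
  then show ?thesis using l by blast
qed

text \<open>The negative Hessian is a multiple of the identity minus a rank-one matrix, so
  \<open>csig_minus_rank_one\<close> with \<open>H = mat 1\<close> gives every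
  \<open>\<sigma>_j\<close> as a positive factor times \<open>1 + l |x - x0|^2 (1 - j/k)\<close>.
  This is positive up to \<open>j = k\<close>, where the quadratic term drops out and the equation
  appears.\<close>

lemma bubble_admissible:
  fixes x0 :: "real^'n"
  assumes k: "k \<ge> 2" and dim: "CARD('n) = 2 * k" and l: "l > 0"
  shows "admissible_solution k (bubble k x0 l)"
proof -
  define q where "q x = 1 + l * (norm (x - x0))\<^sup>2" for x :: "real^'n"
  have q0: "q x > 0" for x unfolding q_def by (rule bubble_factor_pos[OF l])
  have gq: "has_grad q (\<lambda>x. (2 * l) *\<^sub>R (x - x0))"
    unfolding q_def by (rule has_grad_bubble_factor)
  define u where "u = bubble k x0 l"
  let ?L = "ln (2 ^ k * (real k + 1) ^ k * real ((2 * k) choose k) * l ^ k)"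
  have u: "u = (\<lambda>x. ?L - (real k + 1) * ln (q x))" by (simp add: u_def bubble_def q_def fun_eq_iff)
  define F where "F x = (- (real k + 1) * (2 * l) / q x) *\<^sub>R (x - x0)" for x
  have "has_grad (\<lambda>x. ?L - (real k + 1) * ln (q x)) (\<lambda>x. (- (real k + 1) / q x) *\<^sub>R ((2 * l) *\<^sub>R (x - x0)))"
  proof (rule has_grad_compose[OF gq, of "\<lambda>t. ?L - (real k + 1) * ln t" "\<lambda>t. - (real k + 1) / t"])
    show "((\<lambda>t. ?L - (real k + 1) * ln t) has_real_derivative - (real k + 1) / q x) (at (q x))" for x
      using q0[of x] by (auto intro!: derivative_eq_intros simp: field_simps)
    show "continuous_on (range q) (\<lambda>t. - (real k + 1) / t)"
      using q0 by (intro continuous_intros) (auto simp: less_imp_neq[THEN not_sym])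
  qed
  then have gu: "has_grad u F" by (simp add: u F_def[abs_def])
  define M where "M x = (- (real k + 1) * (2 * l) / q x) *\<^sub>R mat 1 + outer (x - x0) (((real k + 1) * (2 * l) / (q x)\<^sup>2 * (2 * l)) *\<^sub>R (x - x0))"
    for x
  have dF: "(F has_derivative (\<lambda>h. M x *v h)) (at x)" for x
  proof -
    have "has_grad (\<lambda>x. - (real k + 1) * (2 * l) / q x) (\<lambda>x. ((real k + 1) * (2 * l) / (q x)\<^sup>2) *\<^sub>R ((2 * l) *\<^sub>R (x - x0)))"
    proof (rule has_grad_compose[OF gq, of "\<lambda>t. - (real k + 1) * (2 * l) / t" "\<lambda>t. (real k + 1) * (2 * l) / t\<^sup>2"])
      show "((\<lambda>t. - (real k + 1) * (2 * l) / t) has_real_derivative (real k + 1) * (2 * l) / (q x)\<^sup>2) (at (q x))" for x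
      proof -
        have "((\<lambda>t. - (real k + 1) * (2 * l) / t) has_real_derivative
            (0 * q x - (- (real k + 1) * (2 * l)) * 1) / (q x * q x)) (at (q x))"
          using q0[of x] by (intro DERIV_divide DERIV_const DERIV_ident) auto
        then show ?thesis
          by (rule DERIV_cong) (use q0[of x] in \<open>simp add: power2_eq_square field_simps\<close>)
      qed
      show "continuous_on (range q) (\<lambda>t. (real k + 1) * (2 * l) / t\<^sup>2)"
        using q0 by (intro continuous_intros) (auto simp: less_imp_neq[THEN not_sym])
    qed
    note g = has_gradD(1)[OF this, of x]
    have "((\<lambda>x. x - x0) has_derivative (\<lambda>h. h)) (at x)" by (auto intro!: derivative_eq_intros)
    from has_derivative_scaleR[OF g this] show ?thesis
      unfolding F_def M_def
      by (rule has_derivative_eq_rhs)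
         (simp add: fun_eq_iff matrix_vector_mult_add_rdistrib outer_mult_vec flip: scaleR_matrix_vector_assoc)
  qed
  have hess: "hessian u x = M x" for x by (rule has_derivative_imp_hessian[OF gu dF])
  have gradu: "grad u = F" using has_derivative_imp_grad[OF has_gradD(1)[OF gu]] by auto
  have "continuous_on UNIV M"
    unfolding M_def using q0
    by (intro continuous_intros has_gradD(3)[OF gq]) (auto simp: less_imp_neq[THEN not_sym])
  then have C2: "C2 u"
    unfolding C2_def gradu differentiable_on_def differentiable_def
    using has_gradD(1)[OF gu] dF hess by (auto simp: fun_eq_iff[symmetric])
  have sig: "transpose (- M x) = - M x \<and> sigma (Suc m) (- M x) =
     ((real k + 1) * (2 * l) / q x) ^ Suc m * real ((2 * k) choose Suc m) * ((1 + l * (norm (x - x0))\<^sup>2 * (1 - (real m + 1) / k)) / q x)" for x m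
  proof -
    define a where "a = (real k + 1) * (2 * l) / q x"
    define z where "z = (sqrt (real k + 1) * (2 * l) / q x) *\<^sub>R (x - x0)"
    have sym1: "transpose (mat 1 :: real^'n^'n) = mat 1" by simp
    have zz: "outer z z = ((real k + 1) * (2 * l) / (q x)\<^sup>2 * (2 * l)) *\<^sub>R outer (x - x0) (x - x0)"
      unfolding z_def outer_scaleR by (simp add: power2_eq_square)
    have oM: "outer (x - x0) (r *\<^sub>R (x - x0)) = r *\<^sub>R outer (x - x0) (x - x0)" for r
      using outer_scaleR[of 1 "x - x0" r "x - x0"] by simp
    have neg: "- (real k + 1) * (2 * l) / q x = - a"
      using q0[of x] by (simp add: a_def field_simps)
    have M: "- M x = a *\<^sub>R mat 1 - outer z z" unfolding M_def oM zz neg by simp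
    have sM: "transpose (- M x) = - M x"
      unfolding M_def oM transpose_uminus' transpose_add' transpose_scaleR sym1 transpose_outer ..
    \<comment> \<open>With \<open>n = 2k\<close> this ratio combines with the factor 2 in
      \<open>2 l\<close> to give \<open>(m + 1) / k\<close>, hence the critical order
      \<open>m + 1 = k\<close>.\<close>
    have bin: "real ((2 * k - 1) choose m) = (real m + 1) / (2 * k) * real ((2 * k) choose Suc m)"
    proof -
      have "Suc m * ((2 * k) choose Suc m) = (2 * k) * ((2 * k - 1) choose m)"
        by (rule binomial_absorption)
      then have "real (Suc m * ((2 * k) choose Suc m)) = real ((2 * k) * ((2 * k - 1) choose m))" by simp
      then show ?thesis using k by (simp add: field_simps)
    qed
    have z2: "z \<bullet> z = a * (2 * l / q x) * (norm (x - x0))\<^sup>2"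
      by (simp add: z_def a_def power2_norm_eq_inner)
    have "sigma (Suc m) (- M x) = csig (Suc m) (- M x)" by (rule csig_eq_sigma[OF sM, symmetric])
    also have "\<dots> = a ^ m * (a * real ((2 * k) choose Suc m) - a * (2 * l / q x) * (norm (x - x0))\<^sup>2 * real ((2 * k - 1) choose m))"
      unfolding M csig_minus_rank_one[OF sym1] csig_mat_1 Tn_mat_1 z2 dim by simp
    also have "\<dots> = a ^ Suc m * real ((2 * k) choose Suc m) * (1 - l / q x * (norm (x - x0))\<^sup>2 * ((real m + 1) / k))"
    proof -
      have e1: "(2 * l / q x) * ((real m + 1) / (2 * k)) = l / q x * ((real m + 1) / k)" by simp
      have e2: "a ^ m * (a * B - a * (2 * l / q x) * s * (t * B)) = a ^ Suc m * B * (1 - ((2 * l / q x) * t) * s)" for B s t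
        by (simp add: algebra_simps)
      show ?thesis unfolding bin e2 e1 by (simp only: mult_ac)
    qed
    also have "1 - l / q x * (norm (x - x0))\<^sup>2 * ((real m + 1) / k) = (1 + l * (norm (x - x0))\<^sup>2 * (1 - (real m + 1) / k)) / q x"
    proof -
      have "(1 + l * (norm (x - x0))\<^sup>2 * (1 - (real m + 1) / k)) = q x - l * (norm (x - x0))\<^sup>2 * ((real m + 1) / k)"
        by (simp add: q_def algebra_simps)
      then show ?thesis using q0[of x] by (simp add: diff_divide_distrib)
    qed
    finally show ?thesis using sM by (simp add: a_def)
  qed
  have "- hessian u x \<in> Gamma_cone k" for x
  proof -
    have "sigma j (- M x) > 0" if j: "j \<in> {1..k}" for j
    proof -
      obtain m where m: "j = Suc m" using j by (cases j) auto
      have "(real m + 1) / k \<le> 1" using j m k by simp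
      then have "0 \<le> l * (norm (x - x0))\<^sup>2 * (1 - (real m + 1) / k)" using l by simp
      then have "0 < (1 + l * (norm (x - x0))\<^sup>2 * (1 - (real m + 1) / k)) / q x" using q0[of x] by simp
      moreover have "0 < ((real k + 1) * (2 * l) / q x) ^ Suc m" using l q0[of x] by simp
      moreover have "0 < real ((2 * k) choose Suc m)" using j m by simp
      ultimately show ?thesis using sig[of x m] unfolding m by (metis mult_pos_pos)
    qed
    then show ?thesis using sig unfolding hess by (simp add: Gamma_cone_def)
  qed
  moreover have "sigma k (- hessian u x) = exp (u x)" for x
  proof -
    obtain m where m: "k = Suc m" using k by (cases k) auto
    have "(real m + 1) / k = 1" by (simp add: m)
    then have "sigma k (- hessian u x) = ((real k + 1) * (2 * l) / q x) ^ k * real ((2 * k) choose k) * (1 / q x)"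
      using sig[of x m] unfolding hess m[symmetric] by simp
    also have "\<dots> = exp (u x)"
      unfolding u_def exp_bubble[OF l] q_def[symmetric]
      by (simp only: power_divide power_mult_distrib power_Suc Suc_eq_plus1[symmetric] times_divide_eq_left
          times_divide_eq_right divide_divide_eq_left mult_1_right mult_ac)
    finally show ?thesis .
  qed
  ultimately show ?thesis using C2 by (simp add: admissible_solution_def u_def)
qed

text \<open>The map \<open>g x = sqrt l (x - x0) / sqrt (q x)\<close> takes the whole space
  bijectively onto the open unit ball, and its Jacobian \<open>l^k / q^(k+1)\<close> is the bubble
  density up to the constant. The mass is that constant times the volume of the unit ball,
  independent of \<open>x0\<close> and \<open>l\<close>.\<close>

lemma bubble_integral:
  fixes x0 :: "real^'n"
  assumes dim: "CARD('n) = 2 * k" and l: "l > 0"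
  shows "has_bochner_integral lborel (\<lambda>x. exp (bubble k x0 l x))
    (2 ^ k * (real k + 1) ^ k * real ((2 * k) choose k) * pi ^ k / fact k)"
proof -
  define q where "q x = 1 + l * (norm (x - x0))\<^sup>2" for x :: "real^'n"
  have q0: "q x > 0" for x unfolding q_def by (rule bubble_factor_pos[OF l])
  have l0: "sqrt l > 0" "sqrt l * sqrt l = l" using l by simp_all
  define r where "r x = sqrt l / sqrt (q x)" for x
  define g where "g x = r x *\<^sub>R (x - x0)" for x
  define b where "b x = sqrt l * l / (sqrt (q x) * q x)" for x
  have r0: "r x > 0" for x using l q0[of x] by (simp add: r_def)
  have r2: "(r x)\<^sup>2 = l / q x" for x using l q0[of x] by (simp add: r_def power_divide)
  have gq: "(q has_derivative (\<lambda>h. ((2 * l) *\<^sub>R (x - x0)) \<bullet> h)) (at x)" for x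
    unfolding q_def by (rule has_gradD(1)[OF has_grad_bubble_factor])
  define M where "M x = diagm (\<lambda>_. r x) + outer ((- b x) *\<^sub>R (x - x0)) (x - x0)" for x
  have dg: "(g has_derivative (\<lambda>h. M x *v h)) (at x)" for x
  proof -
    have "((\<lambda>t. sqrt l / sqrt t) has_real_derivative - (sqrt l / (2 * (sqrt (q x) * q x)))) (at (q x))"
    proof -
      have "((\<lambda>t. sqrt l / sqrt t) has_real_derivative
         (0 * sqrt (q x) - sqrt l * (inverse (sqrt (q x)) / 2)) / (sqrt (q x) * sqrt (q x))) (at (q x))"
        using q0[of x] by (intro DERIV_divide DERIV_const DERIV_real_sqrt) auto
      then show ?thesis
        by (rule DERIV_cong) (use q0[of x] in \<open>simp add: divide_simps\<close>)
    qed
    from has_derivative_compose[OF gq this[unfolded has_field_derivative_def]]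
    have "(r has_derivative (\<lambda>h. - (sqrt l / (2 * (sqrt (q x) * q x))) * (((2 * l) *\<^sub>R (x - x0)) \<bullet> h))) (at x)"
      by (simp add: r_def[abs_def])
    moreover have "((\<lambda>x. x - x0) has_derivative (\<lambda>h. h)) (at x)" by (auto intro!: derivative_eq_intros)
    ultimately have "(g has_derivative (\<lambda>h. r x *\<^sub>R h +
        (- (sqrt l / (2 * (sqrt (q x) * q x))) * (((2 * l) *\<^sub>R (x - x0)) \<bullet> h)) *\<^sub>R (x - x0))) (at x)"
      unfolding g_def[abs_def] by (rule has_derivative_scaleR)
    moreover have "r x *\<^sub>R h + (- (sqrt l / (2 * (sqrt (q x) * q x))) * (((2 * l) *\<^sub>R (x - x0)) \<bullet> h)) *\<^sub>R (x - x0) = M x *v h" for h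
    proof -
      have "diagm (\<lambda>_. r x) *v h = r x *\<^sub>R h"
        by (simp add: diagm_def matrix_vector_mult_def vec_eq_iff if_distrib[of "\<lambda>y. y * _"] cong: if_cong)
      then show ?thesis
        by (simp add: M_def matrix_vector_mult_add_rdistrib outer_mult_vec b_def)
    qed
    ultimately show ?thesis by simp
  qed
  have det: "det (M x) = l ^ k / q x ^ (k + 1)" for x
  proof -
    define s where "s = (norm (x - x0))\<^sup>2"
    have card: "card (UNIV - {i :: 'n}) = 2 * k - 1" for i using dim by simp
    have pos: "2 * k > 0" using dim by (metis zero_less_card_finite)
    have "det (M x) = r x ^ (2 * k) + (\<Sum>i\<in>UNIV. ((- b x) *\<^sub>R (x - x0)) $ i * (x - x0) $ i * r x ^ (2 * k - 1))"
      unfolding M_def outer_def det_diagm_rank_one by (simp add: card dim)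
    also have "(\<Sum>i\<in>UNIV. ((- b x) *\<^sub>R (x - x0)) $ i * (x - x0) $ i * r x ^ (2 * k - 1)) = - b x * s * r x ^ (2 * k - 1)"
      unfolding s_def power2_norm_eq_inner inner_vec_def
      by (simp add: sum_distrib_left sum_distrib_right mult_ac sum_negf)
    also have "b x = r x * (l / q x)" by (simp add: b_def r_def)
    also have "r x ^ (2 * k) + - (r x * (l / q x)) * s * r x ^ (2 * k - 1) = r x ^ (2 * k) * (1 - l / q x * s)"
      using pos by (cases "2 * k") (auto simp: algebra_simps)
    also have "r x ^ (2 * k) = l ^ k / q x ^ k" by (simp add: power_mult r2 power_divide)
    also have "1 - l / q x * s = 1 / q x"
      using q0[of x] by (simp add: q_def s_def field_simps)
    finally show ?thesis by simp
  qed
  have mat: "matrix (\<lambda>h. M x *v h) = M x" for x by simp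
  have ng: "(norm (g x))\<^sup>2 = 1 - 1 / q x" for x
  proof -
    have "(norm (g x))\<^sup>2 = (r x)\<^sup>2 * (norm (x - x0))\<^sup>2" by (simp add: g_def power_mult_distrib)
    also have "\<dots> = (q x - 1) / q x" by (simp add: r2 q_def)
    finally show ?thesis using q0[of x] by (simp add: diff_divide_distrib)
  qed
  have inj: "inj_on g UNIV"
  proof (rule inj_onI)
    fix x y assume "g x = g y"
    then have "1 / q x = 1 / q y" using ng[of x] ng[of y] by simp
    then have "r x = r y" by (simp add: r_def)
    then show "x = y" using \<open>g x = g y\<close> r0[of y] by (simp add: g_def)
  qed
  have img: "g ` UNIV = ball 0 1"
  proof (intro set_eqI iffI)
    fix z assume "z \<in> g ` UNIV"
    then obtain x where z: "z = g x" by auto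
    have "(norm z)\<^sup>2 < 1\<^sup>2" using ng[of x] q0[of x] by (simp add: z)
    then have "norm z < 1" by (rule power2_less_imp_less) simp
    then show "z \<in> ball 0 1" by simp
  next
    fix z :: "real^'n" assume "z \<in> ball 0 1"
    then have z1: "(norm z)\<^sup>2 < 1" by (simp add: power_less_one_iff abs_square_less_1)
    define s where "s = sqrt (1 - (norm z)\<^sup>2)"
    have s: "s > 0" "s\<^sup>2 = 1 - (norm z)\<^sup>2" using z1 by (simp_all add: s_def)
    \<comment> \<open>The inverse of \<open>g\<close>: from \<open>|g x|^2 = 1 - 1 / q x\<close> one
      reads off \<open>q x = 1 / s^2\<close>, so \<open>g\<close> scales \<open>x - x0\<close> by
      \<open>sqrt l * s\<close>.\<close>
    define x where "x = x0 + (1 / (sqrt l * s)) *\<^sub>R z"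
    have "q x = 1 + l * (1 / (sqrt l * s))\<^sup>2 * (norm z)\<^sup>2"
      by (simp add: q_def x_def power_mult_distrib power_divide)
    also have "l * (1 / (sqrt l * s))\<^sup>2 = 1 / s\<^sup>2" using l by (simp add: power_divide power_mult_distrib)
    also have "1 + 1 / s\<^sup>2 * (norm z)\<^sup>2 = (s\<^sup>2 + (norm z)\<^sup>2) / s\<^sup>2"
      using s(1) by (simp add: add_divide_distrib)
    also have "\<dots> = 1 / s\<^sup>2" unfolding s(2) by simp
    finally have "sqrt (q x) = 1 / s" using s(1) by (simp add: real_sqrt_divide)
    then have "g x = z" using s(1) l by (simp add: g_def r_def x_def)
    then show "z \<in> g ` UNIV" by auto
  qed
  have cq: "continuous_on UNIV q" unfolding q_def by (intro continuous_intros)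
  have "has_bochner_integral lborel (\<lambda>x. indicator UNIV x * \<bar>det (matrix (\<lambda>h. M x *v h))\<bar>) (measure lborel (g ` UNIV))"
  proof (rule measure_differentiable_image)
    show "(g has_derivative (\<lambda>h. M x *v h)) (at x within UNIV)" for x by (rule dg)
    show "(\<lambda>x. det (matrix (\<lambda>h. M x *v h))) \<in> borel_measurable borel"
      unfolding mat det using q0
      by (intro borel_measurable_continuous_onI continuous_intros cq) (auto simp: less_imp_neq[THEN not_sym])
  qed (auto simp: img inj)
  moreover have "\<bar>det (M x)\<bar> = l ^ k / q x ^ (k + 1)" for x using det[of x] q0[of x] l by simp
  ultimately have "has_bochner_integral lborel (\<lambda>x. l ^ k / q x ^ (k + 1)) (measure lborel (ball (0 :: real^'n) 1))"
    unfolding mat img by simp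
  from has_bochner_integral_mult_right[OF this, of "2 ^ k * (real k + 1) ^ k * real ((2 * k) choose k)"]
  have "has_bochner_integral lborel (\<lambda>x. 2 ^ k * (real k + 1) ^ k * real ((2 * k) choose k) * (l ^ k / q x ^ (k + 1)))
     (2 ^ k * (real k + 1) ^ k * real ((2 * k) choose k) * measure lborel (ball (0 :: real^'n) 1))"
    by simp
  moreover have "measure lborel (ball (0 :: real^'n) 1) = pi ^ k / fact k"
    using content_ball[of 1 "0 :: real^'n"] unit_ball_vol_even[of k] by (simp add: dim)
  ultimately show ?thesis unfolding exp_bubble[OF l] q_def by (simp add: mult_ac)
qed

theorem theorem1p7:
  fixes k :: nat
  assumes "k \<ge> 2" and "CARD('n::finite) = 2 * k"
  shows "(\<forall>u :: real ^ 'n \<Rightarrow> real.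
           admissible_solution k u \<and>
           (\<exists>C>0. \<exists>R :: nat \<Rightarrow> real. filterlim R at_top sequentially \<and>
              (\<forall>j. (LINT x:ball 0 (R j)|lborel. exp (- u x / (real k + 1)))
                     \<le> C * R j ^ (CARD('n) + 2)))
           \<longrightarrow> (\<exists>x0 l. l > 0 \<and> (\<forall>x. u x = bubble k x0 l x)))
    \<and> (\<forall>(x0 :: real ^ 'n) l. l > 0 \<longrightarrow> admissible_solution k (bubble k x0 l))
    \<and> (\<forall>(x0 :: real ^ 'n) l. l > 0 \<longrightarrow>
           has_bochner_integral lborel (\<lambda>x. exp (bubble k x0 l x))
             (2 ^ k * (real k + 1) ^ k * real ((2 * k) choose k) * pi ^ k / fact k))"
proof (intro conjI allI impI)
  fix u :: "real ^ 'n \<Rightarrow> real"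
  assume "admissible_solution k u \<and>
           (\<exists>C>0. \<exists>R :: nat \<Rightarrow> real. filterlim R at_top sequentially \<and>
              (\<forall>j. (LINT x:ball 0 (R j)|lborel. exp (- u x / (real k + 1)))
                     \<le> C * R j ^ (CARD('n) + 2)))"
  then obtain C R where "admissible_solution k u" "C > 0" "filterlim R at_top sequentially"
    "\<And>j. (LINT x:ball 0 (R j)|lborel. exp (- u x / (real k + 1))) \<le> C * R j ^ (CARD('n) + 2)"
    by blast
  then show "\<exists>x0 l. l > 0 \<and> (\<forall>x. u x = bubble k x0 l x)"
    by (rule classification[OF assms])
qed (use assms bubble_admissible bubble_integral in blast)+

end
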